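(* Let $K,K'$ be number fields anabelomorphically connected along non-archimedean places $v_1,\ldots,v_n$ of $K$ and $w_1,\ldots,w_n$ of $K'$. Let $E/K$ be an elliptic curve with $j$-invariant $j_E\ne0,1728$. Assume that $E$ has potential multiplicative reduction at each of $v_1,\ldots,v_n$ and potentially good reduction at all non-archimedean $v\notin\{v_1,\ldots,v_n\}$. Then there exists an elliptic curve $E'/K'$ with $j$-invariant $j_{E'}\ne0,1728$ such that: (1) $E'/K'$ has potentially good reduction at all non-archimedean $w\notin\{w_1,\ldots,w_n\}$. (2) For $1\le i\le n$ one has $\mathrm{ord}_{v_i}(j_E)=\mathrm{ord}_{w_i}(j_{E'})$. (3) Hence $E'/K'$ has potential multiplicative reduction at all $w_i$.
   Context: Two number fields $K,K'$ are anabelomorphically connected along (distinct) non-archimedean places $v_1,\ldots,v_n$ of $K$ and (distinct) non-archimedean places $w_1,\ldots,w_n$ of $K'$ if for each $i$ there is a topological isomorphism of absolute Galois groups of the completions, $G_{K_{v_i}}\simeq G_{K'_{w_i}}$. Here $\mathrm{ord}_v$ is the valuation at $v$ normalized to have value group $\mathbb{Z}$. *)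

theory Defs
  imports
    "HOL-Algebra.Algebraic_Closure_Type"
    "HOL-Algebra.QuotRing"
    "HOL-Algebra.Bij"
    "HOL-Analysis.Abstract_Topology"
begin

section \<open>Number fields and their non-archimedean places\<close>

class number_field = field_char_0 +
  assumes finite_over_Rats: "ring.finite_dimension (ring_of_type_algebra :: 'a ring) \<rat> UNIV"

text \<open>
  A discrete valuation, normalized to have value group \<open>\<int>\<close>, on a subfield \<open>L\<close> of a type.
  The value at \<open>0\<close>, which ought to be \<open>\<infinity>\<close>, is set to \<open>0\<close> by convention.
\<close>

definition discrete_valuation :: "'a::field set \<Rightarrow> ('a \<Rightarrow> int) \<Rightarrow> bool" where
  "discrete_valuation L v \<longleftrightarrow>
     v 0 = 0 \<and>
     v ` (L - {0}) = UNIV \<and>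
     (\<forall>x\<in>L - {0}. \<forall>y\<in>L - {0}. v (x * y) = v x + v y) \<and>
     (\<forall>x\<in>L - {0}. \<forall>y\<in>L - {0}. x + y \<noteq> 0 \<longrightarrow> v (x + y) \<ge> min (v x) (v y))"

text \<open>
  Every equivalence class of nontrivial non-archimedean absolute values on a number field
  contains exactly one \<open>exp (- ord\<^sub>v)\<close> with \<open>ord\<^sub>v\<close> a normalized discrete valuation; the place
  is represented by this function \<open>ord\<^sub>v\<close>. Because of the convention at \<open>0\<close>, two places are
  equal iff the representing functions are.
\<close>

definition nonarch_place :: "('k::number_field \<Rightarrow> int) \<Rightarrow> bool" where
  "nonarch_place v \<longleftrightarrow> discrete_valuation UNIV v"

definition val_ge :: "('a::field \<Rightarrow> int) \<Rightarrow> int \<Rightarrow> 'a \<Rightarrow> bool" where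
  "val_ge v N x \<longleftrightarrow> x = 0 \<or> v x \<ge> N"

definition valuation_ring :: "'a::field set \<Rightarrow> ('a \<Rightarrow> int) \<Rightarrow> 'a ring" where
  "valuation_ring L v = ring_of_type_algebra \<lparr>carrier := {x \<in> L. val_ge v 0 x}\<rparr>"

definition valuation_ideal :: "'a::field set \<Rightarrow> ('a \<Rightarrow> int) \<Rightarrow> 'a set" where
  "valuation_ideal L v = {x \<in> L. val_ge v 1 x}"

definition residue_field :: "'a::field set \<Rightarrow> ('a \<Rightarrow> int) \<Rightarrow> 'a set ring" where
  "residue_field L v = valuation_ring L v Quot valuation_ideal L v"


section \<open>Completions\<close>

text \<open>The completion at \<open>v\<close>: Cauchy sequences modulo null sequences.\<close>

definition cauchy_seqs :: "('a::field \<Rightarrow> int) \<Rightarrow> (nat \<Rightarrow> 'a) set" where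
  "cauchy_seqs v = {s. \<forall>N. \<exists>M. \<forall>m\<ge>M. \<forall>n\<ge>M. val_ge v N (s m - s n)}"

definition null_seqs :: "('a::field \<Rightarrow> int) \<Rightarrow> (nat \<Rightarrow> 'a) set" where
  "null_seqs v = {s. \<forall>N. \<exists>M. \<forall>n\<ge>M. val_ge v N (s n)}"

definition cauchy_ring :: "('a::field \<Rightarrow> int) \<Rightarrow> (nat \<Rightarrow> 'a) ring" where
  "cauchy_ring v = \<lparr>carrier = cauchy_seqs v, monoid.mult = (\<lambda>s t n. s n * t n), one = (\<lambda>_. 1),
                    ring.zero = (\<lambda>_. 0), add = (\<lambda>s t n. s n + t n)\<rparr>"

definition completion :: "('a::field \<Rightarrow> int) \<Rightarrow> (nat \<Rightarrow> 'a) set ring" where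
  "completion v = cauchy_ring v Quot null_seqs v"


section \<open>Absolute Galois groups\<close>

text \<open>
  The library's \<open>field.alg_closure F\<close> is an algebraic closure of \<open>F\<close> with structure map
  \<open>ring.indexed_const F\<close>; for perfect \<open>F\<close> (in particular in characteristic 0) it is also a
  separable closure. Automorphisms are extensional functions on its carrier.
\<close>

abbreviation base_field :: "('a, 'm) ring_scheme \<Rightarrow> (('a list \<times> nat) multiset \<Rightarrow> 'a) set" where
  "base_field F \<equiv> ring.indexed_const F ` carrier F"

definition galois_over ::
  "('a, 'm) ring_scheme \<Rightarrow> (('a list \<times> nat) multiset \<Rightarrow> 'a) set \<Rightarrow>
   ((('a list \<times> nat) multiset \<Rightarrow> 'a) \<Rightarrow> (('a list \<times> nat) multiset \<Rightarrow> 'a)) set" where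
  "galois_over F L =
     {\<sigma> \<in> Bij (carrier (field.alg_closure F)).
        \<sigma> \<in> ring_hom (field.alg_closure F) (field.alg_closure F) \<and> (\<forall>x\<in>L. \<sigma> x = x)}"

definition absolute_galois_group ::
  "('a, 'm) ring_scheme \<Rightarrow>
   ((('a list \<times> nat) multiset \<Rightarrow> 'a) \<Rightarrow> (('a list \<times> nat) multiset \<Rightarrow> 'a)) monoid" where
  "absolute_galois_group F =
     BijGroup (carrier (field.alg_closure F)) \<lparr>carrier := galois_over F (base_field F)\<rparr>"

definition finite_intermediate_field ::
  "('a, 'm) ring_scheme \<Rightarrow> (('a list \<times> nat) multiset \<Rightarrow> 'a) set \<Rightarrow> bool" where
  "finite_intermediate_field F L \<longleftrightarrow>
     subfield L (field.alg_closure F) \<and> base_field F \<subseteq> L \<and>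
     ring.finite_dimension (field.alg_closure F) (base_field F) L"

definition krull_topology ::
  "('a, 'm) ring_scheme \<Rightarrow>
   ((('a list \<times> nat) multiset \<Rightarrow> 'a) \<Rightarrow> (('a list \<times> nat) multiset \<Rightarrow> 'a)) topology" where
  "krull_topology F =
     topology_generated_by
       {\<sigma> <#\<^bsub>absolute_galois_group F\<^esub> galois_over F L | \<sigma> L.
          \<sigma> \<in> carrier (absolute_galois_group F) \<and> finite_intermediate_field F L}"

definition galois_topologically_isomorphic ::
  "('a, 'm) ring_scheme \<Rightarrow> ('b, 'n) ring_scheme \<Rightarrow> bool" where
  "galois_topologically_isomorphic F F' \<longleftrightarrow>
     (\<exists>\<phi>. \<phi> \<in> iso (absolute_galois_group F) (absolute_galois_group F') \<and>
          homeomorphic_map (krull_topology F) (krull_topology F') \<phi>)"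

definition anabelomorphically_connected ::
  "nat \<Rightarrow> (nat \<Rightarrow> 'k::number_field \<Rightarrow> int) \<Rightarrow> (nat \<Rightarrow> 'l::number_field \<Rightarrow> int) \<Rightarrow> bool" where
  "anabelomorphically_connected n v w \<longleftrightarrow>
     (\<forall>i\<in>{1..n}. nonarch_place (v i)) \<and> inj_on v {1..n} \<and>
     (\<forall>i\<in>{1..n}. nonarch_place (w i)) \<and> inj_on w {1..n} \<and>
     (\<forall>i\<in>{1..n}. galois_topologically_isomorphic (completion (v i)) (completion (w i)))"


section \<open>Weierstrass equations and elliptic curves\<close>

text \<open>
  \<open>Weierstrass a1 a2 a3 a4 a6\<close> stands for
  \<open>y\<^sup>2 + a1 x y + a3 y = x\<^sup>3 + a2 x\<^sup>2 + a4 x + a6\<close>.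
\<close>

datatype 'a weierstrass = Weierstrass 'a 'a 'a 'a 'a

primrec discriminant :: "'a::field weierstrass \<Rightarrow> 'a" where
  "discriminant (Weierstrass a1 a2 a3 a4 a6) =
     (let b2 = a1^2 + 4 * a2;
          b4 = 2 * a4 + a1 * a3;
          b6 = a3^2 + 4 * a6;
          b8 = a1^2 * a6 + 4 * a2 * a6 - a1 * a3 * a4 + a2 * a3^2 - a4^2
      in - (b2^2 * b8) - 8 * b4^3 - 27 * b6^2 + 9 * b2 * b4 * b6)"

primrec c4_invariant :: "'a::field weierstrass \<Rightarrow> 'a" where
  "c4_invariant (Weierstrass a1 a2 a3 a4 a6) = (a1^2 + 4 * a2)^2 - 24 * (2 * a4 + a1 * a3)"

definition j_invariant :: "'a::field weierstrass \<Rightarrow> 'a" where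
  "j_invariant W = c4_invariant W ^ 3 / discriminant W"

definition elliptic_curve :: "'a::field weierstrass \<Rightarrow> bool" where
  "elliptic_curve W \<longleftrightarrow> discriminant W \<noteq> 0"

text \<open>The equation in \<open>x', y'\<close> obtained from \<open>x = u\<^sup>2 x' + r\<close>, \<open>y = u\<^sup>3 y' + s u\<^sup>2 x' + t\<close>.\<close>

primrec change_of_variables :: "'a::field \<Rightarrow> 'a \<Rightarrow> 'a \<Rightarrow> 'a \<Rightarrow> 'a weierstrass \<Rightarrow> 'a weierstrass" where
  "change_of_variables u r s t (Weierstrass a1 a2 a3 a4 a6) =
     Weierstrass
       ((a1 + 2 * s) / u)
       ((a2 - s * a1 + 3 * r - s^2) / u^2)
       ((a3 + r * a1 + 2 * t) / u^3)
       ((a4 - s * a3 + 2 * r * a2 - (t + r * s) * a1 + 3 * r^2 - 2 * s * t) / u^4)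
       ((a6 + r * a4 + r^2 * a2 + r^3 - t * a3 - t^2 - r * t * a1) / u^6)"

lemma discriminant_change_of_variables:
  assumes "u \<noteq> 0"
  shows "discriminant W = u^12 * discriminant (change_of_variables u r s t W)"
proof (cases W)
  case (Weierstrass a1 a2 a3 a4 a6)
  define A1 where "A1 = a1 + 2 * s"
  define A2 where "A2 = a2 - s * a1 + 3 * r - s^2"
  define A3 where "A3 = a3 + r * a1 + 2 * t"
  define A4 where "A4 = a4 - s * a3 + 2 * r * a2 - (t + r * s) * a1 + 3 * r^2 - 2 * s * t"
  define A6 where "A6 = a6 + r * a4 + r^2 * a2 + r^3 - t * a3 - t^2 - r * t * a1"
  note A = A1_def A2_def A3_def A4_def A6_def
  define b2 where "b2 = a1^2 + 4 * a2"
  define b4 where "b4 = 2 * a4 + a1 * a3"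
  define b6 where "b6 = a3^2 + 4 * a6"
  define b8 where "b8 = a1^2 * a6 + 4 * a2 * a6 - a1 * a3 * a4 + a2 * a3^2 - a4^2"
  note b = b2_def b4_def b6_def b8_def
  have 1: "A1^2 + 4 * A2 = b2 + 12 * r"
    and 2: "2 * A4 + A1 * A3 = b4 + r * b2 + 6 * r^2"
    and 3: "A3^2 + 4 * A6 = b6 + 2 * r * b4 + r^2 * b2 + 4 * r^3"
    and 4: "A1^2 * A6 + 4 * A2 * A6 - A1 * A3 * A4 + A2 * A3^2 - A4^2
              = b8 + 3 * r * b6 + 3 * r^2 * b4 + r^3 * b2 + 3 * r^4"
    and 5: "4 * b8 = b2 * b6 - b4^2"
    unfolding A b by (simp_all add: eval_nat_numeral algebra_simps)
  have "discriminant (Weierstrass A1 A2 A3 A4 A6)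
          = - (b2^2 * b8) - 8 * b4^3 - 27 * b6^2 + 9 * b2 * b4 * b6
            - (6 * r * b2 + 36 * r^2) * (4 * b8 - (b2 * b6 - b4^2))"
    unfolding discriminant.simps Let_def 1 2 3 4 by (simp add: eval_nat_numeral algebra_simps)
  also have "\<dots> = discriminant W"
    unfolding 5 by (simp add: Weierstrass b Let_def)
  finally have "discriminant (Weierstrass A1 A2 A3 A4 A6) = discriminant W" .
  moreover have "discriminant (Weierstrass A1 A2 A3 A4 A6)
      = u^12 * discriminant (Weierstrass (A1 / u) (A2 / u^2) (A3 / u^3) (A4 / u^4) (A6 / u^6))"
  proof -
    define B1 B2 B3 B4 B6
      where B: "B1 = A1 / u" "B2 = A2 / u^2" "B3 = A3 / u^3" "B4 = A4 / u^4" "B6 = A6 / u^6"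
    have C: "A1 = u * B1" "A2 = u^2 * B2" "A3 = u^3 * B3" "A4 = u^4 * B4" "A6 = u^6 * B6"
      using assms by (simp_all add: B)
    show ?thesis
      unfolding B [symmetric] unfolding C discriminant.simps Let_def
      by (simp add: eval_nat_numeral algebra_simps)
  qed
  ultimately show ?thesis
    by (simp only: Weierstrass change_of_variables.simps A)
qed

lemma c4_invariant_change_of_variables:
  assumes "u \<noteq> 0"
  shows "c4_invariant W = u^4 * c4_invariant (change_of_variables u r s t W)"
proof (cases W)
  case (Weierstrass a1 a2 a3 a4 a6)
  define A1 where "A1 = a1 + 2 * s"
  define A2 where "A2 = a2 - s * a1 + 3 * r - s^2"
  define A3 where "A3 = a3 + r * a1 + 2 * t"
  define A4 where "A4 = a4 - s * a3 + 2 * r * a2 - (t + r * s) * a1 + 3 * r^2 - 2 * s * t"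
  have "(a1^2 + 4 * a2)^2 - 24 * (2 * a4 + a1 * a3)
          = (A1^2 + 4 * A2)^2 - 24 * (2 * A4 + A1 * A3)"
    unfolding A1_def A2_def A3_def A4_def by (simp add: eval_nat_numeral algebra_simps)
  also have "\<dots> = u^4 * (((A1 / u)^2 + 4 * (A2 / u^2))^2
                          - 24 * (2 * (A4 / u^4) + (A1 / u) * (A3 / u^3)))"
    using assms by (simp add: field_simps eval_nat_numeral)
  finally show ?thesis
    by (simp add: Weierstrass A1_def A2_def A3_def A4_def)
qed


section \<open>Reduction types\<close>

text \<open>
  Singular points of a Weierstrass equation over a field \<open>k\<close>: with
  \<open>f = y\<^sup>2 + a1 x y + a3 y - x\<^sup>3 - a2 x\<^sup>2 - a4 x - a6\<close>, the equations say \<open>f = 0\<close>,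
  \<open>\<partial>f/\<partial>y = 0\<close> and \<open>\<partial>f/\<partial>x = 0\<close>. The point at infinity is never singular.
\<close>

primrec singular_point :: "('b, 'm) ring_scheme \<Rightarrow> 'b weierstrass \<Rightarrow> 'b \<Rightarrow> 'b \<Rightarrow> bool" where
  "singular_point k (Weierstrass a1 a2 a3 a4 a6) x y \<longleftrightarrow>
     x \<in> carrier k \<and> y \<in> carrier k \<and>
     y \<otimes>\<^bsub>k\<^esub> y \<oplus>\<^bsub>k\<^esub> a1 \<otimes>\<^bsub>k\<^esub> x \<otimes>\<^bsub>k\<^esub> y \<oplus>\<^bsub>k\<^esub> a3 \<otimes>\<^bsub>k\<^esub> y
       = x \<otimes>\<^bsub>k\<^esub> x \<otimes>\<^bsub>k\<^esub> x \<oplus>\<^bsub>k\<^esub> a2 \<otimes>\<^bsub>k\<^esub> x \<otimes>\<^bsub>k\<^esub> x \<oplus>\<^bsub>k\<^esub> a4 \<otimes>\<^bsub>k\<^esub> x \<oplus>\<^bsub>k\<^esub> a6 \<and>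
     y \<oplus>\<^bsub>k\<^esub> y \<oplus>\<^bsub>k\<^esub> a1 \<otimes>\<^bsub>k\<^esub> x \<oplus>\<^bsub>k\<^esub> a3 = \<zero>\<^bsub>k\<^esub> \<and>
     a1 \<otimes>\<^bsub>k\<^esub> y
       = x \<otimes>\<^bsub>k\<^esub> x \<oplus>\<^bsub>k\<^esub> x \<otimes>\<^bsub>k\<^esub> x \<oplus>\<^bsub>k\<^esub> x \<otimes>\<^bsub>k\<^esub> x \<oplus>\<^bsub>k\<^esub> a2 \<otimes>\<^bsub>k\<^esub> x \<oplus>\<^bsub>k\<^esub> a2 \<otimes>\<^bsub>k\<^esub> x \<oplus>\<^bsub>k\<^esub> a4"

text \<open>
  At a singular point \<open>(x, y)\<close> the Taylor expansion of \<open>f\<close> is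
  \<open>f (x + X) (y + Y) = Y\<^sup>2 + a1 X Y - (3 x + a2) X\<^sup>2 - X\<^sup>3\<close>. The point is a node iff the quadratic
  part is \<open>(Y - \<alpha> X) (Y - \<beta> X)\<close> with \<open>\<alpha> \<noteq> \<beta>\<close>, i.e. iff there are two distinct tangent
  directions.
\<close>

primrec node :: "('b, 'm) ring_scheme \<Rightarrow> 'b weierstrass \<Rightarrow> 'b \<Rightarrow> 'b \<Rightarrow> bool" where
  "node k (Weierstrass a1 a2 a3 a4 a6) x y \<longleftrightarrow>
     singular_point k (Weierstrass a1 a2 a3 a4 a6) x y \<and>
     (\<exists>\<alpha>\<in>carrier k. \<exists>\<beta>\<in>carrier k. \<alpha> \<noteq> \<beta> \<and>
        \<alpha> \<oplus>\<^bsub>k\<^esub> \<beta> = \<ominus>\<^bsub>k\<^esub> a1 \<and>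
        \<alpha> \<otimes>\<^bsub>k\<^esub> \<beta> = \<ominus>\<^bsub>k\<^esub> (x \<oplus>\<^bsub>k\<^esub> x \<oplus>\<^bsub>k\<^esub> x \<oplus>\<^bsub>k\<^esub> a2))"

definition integral_model ::
  "'a::field set \<Rightarrow> ('a \<Rightarrow> int) \<Rightarrow> 'a weierstrass \<Rightarrow> 'a weierstrass \<Rightarrow> bool" where
  "integral_model L v E W \<longleftrightarrow>
     (\<exists>u\<in>L. \<exists>r\<in>L. \<exists>s\<in>L. \<exists>t\<in>L. u \<noteq> 0 \<and> W = change_of_variables u r s t E) \<and>
     (\<forall>a\<in>set_weierstrass W. a \<in> L \<and> val_ge v 0 a)"

definition minimal_model ::
  "'a::field set \<Rightarrow> ('a \<Rightarrow> int) \<Rightarrow> 'a weierstrass \<Rightarrow> 'a weierstrass \<Rightarrow> bool" where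
  "minimal_model L v E W \<longleftrightarrow>
     integral_model L v E W \<and>
     (\<forall>W'. integral_model L v E W' \<longrightarrow> v (discriminant W) \<le> v (discriminant W'))"

text \<open>
  The reduction of an integral equation, viewed over the algebraic closure of the residue
  field, since (non)singularity is a geometric notion.
\<close>

definition reduction_field ::
  "'a::field set \<Rightarrow> ('a \<Rightarrow> int) \<Rightarrow> (('a set list \<times> nat) multiset \<Rightarrow> 'a set) ring" where
  "reduction_field L v = field.alg_closure (residue_field L v)"

definition reduced_curve ::
  "'a::field set \<Rightarrow> ('a \<Rightarrow> int) \<Rightarrow> 'a weierstrass \<Rightarrow>
   (('a set list \<times> nat) multiset \<Rightarrow> 'a set) weierstrass" where
  "reduced_curve L v W =
     map_weierstrass
       (\<lambda>x. ring.indexed_const (residue_field L v)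
              (valuation_ideal L v +>\<^bsub>valuation_ring L v\<^esub> x)) W"

definition good_reduction :: "'a::field set \<Rightarrow> ('a \<Rightarrow> int) \<Rightarrow> 'a weierstrass \<Rightarrow> bool" where
  "good_reduction L v E \<longleftrightarrow>
     (\<exists>W. minimal_model L v E W \<and>
          (\<nexists>x y. singular_point (reduction_field L v) (reduced_curve L v W) x y))"

definition multiplicative_reduction :: "'a::field set \<Rightarrow> ('a \<Rightarrow> int) \<Rightarrow> 'a weierstrass \<Rightarrow> bool" where
  "multiplicative_reduction L v E \<longleftrightarrow>
     (\<exists>W. minimal_model L v E W \<and>
          (\<exists>x y. node (reduction_field L v) (reduced_curve L v W) x y))"

text \<open>
  Finite extensions of \<open>K\<close> are taken inside \<open>K alg_closure\<close>. The place \<open>w\<close> of \<open>L\<close> lies over the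
  place \<open>v\<close> of \<open>K\<close> iff \<open>w\<close> restricted to \<open>K\<close> is \<open>e\<close> times \<open>v\<close>, \<open>e\<close> being the ramification index.
\<close>

definition finite_extension_place ::
  "('k::number_field \<Rightarrow> int) \<Rightarrow> 'k alg_closure set \<Rightarrow> ('k alg_closure \<Rightarrow> int) \<Rightarrow> bool" where
  "finite_extension_place v L w \<longleftrightarrow>
     subfield L ring_of_type_algebra \<and> range to_ac \<subseteq> L \<and>
     ring.finite_dimension ring_of_type_algebra (range to_ac) L \<and>
     discrete_valuation L w \<and>
     (\<exists>e>0. \<forall>x. x \<noteq> 0 \<longrightarrow> w (to_ac x) = e * v x)"

definition potentially_good_reduction ::
  "('k::number_field \<Rightarrow> int) \<Rightarrow> 'k weierstrass \<Rightarrow> bool" where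
  "potentially_good_reduction v E \<longleftrightarrow>
     (\<exists>L w. finite_extension_place v L w \<and> good_reduction L w (map_weierstrass to_ac E))"

definition potentially_multiplicative_reduction ::
  "('k::number_field \<Rightarrow> int) \<Rightarrow> 'k weierstrass \<Rightarrow> bool" where
  "potentially_multiplicative_reduction v E \<longleftrightarrow>
     (\<exists>L w. finite_extension_place v L w \<and> multiplicative_reduction L w (map_weierstrass to_ac E))"

end

theory Submission
  imports Defs
begin

text \<open>
  The curve \<open>E'\<close> is obtained by first choosing its \<open>j\<close>-invariant. Two local facts are used:
  a curve of potentially multiplicative reduction at \<open>v\<close> has \<open>ord\<^sub>v(j) < 0\<close>
  (\<open>potentially_multiplicative_reduction_imp_j\<close>), and, for \<open>j \<noteq> 0, 1728\<close>, a curve of integral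
  \<open>j\<close>-invariant has potentially good reduction (\<open>potentially_good_reduction_if_j_integral\<close>).
  By the first one, the integers \<open>ord\<^bsub>v\<^sub>i\<^esub>(j\<^sub>E)\<close> are negative. If \<open>j' \<in> K'\<close> has exactly these
  valuations at the \<open>w\<^sub>i\<close> and is integral at all other places, and \<open>j' \<noteq> 0, 1728\<close>, then the curve
  \<open>y\<^sup>2 + x y = x\<^sup>3 - 36 x / (j' - 1728) - 1 / (j' - 1728)\<close> has \<open>j\<close>-invariant \<open>j'\<close>, has
  potentially good reduction away from the \<open>w\<^sub>i\<close>, and at \<open>w\<^sub>i\<close> it reduces to \<open>y\<^sup>2 + x y = x\<^sup>3\<close>,
  which has a node.

  Existence of \<open>j'\<close> (\<open>exists_prescribed_valuations\<close>). Let \<open>N > 0\<close> be an integer with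
  \<open>ord\<^bsub>w\<^sub>i\<^esub>(N) > 0\<close> for all \<open>i\<close>. Only finitely many places lie over \<open>N\<close>, so weak approximation
  gives an \<open>x\<close> with the prescribed valuations at the \<open>w\<^sub>i\<close> and valuation \<open>0\<close> at the other places
  over \<open>N\<close>. As \<open>x\<close> is algebraic, \<open>d x\<close> is integral everywhere for some integer \<open>d > 0\<close>;
  multiplying \<open>x\<close> by the part of \<open>d\<close> coprime to \<open>N\<close> leaves the valuations over \<open>N\<close> unchanged
  and makes \<open>x\<close> integral elsewhere.

  Integral \<open>j\<close> implies potentially good reduction. If \<open>3\<close> is a unit at \<open>v\<close>, there is an \<open>a\<close> in the
  algebraic closure such that the Deuring form \<open>y\<^sup>2 + a x y + y = x\<^sup>3\<close> has invariant \<open>j\<close>; otherwise \<open>2\<close>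
  is a unit at \<open>v\<close> and a Legendre form \<open>y\<^sup>2 = x (x - 1) (x - l)\<close> is used. The equation that relates the
  parameter to \<open>j\<close> forces the parameter to be integral and the discriminant to be a unit. Two curves with
  the same \<open>j \<noteq> 0, 1728\<close> become isomorphic after adjoining one square root \<open>u\<close>, so good reduction
  is attained over the finite extension generated by the parameter and \<open>u\<close>.

  This needs a place of that extension above \<open>v\<close> (\<open>exists_place_above\<close>). A subring of the algebraic
  closure that contains the valuation ring of \<open>v\<close> and is maximal among those that do not contain
  \<open>1 / t\<close>, for a uniformizer \<open>t\<close>, is a valuation ring. On a finite extension \<open>L\<close> of \<open>K\<close>, every
  \<open>x \<noteq> 0\<close> satisfies \<open>x\<^sup>M = t\<^sup>k\<close> up to a unit of that ring, with a common exponent \<open>M > 0\<close>; the map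
  \<open>x \<mapsto> k\<close>, divided by the generator of its image, is the required discrete valuation.

  The reduction types are read off from the discriminant and \<open>c\<^sub>4\<close> of an integral equation: the
  discriminant reduces to \<open>0\<close> at a singular point, and at a node \<open>c\<^sub>4\<close> reduces to the fourth power of
  the difference of the two tangent directions.
\<close>


section \<open>Discrete valuations on subfields of a field\<close>

lemma ring_of_type_algebra_simps [simp]:
  "carrier (ring_of_type_algebra :: 'a::ring_1 ring) = UNIV"
  "x \<otimes>\<^bsub>ring_of_type_algebra\<^esub> y = (x * y :: 'a)"
  "x \<oplus>\<^bsub>ring_of_type_algebra\<^esub> y = (x + y :: 'a)"
  "\<one>\<^bsub>ring_of_type_algebra\<^esub> = (1 :: 'a)"
  "\<zero>\<^bsub>ring_of_type_algebra\<^esub> = (0 :: 'a)"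
  by (simp_all add: ring_of_type_algebra_def)

lemma a_inv_ring_of_type_algebra [simp]:
  "\<ominus>\<^bsub>ring_of_type_algebra\<^esub> x = - (x :: 'a::field)"
proof -
  interpret field "ring_of_type_algebra :: 'a ring" by (rule field_from_type_algebra)
  show ?thesis by (rule minus_equality) simp_all
qed

lemma m_inv_ring_of_type_algebra [simp]:
  "x \<noteq> 0 \<Longrightarrow> inv\<^bsub>ring_of_type_algebra\<^esub> x = inverse (x :: 'a::field)"
proof -
  interpret field "ring_of_type_algebra :: 'a ring" by (rule field_from_type_algebra)
  show "x \<noteq> 0 \<Longrightarrow> ?thesis" by (rule comm_inv_char) simp_all
qed

text \<open>A subfield \<open>L\<close> of a type, with a normalized discrete valuation that matters on \<open>L\<close> only.\<close>

locale valued_field =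
  fixes L :: "'a::field set" and v :: "'a \<Rightarrow> int"
  assumes subfield_L: "subfield L ring_of_type_algebra"
    and valuation: "discrete_valuation L v"
begin

lemma zero_mem [simp]: "0 \<in> L" and one_mem [simp]: "1 \<in> L"
  using subringE(2,3)[OF subfieldE(1)[OF subfield_L]] by simp_all

lemma add_mem: "x \<in> L \<Longrightarrow> y \<in> L \<Longrightarrow> x + y \<in> L"
  and mult_mem: "x \<in> L \<Longrightarrow> y \<in> L \<Longrightarrow> x * y \<in> L"
  and uminus_mem: "x \<in> L \<Longrightarrow> - x \<in> L"
  using subringE(5,6,7)[OF subfieldE(1)[OF subfield_L]] by simp_all

lemma inverse_mem: "x \<in> L \<Longrightarrow> inverse x \<in> L"
proof (cases "x = 0")
  case False
  interpret R: field "ring_of_type_algebra :: 'a ring" by (rule field_from_type_algebra)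
  assume "x \<in> L"
  with R.subfield_m_inv(1)[OF subfield_L, of x] False show ?thesis by simp
qed simp

lemma diff_mem: "x \<in> L \<Longrightarrow> y \<in> L \<Longrightarrow> x - y \<in> L"
  using add_mem[of x "- y"] uminus_mem[of y] by simp

lemma divide_mem: "x \<in> L \<Longrightarrow> y \<in> L \<Longrightarrow> x / y \<in> L"
  using mult_mem[of x "inverse y"] inverse_mem[of y] by (simp add: field_class.field_divide_inverse)

lemma power_mem: "x \<in> L \<Longrightarrow> x ^ n \<in> L"
  by (induction n) (auto intro: mult_mem)

lemma of_nat_mem: "of_nat n \<in> L"
  by (induction n) (auto intro: add_mem)

lemma of_int_mem: "of_int n \<in> L"
  by (cases n rule: int_cases2) (auto intro: of_nat_mem uminus_mem)

lemma numeral_mem: "numeral n \<in> L"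
  using of_nat_mem[of "numeral n"] by simp

lemmas mem_intros = zero_mem one_mem add_mem mult_mem uminus_mem inverse_mem diff_mem divide_mem
  power_mem of_nat_mem of_int_mem numeral_mem

lemma sum_mem: "(\<And>i. i \<in> I \<Longrightarrow> f i \<in> L) \<Longrightarrow> sum f I \<in> L"
  by (induction I rule: infinite_finite_induct) (auto intro: add_mem)

lemma v_0 [simp]: "v 0 = 0"
  using valuation by (simp add: discrete_valuation_def)

lemma v_mult: "x \<in> L \<Longrightarrow> y \<in> L \<Longrightarrow> x \<noteq> 0 \<Longrightarrow> y \<noteq> 0 \<Longrightarrow> v (x * y) = v x + v y"
  using valuation by (simp add: discrete_valuation_def)

lemma v_add: "x \<in> L \<Longrightarrow> y \<in> L \<Longrightarrow> x \<noteq> 0 \<Longrightarrow> y \<noteq> 0 \<Longrightarrow> x + y \<noteq> 0 \<Longrightarrow> v (x + y) \<ge> min (v x) (v y)"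
  using valuation by (simp add: discrete_valuation_def)

lemma v_surj: obtains x where "x \<in> L" "x \<noteq> 0" "v x = k"
proof -
  have "k \<in> v ` (L - {0})"
    using valuation by (simp add: discrete_valuation_def)
  with that show thesis by blast
qed

lemma v_1 [simp]: "v 1 = 0"
  using v_mult[of 1 1] by simp

lemma v_uminus [simp]: "x \<in> L \<Longrightarrow> v (- x) = v x"
proof (cases "x = 0")
  case False
  assume x: "x \<in> L"
  have "v (- 1) = 0"
    using v_mult[of "- 1" "- 1"] by (simp add: uminus_mem)
  with v_mult[of "- 1" x] x False show ?thesis by (simp add: uminus_mem)
qed simp

lemma v_inverse: "x \<in> L \<Longrightarrow> v (inverse x) = - v x"
proof (cases "x = 0")
  case False
  assume x: "x \<in> L"
  with v_mult[of x "inverse x"] False show ?thesis by (simp add: inverse_mem)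
qed simp

lemma v_divide: "x \<in> L \<Longrightarrow> y \<in> L \<Longrightarrow> x \<noteq> 0 \<Longrightarrow> y \<noteq> 0 \<Longrightarrow> v (x / y) = v x - v y"
  using v_mult[of x "inverse y"] v_inverse[of y]
  by (simp add: field_class.field_divide_inverse inverse_mem)

lemma v_power: "x \<in> L \<Longrightarrow> v (x ^ n) = int n * v x"
proof (cases "x = 0")
  case False
  assume "x \<in> L"
  with False show ?thesis
    by (induction n) (simp_all add: v_mult power_mem algebra_simps)
qed (auto simp: power_0_left)

lemma v_power_int: "x \<in> L \<Longrightarrow> v (power_int x k) = k * v x"
  by (auto simp: power_int_def v_power v_inverse inverse_mem)

lemma val_ge_0 [simp]: "val_ge v N 0"
  by (simp add: val_ge_def)

lemma val_ge_mono: "val_ge v N x \<Longrightarrow> M \<le> N \<Longrightarrow> val_ge v M x"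
  by (auto simp: val_ge_def)

lemma val_ge_add:
  assumes "x \<in> L" "y \<in> L" "val_ge v N x" "val_ge v N y"
  shows "val_ge v N (x + y)"
proof (cases "x = 0 \<or> y = 0 \<or> x + y = 0")
  case False
  with v_add[of x y] assms show ?thesis by (auto simp: val_ge_def)
qed (use assms in \<open>auto simp: val_ge_def\<close>)

lemma val_ge_uminus: "x \<in> L \<Longrightarrow> val_ge v N x \<Longrightarrow> val_ge v N (- x)"
  by (auto simp: val_ge_def)

lemma val_ge_diff: "x \<in> L \<Longrightarrow> y \<in> L \<Longrightarrow> val_ge v N x \<Longrightarrow> val_ge v N y \<Longrightarrow> val_ge v N (x - y)"
  using val_ge_add[of x "- y" N] val_ge_uminus[of y N] by (simp add: uminus_mem)

lemma val_ge_mult: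
  "x \<in> L \<Longrightarrow> y \<in> L \<Longrightarrow> val_ge v N x \<Longrightarrow> val_ge v M y \<Longrightarrow> val_ge v (N + M) (x * y)"
  by (cases "x = 0 \<or> y = 0") (auto simp: val_ge_def v_mult)

lemma val_ge_mult_0:
  "x \<in> L \<Longrightarrow> y \<in> L \<Longrightarrow> val_ge v 0 x \<Longrightarrow> val_ge v 0 y \<Longrightarrow> val_ge v 0 (x * y)"
  using val_ge_mult[of x y 0 0] by simp

lemma val_ge_1 [simp]: "val_ge v 0 1"
  by (simp add: val_ge_def)

lemma val_ge_power: "x \<in> L \<Longrightarrow> val_ge v 0 x \<Longrightarrow> val_ge v 0 (x ^ n)"
  by (induction n) (auto intro!: val_ge_mult_0 power_mem)

lemma val_ge_of_nat: "val_ge v 0 (of_nat n)"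
  by (induction n) (auto intro!: val_ge_add of_nat_mem)

lemma val_ge_of_int: "val_ge v 0 (of_int n)"
  by (cases n rule: int_cases2) (auto intro!: val_ge_of_nat val_ge_uminus of_nat_mem)

lemma val_ge_numeral: "val_ge v 0 (numeral n)"
  using val_ge_of_nat[of "numeral n"] by simp

lemmas val_ge_intros = val_ge_0 val_ge_1 val_ge_add val_ge_mult_0 val_ge_uminus val_ge_diff
  val_ge_power val_ge_of_nat val_ge_of_int val_ge_numeral

lemma val_ge_sum:
  "(\<And>i. i \<in> I \<Longrightarrow> f i \<in> L) \<Longrightarrow> (\<And>i. i \<in> I \<Longrightarrow> val_ge v N (f i)) \<Longrightarrow> val_ge v N (sum f I)"
  by (induction I rule: infinite_finite_induct) (auto intro: val_ge_add sum_mem)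

text \<open>Of two summands with different valuations, the smaller valuation wins.\<close>

lemma v_add_eq:
  assumes "x \<in> L" "y \<in> L" "x \<noteq> 0" "val_ge v (v x + 1) y"
  shows "x + y \<noteq> 0" "v (x + y) = v x"
proof -
  show *: "x + y \<noteq> 0"
  proof
    assume "x + y = 0"
    hence "y = - x" by (simp add: add_eq_0_iff)
    with assms show False by (auto simp: val_ge_def)
  qed
  have "val_ge v (v x) (x + y)"
    using assms by (intro val_ge_add) (auto simp: val_ge_def)
  moreover have "\<not> val_ge v (v x + 1) (x + y)"
    using val_ge_diff[of "x + y" y "v x + 1"] assms by (auto simp: val_ge_def add_mem)
  ultimately show "v (x + y) = v x" using * by (auto simp: val_ge_def)
qed

end

lemma subfield_UNIV: "subfield (UNIV :: 'a::field set) ring_of_type_algebra"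
proof -
  interpret field "ring_of_type_algebra :: 'a ring" by (rule field_from_type_algebra)
  show ?thesis using carrier_is_subfield by simp
qed

lemma valued_field_UNIV: "discrete_valuation UNIV v \<Longrightarrow> valued_field UNIV v"
  by (intro valued_field.intro subfield_UNIV)

lemma valued_field_nonarch_place: "nonarch_place v \<Longrightarrow> valued_field UNIV v"
  by (simp add: nonarch_place_def valued_field_UNIV)


section \<open>Weak approximation\<close>

lemma (in valued_field) v_one_plus_power:
  assumes "x \<in> L" "x \<noteq> 0" "k > 0" "v x > 0"
  shows "1 + x ^ k \<noteq> 0" "v (1 + x ^ k) = 0"
proof -
  have "int k * v x \<ge> 1 * 1"
    using assms by (intro mult_mono) auto
  hence "val_ge v (v 1 + 1) (x ^ k)"
    using assms by (simp add: val_ge_def v_power)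
  from v_add_eq[OF _ _ _ this] assms show "1 + x ^ k \<noteq> 0" "v (1 + x ^ k) = 0"
    by (auto simp: power_mem)
qed

text \<open>
  If the valuation ring of \<open>v\<close> were contained in that of \<open>w\<close>, units for \<open>v\<close> would be units for \<open>w\<close>,
  so \<open>w\<close> would be a multiple of \<open>v\<close>, and equal to \<open>v\<close> because both are onto \<open>\<int>\<close>.
\<close>

lemma exists_separating_two:
  fixes v w :: "'a::field \<Rightarrow> int"
  assumes v: "discrete_valuation UNIV v" and w: "discrete_valuation UNIV w" and "v \<noteq> w"
  shows "\<exists>x. x \<noteq> 0 \<and> v x \<ge> 0 \<and> w x < 0"
proof (rule ccontr)
  interpret V: valued_field UNIV v by (rule valued_field_UNIV[OF v])
  interpret W: valued_field UNIV w by (rule valued_field_UNIV[OF w])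
  assume "\<not> ?thesis"
  hence *: "w x \<ge> 0" if "x \<noteq> 0" "v x \<ge> 0" for x using that by force
  have 0: "w x = 0" if "x \<noteq> 0" "v x = 0" for x
    using *[of x] *[of "inverse x"] that V.v_inverse[of x] W.v_inverse[of x] by simp
  obtain p where p: "p \<noteq> 0" "v p = 1" by (rule V.v_surj)
  have eq: "w x = v x * w p" if "x \<noteq> 0" for x
  proof -
    have "v (x * power_int p (- v x)) = 0"
      using that p by (simp add: V.v_mult V.v_power_int)
    hence "w (x * power_int p (- v x)) = 0"
      using that p by (intro 0) auto
    thus ?thesis using that p by (simp add: W.v_mult W.v_power_int)
  qed
  obtain q where q: "q \<noteq> 0" "w q = 1" by (rule W.v_surj)
  have "v q * w p = 1" using eq[OF q(1)] q by simp
  hence "w p = 1"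
    \<comment> \<open>the other possibility, \<open>w p = - 1\<close>, contradicts \<open>*\<close>\<close>
    using *[of p] p zmult_eq_1_iff[of "v q" "w p"] by auto
  hence "w x = v x" for x
    using eq[of x] by (cases "x = 0") auto
  with \<open>v \<noteq> w\<close> show False by auto
qed

text \<open>
  Induction on \<open>S\<close>: \<open>x\<close> serves for \<open>S\<close> and \<open>y\<close> for the new valuation \<open>w\<close>. If \<open>w x < 0\<close>, take \<open>x\<close>
  itself; otherwise, with \<open>k\<close> large, take \<open>y x\<^sup>k\<close> if \<open>w x = 0\<close> and \<open>y (1 + x\<^sup>k)\<close> if \<open>w x > 0\<close>.
\<close>

lemma exists_separating:
  fixes v :: "'a::field \<Rightarrow> int"
  assumes "finite S" and v: "discrete_valuation UNIV v"
    and S: "\<And>w. w \<in> S \<Longrightarrow> discrete_valuation UNIV w" and "v \<notin> S"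
  shows "\<exists>x. x \<noteq> 0 \<and> v x > 0 \<and> (\<forall>w\<in>S. w x < 0)"
  using assms(1,3,4)
proof (induction S rule: finite_induct)
  case empty
  interpret V: valued_field UNIV v by (rule valued_field_UNIV[OF v])
  show ?case using V.v_surj[of 1] by (metis empty_iff zero_less_one)
next
  case (insert w S)
  interpret V: valued_field UNIV v by (rule valued_field_UNIV[OF v])
  have dw: "discrete_valuation UNIV w" using insert.prems by simp
  interpret W: valued_field UNIV w by (rule valued_field_UNIV[OF dw])
  have vf: "valued_field UNIV w'" if "w' \<in> S" for w'
    using that insert.prems by (intro valued_field_UNIV) auto
  have "v \<noteq> w" using insert.prems by auto
  obtain a b where a: "a \<noteq> 0" "v a \<ge> 0" "w a < 0" and b: "b \<noteq> 0" "w b \<ge> 0" "v b < 0"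
    using exists_separating_two[OF v dw \<open>v \<noteq> w\<close>] exists_separating_two[OF dw v \<open>v \<noteq> w\<close>[symmetric]]
    by blast
  define y where "y = a / b"
  have y: "y \<noteq> 0" "v y > 0" "w y < 0"
    using a b by (auto simp: y_def V.v_divide W.v_divide)
  obtain x where x: "x \<noteq> 0" "v x > 0" "\<And>w'. w' \<in> S \<Longrightarrow> w' x < 0"
    using insert.IH insert.prems by auto
  define k where "k = nat (Max (insert 0 ((\<lambda>w'. \<bar>w' y\<bar>) ` S))) + 1"
  have k: "\<bar>w' y\<bar> < int k" if "w' \<in> S" for w'
  proof -
    have "\<bar>w' y\<bar> \<le> Max (insert 0 ((\<lambda>w'. \<bar>w' y\<bar>) ` S))"
      using that insert.hyps by (intro Max_ge) auto
    thus ?thesis unfolding k_def by linarith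
  qed
  have k_pos: "k > 0" by (simp add: k_def)
  have large: "w' y + int k * w' x < 0" if "w' \<in> S" for w'
  proof -
    have "int k * w' x \<le> int k * (-1)"
      using x(3)[OF that] by (intro mult_left_mono) auto
    with k[OF that] show ?thesis by linarith
  qed
  consider "w x < 0" | "w x = 0" | "w x > 0" by linarith
  thus ?case
  proof cases
    case 1
    with x show ?thesis by auto
  next
    case 2
    have "v (y * x ^ k) > 0"
      using x y by (simp add: V.v_mult V.v_power add_pos_nonneg)
    moreover have "w (y * x ^ k) < 0"
      using x y 2 by (simp add: W.v_mult W.v_power)
    moreover have "w' (y * x ^ k) < 0" if "w' \<in> S" for w'
    proof -
      interpret U: valued_field UNIV w' by (rule vf[OF that])
      show ?thesis using x y large[OF that] by (simp add: U.v_mult U.v_power)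
    qed
    ultimately show ?thesis using x y by (intro exI[of _ "y * x ^ k"]) auto
  next
    case 3
    have nz: "1 + x ^ k \<noteq> 0" "v (1 + x ^ k) = 0"
      using V.v_one_plus_power[of x k] x k_pos by auto
    have w0: "w (1 + x ^ k) = 0"
      using W.v_one_plus_power[of x k] x 3 k_pos by auto
    have "v (y * (1 + x ^ k)) > 0"
      using x y nz by (simp add: V.v_mult)
    moreover have "w (y * (1 + x ^ k)) < 0"
      using x y nz w0 by (simp add: W.v_mult)
    moreover have "w' (y * (1 + x ^ k)) < 0" if "w' \<in> S" for w'
    proof -
      interpret U: valued_field UNIV w' by (rule vf[OF that])
      have "w' (x ^ k) < 0"
        using x(3)[OF that] k_pos by (simp add: U.v_power mult_pos_neg)
      hence "w' (x ^ k + 1) = w' (x ^ k)"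
        using x by (intro U.v_add_eq) (auto simp: val_ge_def)
      hence "w' (1 + x ^ k) = w' (x ^ k)" by (simp add: add.commute)
      thus ?thesis using x y nz large[OF that] by (simp add: U.v_mult U.v_power)
    qed
    ultimately show ?thesis using x y nz by (intro exI[of _ "y * (1 + x ^ k)"]) auto
  qed
qed

text \<open>The element is \<open>1 / (1 + x\<^sup>m)\<close> with \<open>x\<close> separating \<open>v\<close> from \<open>S\<close>.\<close>

lemma exists_almost_idempotent:
  fixes v :: "'a::field \<Rightarrow> int"
  assumes "finite S" and v: "discrete_valuation UNIV v"
    and S: "\<And>w. w \<in> S \<Longrightarrow> discrete_valuation UNIV w" and "v \<notin> S"
  shows "\<exists>e. e \<noteq> 0 \<and> v e = 0 \<and> (\<forall>w\<in>S. w e \<ge> int k)"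
proof -
  interpret V: valued_field UNIV v by (rule valued_field_UNIV[OF v])
  obtain x where x: "x \<noteq> 0" "v x > 0" "\<And>w. w \<in> S \<Longrightarrow> w x < 0"
    using exists_separating[OF assms] by blast
  define m where "m = Suc k"
  have nz: "1 + x ^ m \<noteq> 0" "v (1 + x ^ m) = 0"
    using V.v_one_plus_power[of x m] x by (auto simp: m_def)
  have "w (inverse (1 + x ^ m)) \<ge> int k" if "w \<in> S" for w
  proof -
    interpret U: valued_field UNIV w using that S by (intro valued_field_UNIV) auto
    have *: "int m * w x \<le> int m * (-1)"
      using x(3)[OF that] by (intro mult_left_mono) auto
    hence "w (x ^ m) < 0" by (simp add: m_def U.v_power del: power_Suc)
    hence "w (x ^ m + 1) = w (x ^ m)"
      using x by (intro U.v_add_eq) (auto simp: val_ge_def)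
    thus ?thesis using * by (simp add: U.v_inverse U.v_power add.commute m_def del: power_Suc)
  qed
  thus ?thesis using nz by (intro exI[of _ "inverse (1 + x ^ m)"]) (auto simp: V.v_inverse)
qed

lemma weak_approximation:
  fixes S :: "('a::field \<Rightarrow> int) set" and t :: "('a \<Rightarrow> int) \<Rightarrow> int"
  assumes fin: "finite S" and S: "\<And>w. w \<in> S \<Longrightarrow> discrete_valuation UNIV w"
  shows "\<exists>x. x \<noteq> 0 \<and> (\<forall>w\<in>S. w x = t w)"
proof -
  have "\<exists>p. p \<noteq> 0 \<and> w p = t w" if "w \<in> S" for w
  proof -
    interpret valued_field UNIV w using that S by (intro valued_field_UNIV) auto
    show ?thesis using v_surj[of "t w"] by metis
  qed
  then obtain p where p: "\<And>w. w \<in> S \<Longrightarrow> p w \<noteq> 0 \<and> w (p w) = t w" by metis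
  define B where "B = (\<lambda>(w, w'). \<bar>t w\<bar> + \<bar>w (p w')\<bar>) ` (S \<times> S)"
  define k where "k = nat (Max (insert 0 B)) + 1"
  have k: "t w - w (p w') < int k" if "w \<in> S" "w' \<in> S" for w w'
  proof -
    have "\<bar>t w\<bar> + \<bar>w (p w')\<bar> \<le> Max (insert 0 B)"
      using that fin unfolding B_def by (intro Max_ge) auto
    thus ?thesis unfolding k_def by linarith
  qed
  have "\<exists>e. e \<noteq> 0 \<and> w e = 0 \<and> (\<forall>w'\<in>S - {w}. w' e \<ge> int k)" if "w \<in> S" for w
    using that fin S by (intro exists_almost_idempotent) auto
  then obtain e where e: "\<And>w. w \<in> S \<Longrightarrow> e w \<noteq> 0 \<and> w (e w) = 0 \<and> (\<forall>w'\<in>S - {w}. w' (e w) \<ge> int k)"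
    by metis
  define x where "x = (\<Sum>w\<in>S. e w * p w)"
  have x: "x \<noteq> 0 \<and> w x = t w" if w: "w \<in> S" for w
  proof -
    interpret valued_field UNIV w using w S by (intro valued_field_UNIV) auto
    have "x = e w * p w + (\<Sum>w'\<in>S - {w}. e w' * p w')"
      unfolding x_def using fin w by (rule sum.remove)
    moreover have ew: "w (e w * p w) = t w" "e w * p w \<noteq> 0"
      using e[OF w] p[OF w] by (auto simp: v_mult)
    moreover have "val_ge w (t w + 1) (\<Sum>w'\<in>S - {w}. e w' * p w')"
    proof (rule val_ge_sum)
      fix w' assume w': "w' \<in> S - {w}"
      have "w (e w') \<ge> int k" using e[of w'] w w' by auto
      moreover have "w (e w' * p w') = w (e w') + w (p w')"
        using e[of w'] p[of w'] w' by (simp add: v_mult)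
      ultimately show "val_ge w (t w + 1) (e w' * p w')"
        using k[of w w'] w w' by (auto simp: val_ge_def)
    qed auto
    ultimately show ?thesis using v_add_eq[of "e w * p w"] by auto
  qed
  show ?thesis
  proof (cases "S = {}")
    case True
    thus ?thesis by (intro exI[of _ 1]) auto
  next
    case False
    with x show ?thesis by blast
  qed
qed


section \<open>Elements of a number field with prescribed valuations\<close>

lemma combine_eq_sum:
  "length Ks = length Us \<Longrightarrow>
     ring.combine (ring_of_type_algebra :: 'a::field ring) Ks Us = (\<Sum>i<length Us. Ks ! i * Us ! i)"
proof (induction Ks Us rule: list_induct2)
  case Nil
  interpret field "ring_of_type_algebra :: 'a ring" by (rule field_from_type_algebra)
  show ?case by simp
next
  case (Cons k Ks u Us)
  interpret field "ring_of_type_algebra :: 'a ring" by (rule field_from_type_algebra)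
  show ?case using Cons by (simp add: sum.lessThan_Suc_shift del: sum.lessThan_Suc)
qed

text \<open>
  Finite dimension, restated as: any sufficiently long family in \<open>E\<close> satisfies a nontrivial linear
  relation over \<open>K\<close>. The family may have repetitions.
\<close>

lemma finite_dimension_linear_relation:
  fixes K E :: "'a::field set"
  assumes K: "subfield K ring_of_type_algebra"
    and fin: "ring.finite_dimension ring_of_type_algebra K E"
  obtains d where
    "\<And>m (f :: nat \<Rightarrow> 'a). d < m \<Longrightarrow> (\<And>i. i < m \<Longrightarrow> f i \<in> E) \<Longrightarrow>
       \<exists>c. (\<forall>i<m. c i \<in> K) \<and> (\<exists>i<m. c i \<noteq> 0) \<and> (\<Sum>i<m. c i * f i) = 0"
proof -
  interpret R: field "ring_of_type_algebra :: 'a ring" by (rule field_from_type_algebra)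
  obtain d where d: "R.dimension d K E"
    using fin by (auto simp: R.finite_dimension_def)
  show thesis
  proof (rule that)
    fix m :: nat and f :: "nat \<Rightarrow> 'a"
    assume m: "d < m" and f: "\<And>i. i < m \<Longrightarrow> f i \<in> E"
    define Us where "Us = map f [0..<m]"
    have Us: "set Us \<subseteq> E" "length Us = m" using f by (auto simp: Us_def)
    have "R.dependent K Us"
      using R.independent_length_le_dimension[OF K d _ Us(1)] Us m by auto
    then obtain Ks where Ks: "length Ks = length Us" "R.combine Ks Us = 0" "set Ks \<subseteq> K" "set Ks \<noteq> {0}"
      using R.dependent_imp_non_trivial_combine[OF K, of Us] by auto
    have "(\<Sum>i<m. Ks ! i * f i) = R.combine Ks Us"
      by (subst combine_eq_sum[OF Ks(1)]) (simp add: Us_def)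
    hence 1: "(\<Sum>i<m. Ks ! i * f i) = 0" using Ks by simp
    have "\<exists>i<m. Ks ! i \<noteq> 0"
    proof (rule ccontr)
      assume "\<not> ?thesis"
      hence "set Ks \<subseteq> {0}" using Ks(1) Us(2) by (auto simp: in_set_conv_nth)
      moreover have "set Ks \<noteq> {}" using Ks(1) Us(2) m by auto
      ultimately show False using Ks(4) by (auto simp only: subset_singleton_iff)
    qed
    moreover have "\<forall>i<m. Ks ! i \<in> K"
      using Ks(1,3) Us(2) by (auto intro: subsetD[OF _ nth_mem])
    ultimately show "\<exists>c. (\<forall>i<m. c i \<in> K) \<and> (\<exists>i<m. c i \<noteq> 0) \<and> (\<Sum>i<m. c i * f i) = 0"
      using 1 by blast
  qed
qed

lemma subfield_Rats: "subfield (\<rat> :: 'a::field_char_0 set) ring_of_type_algebra"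
proof -
  interpret R: field "ring_of_type_algebra :: 'a ring" by (rule field_from_type_algebra)
  show ?thesis
  proof (rule R.subfieldI')
    show "subring \<rat> (ring_of_type_algebra :: 'a ring)"
      by (intro R.subringI) simp_all
  qed auto
qed

lemma number_field_integer_relation:
  obtains d where
    "\<And>m (f :: nat \<Rightarrow> 'a::number_field). d < m \<Longrightarrow>
       \<exists>c :: nat \<Rightarrow> int. (\<exists>i<m. c i \<noteq> 0) \<and> (\<Sum>i<m. of_int (c i) * f i) = 0"
proof -
  obtain d where d: "\<And>m (f :: nat \<Rightarrow> 'a). d < m \<Longrightarrow> (\<And>i. i < m \<Longrightarrow> f i \<in> UNIV) \<Longrightarrow>
       \<exists>c. (\<forall>i<m. c i \<in> \<rat>) \<and> (\<exists>i<m. c i \<noteq> 0) \<and> (\<Sum>i<m. c i * f i) = 0"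
    using finite_dimension_linear_relation[OF subfield_Rats finite_over_Rats] by blast
  show thesis
  proof (rule that)
    fix m :: nat and f :: "nat \<Rightarrow> 'a"
    assume m: "d < m"
    obtain c where "(\<forall>i<m. c i \<in> \<rat>) \<and> (\<exists>i<m. c i \<noteq> 0) \<and> (\<Sum>i<m. c i * f i) = 0"
      using d[OF m, of f] by auto
    hence c: "\<And>i. i < m \<Longrightarrow> c i \<in> \<rat>" "\<exists>i<m. c i \<noteq> 0" "(\<Sum>i<m. c i * f i) = 0"
      by auto
    have "\<exists>a b. b \<noteq> 0 \<and> c i = of_int a / of_int b" if "i < m" for i
      using c(1)[OF that] by (metis Rats_cases' of_int_0_eq_iff less_irrefl)
    then obtain a b where ab: "\<And>i. i < m \<Longrightarrow> b i \<noteq> 0 \<and> c i = of_int (a i) / of_int (b i)"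
      by metis
    define g where "g i = a i * (\<Prod>j\<in>{..<m} - {i}. b j)" for i
    have g: "of_int (g i) = of_int (\<Prod>j<m. b j) * c i" if "i < m" for i
    proof -
      have "(\<Prod>j<m. b j) = b i * (\<Prod>j\<in>{..<m} - {i}. b j)"
        using that by (intro prod.remove) auto
      thus ?thesis using ab[OF that] by (simp add: g_def)
    qed
    have nz: "(\<Prod>j<m. b j) \<noteq> 0" using ab by auto
    have "\<exists>i<m. g i \<noteq> 0"
    proof -
      obtain i where i: "i < m" "c i \<noteq> 0" using c(2) by blast
      have "(of_int (g i) :: 'a) \<noteq> 0" using g[OF i(1)] i(2) nz by (metis mult_eq_0_iff of_int_0_eq_iff)
      thus ?thesis using i by auto
    qed
    moreover have "(\<Sum>i<m. of_int (g i) * f i) = of_int (\<Prod>j<m. b j) * (\<Sum>i<m. c i * f i)"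
      unfolding sum_distrib_left using g by (intro sum.cong) (auto simp: mult.assoc)
    ultimately show "\<exists>c :: nat \<Rightarrow> int. (\<exists>i<m. c i \<noteq> 0) \<and> (\<Sum>i<m. of_int (c i) * f i) = 0"
      using c(3) by auto
  qed
qed

lemma number_field_primitive_relation:
  obtains d where
    "\<And>m (f :: nat \<Rightarrow> 'a::number_field) p. d < m \<Longrightarrow> prime p \<Longrightarrow>
       \<exists>c :: nat \<Rightarrow> int. (\<exists>i<m. \<not> p dvd c i) \<and> (\<Sum>i<m. of_int (c i) * f i) = 0"
proof -
  obtain d where d: "\<And>m (f :: nat \<Rightarrow> 'a). d < m \<Longrightarrow>
       \<exists>c :: nat \<Rightarrow> int. (\<exists>i<m. c i \<noteq> 0) \<and> (\<Sum>i<m. of_int (c i) * f i) = 0"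
    using number_field_integer_relation[where 'a = 'a] by blast
  show thesis
  proof (rule that)
    fix m :: nat and f :: "nat \<Rightarrow> 'a" and p :: int
    assume m: "d < m" and p: "prime p"
    obtain c :: "nat \<Rightarrow> int" where c: "\<exists>i<m. c i \<noteq> 0" "(\<Sum>i<m. of_int (c i) * f i) = 0"
      using d[OF m] by blast
    define g where "g = Gcd (c ` {..<m})"
    have g: "g \<noteq> 0" "\<And>i. i < m \<Longrightarrow> g dvd c i" using c(1) by (auto simp: g_def)
    have "\<exists>i<m. \<not> p dvd c i div g"
    proof (rule ccontr)
      assume "\<not> ?thesis"
      hence "p * g dvd c i" if "i < m" for i
        using that g by (metis dvd_div_mult_self dvd_refl mult_dvd_mono)
      hence "p * g dvd g" unfolding g_def by (intro Gcd_greatest) auto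
      hence "p dvd 1" using g by (simp add: dvd_times_right_cancel_iff[of g p 1, simplified])
      with p show False by auto
    qed
    moreover have "of_int g * (\<Sum>i<m. of_int (c i div g) * f i) = (\<Sum>i<m. of_int (c i) * f i)"
      unfolding sum_distrib_left using g
      by (intro sum.cong) (auto simp flip: mult.assoc of_int_mult)
    ultimately show "\<exists>c :: nat \<Rightarrow> int. (\<exists>i<m. \<not> p dvd c i) \<and> (\<Sum>i<m. of_int (c i) * f i) = 0"
      using c(2) g(1) by (intro exI[of _ "\<lambda>i. c i div g"]) auto
  qed
qed

lemma (in valued_field) v_of_int_eq_0:
  assumes "coprime a b" "a \<noteq> 0" "v (of_int a) > 0" "of_int b \<noteq> (0 :: 'a)"
  shows "v (of_int b) = 0"
proof (rule ccontr)
  assume "v (of_int b) \<noteq> 0"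
  hence b: "val_ge v 1 (of_int b)" using val_ge_of_int[of b] by (auto simp: val_ge_def)
  obtain x y where "x * a + y * b = 1"
    using assms(1) by (metis bezout_int coprime_iff_gcd_eq_1)
  hence 1: "of_int x * of_int a + of_int y * of_int b = (1 :: 'a)"
    by (metis of_int_1 of_int_add of_int_mult)
  have "val_ge v (0 + 1) (of_int x * of_int a)" "val_ge v (0 + 1) (of_int y * of_int b)"
    using assms b by (intro val_ge_mult mem_intros val_ge_intros; simp add: val_ge_def)+
  hence "val_ge v 1 (of_int x * of_int a + of_int y * of_int b)"
    by (intro val_ge_add mem_intros) auto
  thus False unfolding 1 by (simp add: val_ge_def)
qed

text \<open>
  If \<open>w\<^sub>0, \<dots>, w\<^sub>d\<close> are distinct places over \<open>p\<close> and \<open>e\<^sub>i\<close> has valuation \<open>0\<close> at \<open>w\<^sub>i\<close> and positive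
  valuation at the others, then in a relation \<open>\<Sum> c\<^sub>i e\<^sub>i = 0\<close> with integers \<open>c\<^sub>i\<close> not all divisible by
  \<open>p\<close>, a term with \<open>p\<close> not dividing \<open>c\<^sub>i\<close> is the only one of valuation \<open>0\<close> at \<open>w\<^sub>i\<close>. So the number
  of places over \<open>p\<close> is bounded by the degree of the field.
\<close>

lemma finite_places_over_prime:
  fixes p :: int
  assumes "prime p"
  shows "finite {w :: 'a::number_field \<Rightarrow> int. nonarch_place w \<and> w (of_int p) > 0}" (is "finite ?P")
proof (rule ccontr)
  assume inf: "infinite ?P"
  obtain d where d: "\<And>m (f :: nat \<Rightarrow> 'a) p. d < m \<Longrightarrow> prime p \<Longrightarrow>
       \<exists>c :: nat \<Rightarrow> int. (\<exists>i<m. \<not> p dvd c i) \<and> (\<Sum>i<m. of_int (c i) * f i) = 0"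
    using number_field_primitive_relation[where 'a = 'a] by blast
  obtain S where S: "S \<subseteq> ?P" "finite S" "card S = Suc d"
    using inf by (meson infinite_arbitrarily_large)
  obtain h where h: "bij_betw h {..<Suc d} S"
    using S by (metis ex_bij_betw_nat_finite lessThan_atLeast0)
  have hS: "h i \<in> S" if "i < Suc d" for i
    using h that by (auto simp: bij_betw_def)
  have dv: "discrete_valuation UNIV w" if "w \<in> S" for w
    using that S by (auto simp: nonarch_place_def)
  have "\<exists>e. e \<noteq> 0 \<and> w e = 0 \<and> (\<forall>w'\<in>S - {w}. w' e \<ge> int 1)" if "w \<in> S" for w
    using that S dv by (intro exists_almost_idempotent) auto
  then obtain e where e: "\<And>w. w \<in> S \<Longrightarrow> e w \<noteq> 0 \<and> w (e w) = 0 \<and> (\<forall>w'\<in>S - {w}. w' (e w) \<ge> 1)"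
    by (metis of_nat_1)
  obtain c :: "nat \<Rightarrow> int" and i where c: "i < Suc d" "\<not> p dvd c i"
      "(\<Sum>i<Suc d. of_int (c i) * e (h i)) = 0"
    using d[of "Suc d" p "\<lambda>i. e (h i)"] assms by auto
  interpret valued_field UNIV "h i" using hS[OF c(1)] dv by (intro valued_field_UNIV)
  have "c i \<noteq> 0" using c by auto
  have "coprime p (c i)" using assms c(2) by (simp add: prime_imp_coprime)
  hence "h i (of_int (c i)) = 0"
    using S hS[OF c(1)] assms \<open>c i \<noteq> 0\<close> by (intro v_of_int_eq_0[of p]) auto
  hence 0: "h i (of_int (c i) * e (h i)) = 0" "of_int (c i) * e (h i) \<noteq> 0"
    using e[OF hS[OF c(1)]] \<open>c i \<noteq> 0\<close> by (auto simp: v_mult)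
  have "val_ge (h i) 1 (\<Sum>j\<in>{..<Suc d} - {i}. of_int (c j) * e (h j))"
  proof (rule val_ge_sum)
    fix j assume j: "j \<in> {..<Suc d} - {i}"
    hence "h i \<noteq> h j" using h c(1) by (auto simp: bij_betw_def inj_on_def)
    hence "h i (e (h j)) \<ge> 1" using e[OF hS[of j]] hS[of i] c(1) j by auto
    hence "val_ge (h i) (0 + 1) (of_int (c j) * e (h j))"
      by (intro val_ge_mult val_ge_of_int) (auto simp: val_ge_def)
    thus "val_ge (h i) 1 (of_int (c j) * e (h j))" by simp
  qed auto
  with 0 have "of_int (c i) * e (h i) + (\<Sum>j\<in>{..<Suc d} - {i}. of_int (c j) * e (h j)) \<noteq> 0"
    by (intro v_add_eq) auto
  moreover have "(\<Sum>j<Suc d. of_int (c j) * e (h j)) =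
      of_int (c i) * e (h i) + (\<Sum>j\<in>{..<Suc d} - {i}. of_int (c j) * e (h j))"
    using c(1) by (intro sum.remove) auto
  ultimately show False using c(3) by simp
qed

text \<open>
  The leading coefficient \<open>c\<^sub>m\<close> of an integer equation for \<open>x\<close> serves as denominator: if
  \<open>c\<^sub>m x\<close> had negative valuation, the leading term would have strictly smallest valuation.
\<close>

lemma common_denominator:
  fixes x :: "'a::number_field"
  obtains d :: int where "d > 0" "\<And>w :: 'a \<Rightarrow> int. nonarch_place w \<Longrightarrow> val_ge w 0 (of_int d * x)"
proof (cases "x = 0")
  case True
  with that[of 1] show thesis by (simp add: val_ge_def)
next
  case False
  obtain d where d: "\<And>m (f :: nat \<Rightarrow> 'a). d < m \<Longrightarrow>
       \<exists>c :: nat \<Rightarrow> int. (\<exists>i<m. c i \<noteq> 0) \<and> (\<Sum>i<m. of_int (c i) * f i) = 0"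
    using number_field_integer_relation[where 'a = 'a] by blast
  obtain c :: "nat \<Rightarrow> int" where c: "\<exists>i<Suc d. c i \<noteq> 0" "(\<Sum>i<Suc d. of_int (c i) * x ^ i) = 0"
    using d[of "Suc d"] by blast
  define m where "m = Max {i. i < Suc d \<and> c i \<noteq> 0}"
  have m: "m < Suc d" "c m \<noteq> 0"
    using Max_in[of "{i. i < Suc d \<and> c i \<noteq> 0}"] c(1) by (auto simp: m_def)
  have m_max: "c i = 0" if "i < Suc d" "i > m" for i
  proof (rule ccontr)
    assume "c i \<noteq> 0"
    hence "i \<le> m" unfolding m_def using that by (intro Max_ge) auto
    with that show False by simp
  qed
  have rel: "of_int (c m) * x ^ m + (\<Sum>i<m. of_int (c i) * x ^ i) = 0"
  proof -
    have "(\<Sum>i<Suc d. of_int (c i) * x ^ i) = (\<Sum>i<Suc m. of_int (c i) * x ^ i)"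
      using m m_max by (intro sum.mono_neutral_right) auto
    thus ?thesis using c(2) by (simp add: add.commute)
  qed
  show thesis
  proof (rule that[of "\<bar>c m\<bar>"])
    show "\<bar>c m\<bar> > 0" using m by simp
    fix w :: "'a \<Rightarrow> int" assume "nonarch_place w"
    then interpret valued_field UNIV w by (intro valued_field_nonarch_place)
    have "val_ge w 0 (of_int (c m) * x)"
    proof (rule ccontr)
      assume neg: "\<not> val_ge w 0 (of_int (c m) * x)"
      have cm: "w (of_int (c m)) \<ge> 0" using val_ge_of_int[of "c m"] m by (auto simp: val_ge_def)
      from neg have neg: "w (of_int (c m)) + w x < 0" using m False
        by (auto simp: val_ge_def v_mult)
      have "m \<noteq> 0" using rel m by (cases m) auto
      have wm: "w (of_int (c m) * x ^ m) = w (of_int (c m)) + int m * w x"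
        using m False by (simp add: v_mult v_power)
      have "val_ge w ((int m - 1) * w x) (\<Sum>i<m. of_int (c i) * x ^ i)"
      proof (rule val_ge_sum)
        fix i assume i: "i \<in> {..<m}"
        have "(int m - 1) * w x \<le> int i * w x"
          using i cm neg by (intro mult_right_mono_neg) auto
        hence "val_ge w (0 + (int m - 1) * w x) (of_int (c i) * x ^ i)"
          by (intro val_ge_mult val_ge_of_int) (auto simp: val_ge_def v_power)
        thus "val_ge w ((int m - 1) * w x) (of_int (c i) * x ^ i)" by simp
      qed auto
      moreover have "w (of_int (c m) * x ^ m) + 1 \<le> (int m - 1) * w x"
        using wm neg by (simp add: algebra_simps)
      ultimately have "of_int (c m) * x ^ m + (\<Sum>i<m. of_int (c i) * x ^ i) \<noteq> 0"
        using m False by (intro v_add_eq) (auto intro: val_ge_mono)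
      with rel show False by simp
    qed
    thus "val_ge w 0 (of_int \<bar>c m\<bar> * x)"
      by (cases "c m \<ge> 0") (auto dest: val_ge_uminus[rotated])
  qed
qed

text \<open>
  No place is trivial on \<open>\<int>\<close>: the common denominator of an element of valuation \<open>- 1\<close> has positive
  valuation.
\<close>

lemma place_nontrivial_on_int:
  fixes w :: "'a::number_field \<Rightarrow> int"
  assumes "nonarch_place w"
  obtains d :: int where "d > 0" "w (of_int d) > 0"
proof -
  interpret valued_field UNIV w
    using assms by (intro valued_field_nonarch_place)
  obtain x where x: "x \<noteq> 0" "w x = -1" by (rule v_surj)
  obtain d :: int where d: "d > 0" "val_ge w 0 (of_int d * x)"
    using common_denominator[of x] assms by blast
  show thesis using that[of d] d x by (auto simp: val_ge_def v_mult)
qed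

lemma finite_places_over_int:
  fixes N :: int
  assumes "N > 0"
  shows "finite {w :: 'a::number_field \<Rightarrow> int. nonarch_place w \<and> w (of_int N) > 0}"
  using assms
proof (induction "nat N" arbitrary: N rule: less_induct)
  case less
  show ?case
  proof (cases "N = 1")
    case True
    have "\<not> w (of_int N) > 0" if "nonarch_place w" for w :: "'a \<Rightarrow> int"
    proof -
      interpret valued_field UNIV w
        using that by (intro valued_field_nonarch_place)
      show ?thesis using True by simp
    qed
    thus ?thesis by (metis (mono_tags, lifting) Collect_empty_eq finite.emptyI)
  next
    case False
    with less.prems have "\<bar>N\<bar> \<noteq> 1" by simp
    then obtain p where p: "prime p" "p dvd N"
      using prime_factor_int by blast
    then obtain M where M: "N = p * M" by blast
    have p2: "p \<ge> 2" using p by (simp add: prime_ge_2_int)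
    hence "M > 0" using M less.prems by (simp add: zero_less_mult_iff)
    moreover have "1 * M < p * M" using p2 \<open>M > 0\<close> by (intro mult_strict_right_mono) auto
    hence "nat M < nat N" using M \<open>M > 0\<close> by simp
    ultimately have fin: "finite {w :: 'a \<Rightarrow> int. nonarch_place w \<and> w (of_int M) > 0}"
      by (intro less.hyps)
    show ?thesis
    proof (rule finite_subset[OF _ finite_UnI[OF fin finite_places_over_prime[OF p(1)]]], safe)
      fix w :: "'a \<Rightarrow> int"
      assume w: "nonarch_place w" "w (of_int N) > 0" "\<not> w (of_int p) > 0"
      interpret valued_field UNIV w
        using w by (intro valued_field_nonarch_place)
      have "w (of_int N) = w (of_int p) + w (of_int M)"
        using p2 \<open>M > 0\<close> by (simp add: M v_mult)
      thus "w (of_int M) > 0" using w by simp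
    qed
  qed
qed

lemma split_off_coprime_part:
  fixes d N :: int
  assumes "d > 0" "N > 0"
  shows "\<exists>c k. c > 0 \<and> coprime c N \<and> d dvd N ^ k * c"
  using assms(1)
proof (induction "nat d" arbitrary: d rule: less_induct)
  case less
  show ?case
  proof (cases "coprime d N")
    case True
    thus ?thesis using less.prems by (intro exI[of _ d] exI[of _ 0]) auto
  next
    case False
    define g where "g = gcd d N"
    have g: "g > 0" "g \<noteq> 1" "g dvd d" "g dvd N"
      using False less.prems by (auto simp: g_def coprime_iff_gcd_eq_1)
    then obtain e where e: "d = g * e" by blast
    have "e > 0" using e g less.prems by (simp add: zero_less_mult_iff)
    moreover have "1 * e < g * e" using g \<open>e > 0\<close> by (intro mult_strict_right_mono) auto
    hence "nat e < nat d" using e \<open>e > 0\<close> by simp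
    ultimately obtain c k where c: "c > 0" "coprime c N" "e dvd N ^ k * c"
      using less.hyps[of e] by blast
    have "g * e dvd N * (N ^ k * c)" using g c by (intro mult_dvd_mono)
    hence "d dvd N ^ Suc k * c" by (simp only: e power_Suc mult.assoc)
    with c show ?thesis by blast
  qed
qed

text \<open>
  Arbitrary valuations can be prescribed at finitely many places, with integrality at all others; this
  is the part of strong approximation that is needed here.
\<close>

theorem exists_prescribed_valuations:
  fixes t :: "('a::number_field \<Rightarrow> int) \<Rightarrow> int"
  assumes "finite S" and S: "\<And>w. w \<in> S \<Longrightarrow> nonarch_place w"
  shows "\<exists>x. x \<noteq> 0 \<and> (\<forall>w\<in>S. w x = t w) \<and> (\<forall>w. nonarch_place w \<and> w \<notin> S \<longrightarrow> w x \<ge> 0)"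
proof -
  have "\<exists>d :: int. d > 0 \<and> w (of_int d) > 0" if "w \<in> S" for w
    using place_nontrivial_on_int[OF S[OF that]] by blast
  then obtain \<delta> :: "_ \<Rightarrow> int" where \<delta>: "\<And>w. w \<in> S \<Longrightarrow> \<delta> w > 0 \<and> w (of_int (\<delta> w)) > 0" by metis
  define N where "N = (\<Prod>w\<in>S. \<delta> w)"
  have N: "N > 0" unfolding N_def using \<delta> by (intro prod_pos) auto
  have vf: "valued_field UNIV w" if "nonarch_place w" for w :: "'a \<Rightarrow> int"
    using that by (intro valued_field_nonarch_place)
  \<comment> \<open>All places over \<open>N\<close> must be controlled: only there may \<open>x\<close> be multiplied by integers
    coprime to \<open>N\<close> without changing its valuation.\<close>
  define T where "T = {w :: 'a \<Rightarrow> int. nonarch_place w \<and> w (of_int N) > 0}"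
  have T: "finite T" unfolding T_def by (rule finite_places_over_int[OF N])
  have "S \<subseteq> T"
  proof
    fix w assume w: "w \<in> S"
    interpret valued_field UNIV w by (intro vf S w)
    have N_eq: "N = \<delta> w * (\<Prod>w'\<in>S - {w}. \<delta> w')" (is "_ = _ * ?P")
      unfolding N_def using assms(1) w by (rule prod.remove)
    have "?P > 0" using \<delta> by (intro prod_pos) auto
    hence "w (of_int N) = w (of_int (\<delta> w)) + w (of_int ?P)"
      unfolding N_eq using \<delta>[OF w] by (simp add: v_mult del: of_int_prod)
    moreover have "w (of_int ?P) \<ge> 0"
      using val_ge_of_int[of ?P] by (auto simp: val_ge_def simp del: of_int_prod)
    ultimately show "w \<in> T" using \<delta>[OF w] S[OF w] by (simp add: T_def)
  qed
  obtain x where x: "x \<noteq> 0" "\<And>w. w \<in> T \<Longrightarrow> w x = (if w \<in> S then t w else 0)"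
    using weak_approximation[OF T, of "\<lambda>w. if w \<in> S then t w else 0"]
    by (auto simp: T_def nonarch_place_def)
  obtain d :: int where d: "d > 0" "\<And>w. nonarch_place w \<Longrightarrow> val_ge w 0 (of_int d * x)"
    using common_denominator[of x] by blast
  obtain c k where c: "c > 0" "coprime c N" "d dvd N ^ k * c"
    using split_off_coprime_part[OF d(1) N] by blast
  have onT: "w (of_int c * x) = (if w \<in> S then t w else 0)" if "w \<in> T" for w
  proof -
    interpret valued_field UNIV w using that by (intro vf) (simp add: T_def)
    have "w (of_int c) = 0"
      using that c N by (intro v_of_int_eq_0[of N]) (auto simp: T_def coprime_commute)
    thus ?thesis using x c that by (simp add: v_mult)
  qed
  have offT: "w (of_int c * x) \<ge> 0" if "nonarch_place w" "w \<notin> T" for w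
  proof -
    interpret valued_field UNIV w using that by (intro vf)
    have N0: "w (of_int N) = 0"
      using that val_ge_of_int[of N] N by (auto simp: T_def val_ge_def)
    obtain e where e: "N ^ k * c = d * e" using c(3) by blast
    have "val_ge w (0 + 0) (of_int e * (of_int d * x))"
      using d(2)[OF that(1)] by (intro val_ge_mult val_ge_of_int) auto
    moreover have "of_int e * (of_int d * x) = of_int N ^ k * (of_int c * x)"
      using arg_cong[OF e, of "of_int :: int \<Rightarrow> 'a"] by (simp add: mult_ac)
    ultimately have "val_ge w 0 (of_int N ^ k * (of_int c * x))" by simp
    thus ?thesis using N c x(1) by (auto simp: val_ge_def v_mult v_power N0)
  qed
  show ?thesis
  proof (intro exI[of _ "of_int c * x"] conjI allI impI ballI)
    show "of_int c * x \<noteq> 0" using c x by simp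
    show "w (of_int c * x) = t w" if "w \<in> S" for w
      using onT[of w] \<open>S \<subseteq> T\<close> that by auto
    show "w (of_int c * x) \<ge> 0" if "nonarch_place w \<and> w \<notin> S" for w
      using onT[of w] offT[of w] that by (cases "w \<in> T") auto
  qed
qed


section \<open>Valuation rings as maximal subrings\<close>

text \<open>Subrings of a commutative ring type.\<close>

locale type_subring =
  fixes R :: "'a::comm_ring_1 set"
  assumes one_mem [simp]: "1 \<in> R"
    and uminus_mem: "x \<in> R \<Longrightarrow> - x \<in> R"
    and add_mem: "x \<in> R \<Longrightarrow> y \<in> R \<Longrightarrow> x + y \<in> R"
    and mult_mem: "x \<in> R \<Longrightarrow> y \<in> R \<Longrightarrow> x * y \<in> R"
begin

lemma zero_mem [simp]: "0 \<in> R"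
  using add_mem[of 1 "- 1"] uminus_mem[of 1] by simp

lemma diff_mem: "x \<in> R \<Longrightarrow> y \<in> R \<Longrightarrow> x - y \<in> R"
  using add_mem[of x "- y"] uminus_mem[of y] by simp

lemma power_mem: "x \<in> R \<Longrightarrow> x ^ n \<in> R"
  by (induction n) (auto intro: mult_mem)

lemma sum_mem: "(\<And>i. i \<in> I \<Longrightarrow> f i \<in> R) \<Longrightarrow> sum f I \<in> R"
  by (induction I rule: infinite_finite_induct) (auto intro: add_mem)

lemmas mem_intros = zero_mem one_mem add_mem mult_mem uminus_mem diff_mem power_mem sum_mem

lemma type_subring_adjoin:
  "type_subring {poly p x | p. \<forall>i. Polynomial.coeff p i \<in> R}"
proof unfold_locales
  show "1 \<in> {poly p x | p. \<forall>i. Polynomial.coeff p i \<in> R}"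
    by (intro CollectI exI[of _ 1]) (auto simp: coeff_1)
next
  fix a assume "a \<in> {poly p x | p. \<forall>i. Polynomial.coeff p i \<in> R}"
  then obtain p where "a = poly p x" "\<And>i. Polynomial.coeff p i \<in> R" by auto
  thus "- a \<in> {poly p x | p. \<forall>i. Polynomial.coeff p i \<in> R}"
    by (intro CollectI exI[of _ "- p"]) (auto intro: mem_intros)
next
  fix a b assume "a \<in> {poly p x | p. \<forall>i. Polynomial.coeff p i \<in> R}"
    "b \<in> {poly p x | p. \<forall>i. Polynomial.coeff p i \<in> R}"
  then obtain p q where "a = poly p x" "\<And>i. Polynomial.coeff p i \<in> R"
    "b = poly q x" "\<And>i. Polynomial.coeff q i \<in> R" by auto
  hence "a + b = poly (p + q) x \<and> (\<forall>i. Polynomial.coeff (p + q) i \<in> R)"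
    and "a * b = poly (p * q) x \<and> (\<forall>i. Polynomial.coeff (p * q) i \<in> R)"
    by (auto simp: coeff_mult intro: mem_intros)
  thus "a + b \<in> {poly p x | p. \<forall>i. Polynomial.coeff p i \<in> R}"
    and "a * b \<in> {poly p x | p. \<forall>i. Polynomial.coeff p i \<in> R}"
    by blast+
qed

end

text \<open>
  A subring of a field containing \<open>t\<close> and maximal among the subrings that do not contain \<open>1 / t\<close>.
  Such a ring is a valuation ring (\<open>mem_or_inverse_mem\<close>).
\<close>

locale maximal_subring_avoiding = type_subring R for R :: "'a::field set" +
  fixes t :: 'a
  assumes t_mem: "t \<in> R" and t_nonzero: "t \<noteq> 0" and inverse_t: "inverse t \<notin> R"
    and maximal: "\<And>S. type_subring S \<Longrightarrow> R \<subseteq> S \<Longrightarrow> inverse t \<notin> S \<Longrightarrow> S = R"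
begin

lemma one_plus_nonzero: "b \<in> R \<Longrightarrow> 1 + t * b \<noteq> 0"
proof
  assume b: "b \<in> R" "1 + t * b = 0"
  hence "t * (- b) = 1" by (simp add: add_eq_0_iff)
  hence "inverse t = - b" by (rule inverse_unique)
  with b inverse_t show False by (auto intro: mem_intros)
qed

text \<open>Localizing at \<open>1 + t R\<close> does not introduce \<open>1 / t\<close>, so by maximality it changes nothing.\<close>

lemma one_plus_invertible:
  assumes "b \<in> R"
  shows "inverse (1 + t * b) \<in> R"
proof -
  define S where "S = {a / (1 + t * b) | a b. a \<in> R \<and> b \<in> R}"
  have S_I: "a / (1 + t * b) \<in> S" if "a \<in> R" "b \<in> R" for a b
    using that by (auto simp: S_def)
  have S_sub: "x \<in> S" if "x \<in> R" for x using S_I[of x 0] that by simp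
  have "type_subring S"
  proof unfold_locales
    show "1 \<in> S" by (intro S_sub) simp
    show "- x \<in> S" if "x \<in> S" for x
    proof -
      from that obtain a b where ab: "x = a / (1 + t * b)" "a \<in> R" "b \<in> R" by (auto simp: S_def)
      have "- x = (- a) / (1 + t * b)" by (simp add: ab)
      also have "\<dots> \<in> S" using ab by (intro S_I mem_intros)
      finally show ?thesis .
    qed
    show "x + y \<in> S" "x * y \<in> S" if "x \<in> S" "y \<in> S" for x y
    proof -
      from that obtain a b c d where ab: "x = a / (1 + t * b)" "a \<in> R" "b \<in> R"
        and cd: "y = c / (1 + t * d)" "c \<in> R" "d \<in> R" by (auto simp: S_def)
      have D: "(1 + t * b) * (1 + t * d) = 1 + t * (b + d + t * b * d)"
        by (simp add: algebra_simps)
      have "x + y = (a * (1 + t * d) + c * (1 + t * b)) / ((1 + t * b) * (1 + t * d))"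
        using one_plus_nonzero[of b] one_plus_nonzero[of d] ab cd
        by (simp add: add_frac_eq)
      also have "\<dots> \<in> S" unfolding D using ab cd t_mem by (intro S_I mem_intros)
      finally show "x + y \<in> S" .
      have "x * y = (a * c) / ((1 + t * b) * (1 + t * d))" by (simp add: ab cd)
      also have "\<dots> \<in> S" unfolding D using ab cd t_mem by (intro S_I mem_intros)
      finally show "x * y \<in> S" .
    qed
  qed
  moreover have "inverse t \<notin> S"
  proof
    assume "inverse t \<in> S"
    then obtain a b where ab: "inverse t = a / (1 + t * b)" "a \<in> R" "b \<in> R" by (auto simp: S_def)
    hence "t * (a - b) = 1"
      using t_nonzero one_plus_nonzero[of b] by (simp add: field_simps)
    hence "inverse t = a - b" by (rule inverse_unique)
    with diff_mem[OF ab(2,3)] inverse_t show False by simp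
  qed
  ultimately have "S = R" using S_sub by (intro maximal) auto
  thus ?thesis using S_I[of 1 b] assms by (auto simp: inverse_eq_divide)
qed

text \<open>
  \<open>1 / t\<close> is a polynomial in \<open>x\<close> of degree at most \<open>n\<close> with coefficients in \<open>R\<close>.
\<close>

definition unit_relation :: "'a \<Rightarrow> nat \<Rightarrow> bool" where
  "unit_relation x n \<longleftrightarrow> (\<exists>a. (\<forall>i. a i \<in> R) \<and> t * (\<Sum>i\<le>n. a i * x ^ i) = 1)"

lemma unit_relation_exists:
  assumes "x \<notin> R"
  shows "\<exists>n. unit_relation x n"
proof -
  define S where "S = {poly p x | p. \<forall>i. Polynomial.coeff p i \<in> R}"
  have "inverse t \<in> S"
  proof (rule ccontr)
    assume "inverse t \<notin> S"
    moreover have "R \<subseteq> S"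
    proof
      fix a assume "a \<in> R"
      hence "a = poly [:a:] x \<and> (\<forall>i. Polynomial.coeff [:a:] i \<in> R)"
        by (auto simp: coeff_pCons split: nat.splits)
      thus "a \<in> S" unfolding S_def by blast
    qed
    ultimately have "S = R" unfolding S_def by (intro maximal type_subring_adjoin)
    moreover have "x = poly [:0, 1:] x \<and> (\<forall>i. Polynomial.coeff [:0, 1 :: 'a:] i \<in> R)"
      by (auto simp: coeff_pCons split: nat.splits)
    hence "x \<in> S" unfolding S_def by blast
    ultimately show False using assms by simp
  qed
  then obtain p where p: "inverse t = poly p x" "\<And>i. Polynomial.coeff p i \<in> R"
    by (auto simp: S_def)
  have "t * (\<Sum>i\<le>Polynomial.degree p. Polynomial.coeff p i * x ^ i) = 1"
    using p(1) t_nonzero by (simp add: poly_altdef[symmetric] flip: p(1))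
  with p(2) show ?thesis unfolding unit_relation_def by blast
qed

lemma unit_relation_mono:
  assumes "unit_relation x n" "n \<le> m"
  shows "unit_relation x m"
proof -
  obtain a where a: "\<And>i. a i \<in> R" "t * (\<Sum>i\<le>n. a i * x ^ i) = 1"
    using assms(1) by (auto simp: unit_relation_def)
  have "(\<Sum>i\<le>n. a i * x ^ i) = (\<Sum>i\<le>m. (if i \<le> n then a i else 0) * x ^ i)"
    using assms(2) by (intro sum.mono_neutral_cong_left) auto
  thus ?thesis
    using a unfolding unit_relation_def by (intro exI[of _ "\<lambda>i. if i \<le> n then a i else 0"]) auto
qed

text \<open>
  The relation for \<open>y = 1 / x\<close>, multiplied by \<open>x\<^sup>n\<^sup>+\<^sup>1\<close>, expresses \<open>x\<^sup>n\<^sup>+\<^sup>1\<close> through lower powers of \<open>x\<close>,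
  because \<open>1 - t b\<^sub>0\<close> is invertible in \<open>R\<close>. Substitution into the relation for \<open>x\<close> lowers its degree.
\<close>

lemma unit_relation_reduce:
  assumes x: "unit_relation x (Suc n)" and y: "unit_relation y (Suc n)" and xy: "x * y = 1"
  shows "unit_relation x n"
proof -
  obtain a where a: "\<And>i. a i \<in> R" "t * (\<Sum>i\<le>Suc n. a i * x ^ i) = 1"
    using x by (auto simp: unit_relation_def)
  obtain b where b: "\<And>i. b i \<in> R" "t * (\<Sum>i\<le>Suc n. b i * y ^ i) = 1"
    using y by (auto simp: unit_relation_def)
  define u where "u = 1 + t * (- b 0)"
  have u: "u \<noteq> 0" "inverse u \<in> R"
    using one_plus_nonzero[of "- b 0"] one_plus_invertible[of "- b 0"] b(1)
    by (auto simp: u_def intro: mem_intros)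
  have "u = t * (\<Sum>i\<le>n. b (Suc i) * y ^ Suc i)"
    using b(2) unfolding sum.atMost_Suc_shift by (simp add: u_def algebra_simps)
  hence "u * x ^ Suc n = t * (\<Sum>i\<le>n. b (Suc i) * (y ^ Suc i * x ^ Suc n))"
    by (simp add: sum_distrib_left sum_distrib_right mult_ac)
  also have "(\<Sum>i\<le>n. b (Suc i) * (y ^ Suc i * x ^ Suc n)) = (\<Sum>i\<le>n. b (Suc i) * x ^ (n - i))"
  proof (intro sum.cong refl)
    fix i assume "i \<in> {..n}"
    hence "x ^ Suc n = x ^ Suc i * x ^ (n - i)" by (simp flip: power_add)
    hence "y ^ Suc i * x ^ Suc n = (x * y) ^ Suc i * x ^ (n - i)"
      by (simp only: power_mult_distrib mult_ac)
    thus "b (Suc i) * (y ^ Suc i * x ^ Suc n) = b (Suc i) * x ^ (n - i)"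
      by (simp add: xy)
  qed
  also have "\<dots> = (\<Sum>i\<le>n. b (Suc (n - i)) * x ^ i)"
    by (rule sum.reindex_bij_witness[of _ "\<lambda>i. n - i" "\<lambda>i. n - i"]) auto
  finally have eq: "x ^ Suc n = inverse u * (t * (\<Sum>i\<le>n. b (Suc (n - i)) * x ^ i))"
    using u(1) by (simp add: field_simps)
  define c where "c i = a i + a (Suc n) * (t * (inverse u * b (Suc (n - i))))" for i
  have "(\<Sum>i\<le>n. c i * x ^ i) = (\<Sum>i\<le>n. a i * x ^ i) +
          a (Suc n) * (inverse u * (t * (\<Sum>i\<le>n. b (Suc (n - i)) * x ^ i)))"
    by (simp add: c_def sum.distrib ring_distribs sum_distrib_left mult_ac)
  also have "\<dots> = (\<Sum>i\<le>Suc n. a i * x ^ i)"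
    by (simp add: eq[symmetric] del: power_Suc)
  finally have "t * (\<Sum>i\<le>n. c i * x ^ i) = 1" using a(2) by simp
  moreover have "\<forall>i. c i \<in> R" using a(1) b(1) u(2) t_mem by (auto simp: c_def intro!: mem_intros)
  ultimately show ?thesis unfolding unit_relation_def by blast
qed

lemma no_two_unit_relations:
  assumes "x * y = 1"
  shows "unit_relation x n \<Longrightarrow> unit_relation y n \<Longrightarrow> False"
proof (induction n)
  case 0
  then obtain a :: "nat \<Rightarrow> 'a" where "\<forall>i. a i \<in> R" "t * a 0 = 1"
    by (auto simp: unit_relation_def)
  with inverse_unique[of t "a 0"] inverse_t show False by auto
next
  case (Suc n)
  have "y * x = 1" using assms by (simp add: mult.commute)
  from unit_relation_reduce[OF Suc.prems assms] unit_relation_reduce[OF Suc.prems(2,1) this] Suc.IH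
  show False by blast
qed

lemma mem_or_inverse_mem: "x \<in> R \<or> inverse x \<in> R"
proof (rule ccontr)
  assume *: "\<not> ?thesis"
  hence "x * inverse x = 1" by (cases "x = 0") auto
  moreover obtain n m where "unit_relation x n" "unit_relation (inverse x) m"
    using * unit_relation_exists by metis
  hence "unit_relation x (max n m)" "unit_relation (inverse x) (max n m)"
    by (auto intro: unit_relation_mono)
  ultimately show False using no_two_unit_relations by blast
qed

end

theorem exists_maximal_subring_avoiding:
  assumes "type_subring A" "t \<in> A" "t \<noteq> 0" "inverse t \<notin> A"
  obtains R where "A \<subseteq> R" "maximal_subring_avoiding R t"
proof -
  define F where "F = {S. type_subring S \<and> A \<subseteq> S \<and> inverse t \<notin> S}"
  have "\<exists>M\<in>F. \<forall>S\<in>F. M \<subseteq> S \<longrightarrow> S = M"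
  proof (rule subset_Zorn_nonempty)
    show "F \<noteq> {}" using assms by (auto simp: F_def)
    fix C assume C: "C \<noteq> {}" "subset.chain F C"
    have CF: "S \<in> F" if "S \<in> C" for S using C that by (auto simp: subset.chain_def)
    have sub: "type_subring S" if "S \<in> C" for S using CF[OF that] by (simp add: F_def)
    have common: "\<exists>S\<in>C. x \<in> S \<and> y \<in> S" if "x \<in> \<Union>C" "y \<in> \<Union>C" for x y
    proof -
      from that obtain S T where "S \<in> C" "T \<in> C" "x \<in> S" "y \<in> T" by auto
      moreover from this C have "S \<subseteq> T \<or> T \<subseteq> S" unfolding subset.chain_def by blast
      ultimately show ?thesis by blast
    qed
    have "type_subring (\<Union>C)"
    proof unfold_locales
      show "1 \<in> \<Union>C" using C(1) sub type_subring.one_mem by blast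
      show "- x \<in> \<Union>C" if "x \<in> \<Union>C" for x using that sub type_subring.uminus_mem by blast
      show "x + y \<in> \<Union>C" "x * y \<in> \<Union>C" if "x \<in> \<Union>C" "y \<in> \<Union>C" for x y
        using common[OF that] sub type_subring.add_mem type_subring.mult_mem by blast+
    qed
    thus "\<Union>C \<in> F" using C(1) CF by (auto simp: F_def)
  qed
  then obtain M where M: "M \<in> F" "\<And>S. S \<in> F \<Longrightarrow> M \<subseteq> S \<Longrightarrow> S = M" by blast
  interpret type_subring M using M(1) by (simp add: F_def)
  show thesis
  proof (rule that)
    show "A \<subseteq> M" using M(1) by (simp add: F_def)
    show "maximal_subring_avoiding M t"
    proof unfold_locales
      show "t \<in> M" "t \<noteq> 0" "inverse t \<notin> M" using M(1) assms by (auto simp: F_def)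
      show "S = M" if "type_subring S" "M \<subseteq> S" "inverse t \<notin> S" for S
        using that M \<open>A \<subseteq> M\<close> by (auto simp: F_def)
    qed
  qed
qed


text \<open>
  A valuation on \<open>L\<close> with values in \<open>\<int>\<close> that is not identically \<open>0\<close> is a multiple of a normalized
  one: its image is generated by its least positive element \<open>g\<close>.
\<close>

lemma normalize_valuation:
  fixes f :: "'a::field \<Rightarrow> int"
  assumes L: "subfield L ring_of_type_algebra"
    and mult: "\<And>x y. x \<in> L \<Longrightarrow> y \<in> L \<Longrightarrow> x \<noteq> 0 \<Longrightarrow> y \<noteq> 0 \<Longrightarrow> f (x * y) = f x + f y"
    and add: "\<And>x y. x \<in> L \<Longrightarrow> y \<in> L \<Longrightarrow> x \<noteq> 0 \<Longrightarrow> y \<noteq> 0 \<Longrightarrow> x + y \<noteq> 0 \<Longrightarrow> f (x + y) \<ge> min (f x) (f y)"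
    and p: "p \<in> L" "p \<noteq> 0" "f p > 0"
  obtains g w where "g > 0" "discrete_valuation L w" "\<And>x. x \<in> L \<Longrightarrow> x \<noteq> 0 \<Longrightarrow> f x = g * w x"
proof -
  interpret R: field "ring_of_type_algebra :: 'a ring" by (rule field_from_type_algebra)
  have one: "1 \<in> L" using subringE(3)[OF subfieldE(1)[OF L]] by simp
  have mult_mem: "x * y \<in> L" if "x \<in> L" "y \<in> L" for x y
    using subringE(6)[OF subfieldE(1)[OF L]] that by simp
  have inverse_mem: "inverse x \<in> L" if "x \<in> L" "x \<noteq> 0" for x
    using R.subfield_m_inv(1)[OF L, of x] that by simp
  have f1: "f 1 = 0" using mult[of 1 1] one by simp
  have finv: "f (inverse x) = - f x" if "x \<in> L" "x \<noteq> 0" for x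
    using mult[of x "inverse x"] inverse_mem[of x] that f1 by simp
  have pow_mem: "x ^ n \<in> L" if "x \<in> L" for x n
    using that one by (induction n) (auto intro: mult_mem)
  have fpow: "f (x ^ n) = int n * f x" if "x \<in> L" "x \<noteq> 0" for x n
    using that f1 by (induction n) (simp_all add: mult pow_mem algebra_simps)
  define Q where "Q n \<longleftrightarrow> n > 0 \<and> (\<exists>x\<in>L. x \<noteq> 0 \<and> f x = int n)" for n
  define g where "g = (LEAST n. Q n)"
  have "Q (nat (f p))" using p by (auto simp: Q_def)
  hence "Q g" unfolding g_def by (rule LeastI)
  then obtain y where y: "y \<in> L" "y \<noteq> 0" "f y = int g" and g: "g > 0" by (auto simp: Q_def)
  have dvd: "int g dvd f x" if x: "x \<in> L" "x \<noteq> 0" for x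
  proof -
    define k where "k = f x div int g"
    have "\<exists>z\<in>L. z \<noteq> 0 \<and> f z = k * int g"
    proof (cases "k \<ge> 0")
      case True
      with y show ?thesis by (intro bexI[of _ "y ^ nat k"]) (auto simp: fpow pow_mem)
    next
      case False
      have "f (inverse (y ^ nat (- k))) = k * int g"
        using y False finv[of "y ^ nat (- k)"] by (simp add: fpow pow_mem)
      moreover have "inverse (y ^ nat (- k)) \<in> L" using y by (intro inverse_mem pow_mem) auto
      ultimately show ?thesis using y by (intro bexI[of _ "inverse (y ^ nat (- k))"]) auto
    qed
    then obtain z where z: "z \<in> L" "z \<noteq> 0" "f z = k * int g" by blast
    have r: "f (x * inverse z) = f x mod int g"
      using x z by (simp add: mult inverse_mem finv k_def minus_div_mult_eq_mod)
    have "f x mod int g = 0"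
    proof (rule ccontr)
      assume "f x mod int g \<noteq> 0"
      moreover have "f x mod int g \<ge> 0" using g by simp
      ultimately have pos: "f x mod int g > 0" by linarith
      have "x * inverse z \<in> L" "x * inverse z \<noteq> 0" using x z by (auto intro: mult_mem inverse_mem)
      hence "Q (nat (f x mod int g))"
        unfolding Q_def using r pos by (intro conjI bexI[of _ "x * inverse z"]) auto
      hence "g \<le> nat (f x mod int g)" unfolding g_def by (rule Least_le)
      moreover have "f x mod int g < int g" using g by simp
      ultimately show False using pos by linarith
    qed
    thus ?thesis by auto
  qed
  define w where "w x = (if x = 0 then 0 else f x div int g)" for x
  have fw: "f x = int g * w x" if "x \<in> L" "x \<noteq> 0" for x
    using dvd[OF that] that by (simp add: w_def)
  show thesis
  proof (rule that)
    show "int g > 0" using g by simp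
    show "f x = int g * w x" if "x \<in> L" "x \<noteq> 0" for x using fw that by blast
    show "discrete_valuation L w"
      unfolding discrete_valuation_def
    proof (intro conjI ballI impI)
      show "w 0 = 0" by (simp add: w_def)
      have "k \<in> w ` (L - {0})" for k
      proof (cases "k \<ge> 0")
        case True
        hence "k = w (y ^ nat k)" using y g by (simp add: w_def fpow)
        thus ?thesis using y pow_mem by auto
      next
        case False
        hence "k = w (inverse (y ^ nat (- k)))" using y g by (simp add: w_def fpow finv pow_mem)
        moreover have "inverse (y ^ nat (- k)) \<in> L - {0}"
          using y by (auto intro!: inverse_mem pow_mem)
        ultimately show ?thesis by blast
      qed
      thus "w ` (L - {0}) = UNIV" by blast
    next
      fix a b assume ab: "a \<in> L - {0}" "b \<in> L - {0}"
      have "int g * w (a * b) = f a + f b"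
        using ab fw[of "a * b"] mult[of a b] by (simp add: mult_mem)
      hence "int g * w (a * b) = int g * (w a + w b)"
        using ab by (simp add: fw distrib_left)
      thus "w (a * b) = w a + w b" using g by simp
      assume nz: "a + b \<noteq> 0"
      have s: "a + b \<in> L" using subringE(7)[OF subfieldE(1)[OF L], of a b] ab by simp
      have "min (int g * w a) (int g * w b) \<le> int g * w (a + b)"
        using add[of a b] ab nz s by (simp add: fw)
      thus "min (w a) (w b) \<le> w (a + b)" using g by (auto simp: min_def split: if_splits)
    qed
  qed
qed

context maximal_subring_avoiding
begin

text \<open>Units of the valuation ring \<open>R\<close>.\<close>

definition val_unit :: "'a \<Rightarrow> bool" where
  "val_unit x \<longleftrightarrow> x \<noteq> 0 \<and> x \<in> R \<and> inverse x \<in> R"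

lemma val_unit_1 [simp]: "val_unit 1"
  by (simp add: val_unit_def)

lemma val_unit_mult: "val_unit x \<Longrightarrow> val_unit y \<Longrightarrow> val_unit (x * y)"
  by (auto simp: val_unit_def intro: mem_intros)

lemma val_unit_inverse: "val_unit x \<Longrightarrow> val_unit (inverse x)"
  by (auto simp: val_unit_def)

lemma val_unit_power: "val_unit x \<Longrightarrow> val_unit (x ^ n)"
  by (induction n) (auto intro: val_unit_mult)

lemma power_int_t_mem_iff: "t powi k \<in> R \<longleftrightarrow> k \<ge> 0"
proof
  assume k: "t powi k \<in> R"
  show "k \<ge> 0"
  proof (rule ccontr)
    assume "\<not> k \<ge> 0"
    have "t powi k * t ^ nat (- k - 1) \<in> R" using k t_mem by (intro mem_intros)
    also have "t powi k * t ^ nat (- k - 1) = t powi k * t powi (- k - 1)"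
      using \<open>\<not> k \<ge> 0\<close> by (simp add: power_int_def)
    also have "\<dots> = t powi (- 1)" using t_nonzero by (simp flip: power_int_add)
    finally show False using inverse_t by simp
  qed
qed (auto simp: power_int_def intro!: power_mem t_mem)

lemma val_unit_power_int_t_iff: "val_unit (t powi k) \<longleftrightarrow> k = 0"
  using t_nonzero power_int_t_mem_iff[of k] power_int_t_mem_iff[of "- k"]
  by (auto simp: val_unit_def power_int_minus)

lemma nonunit_add:
  assumes "x \<in> R" "\<not> val_unit x" "y \<in> R" "\<not> val_unit y"
  shows "\<not> val_unit (x + y)"
proof
  assume u: "val_unit (x + y)"
  have *: False if "b \<in> R" "\<not> val_unit b" "val_unit (a + b)" "a / b \<in> R" "b \<noteq> 0" for a b
  proof -
    have "a + b = b * (1 + a / b)" using that by (simp add: field_simps)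
    hence "inverse b = (1 + a / b) * inverse (a + b)"
      using that by (auto simp: val_unit_def field_simps)
    also have "\<dots> \<in> R" using that by (intro mem_intros) (auto simp: val_unit_def)
    finally show False using that by (auto simp: val_unit_def)
  qed
  show False
  proof (cases "x = 0 \<or> y = 0")
    case False
    with mem_or_inverse_mem[of "x / y"] consider "x / y \<in> R" | "y / x \<in> R" by auto
    thus False using *[of y x] *[of x y] assms u False by cases (auto simp: add.commute)
  qed (use assms u in auto)
qed

lemma nonunit_sum:
  assumes "\<And>i. i \<in> I \<Longrightarrow> f i \<in> R \<and> \<not> val_unit (f i)"
  shows "sum f I \<in> R \<and> \<not> val_unit (sum f I)"
  using assms
  by (induction I rule: infinite_finite_induct)
     (auto intro: add_mem dest: nonunit_add simp: val_unit_def[of 0])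

text \<open>
  Divisibility in a valuation ring is a total preorder, so a finite family has an element dividing all
  others.
\<close>

lemma exists_val_minimal:
  assumes "finite I" "I \<noteq> {}" "\<And>i. i \<in> I \<Longrightarrow> f i \<noteq> 0"
  shows "\<exists>i\<in>I. \<forall>j\<in>I. f j / f i \<in> R"
  using assms
proof (induction I rule: finite_ne_induct)
  case (insert k I)
  then obtain i where i: "i \<in> I" "\<And>j. j \<in> I \<Longrightarrow> f j / f i \<in> R" by auto
  show ?case
  proof (cases "f k / f i \<in> R")
    case True
    with i insert.prems show ?thesis by (intro bexI[of _ i]) auto
  next
    case False
    hence ik: "f i / f k \<in> R" using mem_or_inverse_mem[of "f k / f i"] by simp
    have "f j / f k \<in> R" if "j \<in> I" for j
    proof -
      have "f j / f k = f j / f i * (f i / f k)" using insert.prems i(1) by simp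
      also have "\<dots> \<in> R" using i(2)[OF that] ik by (rule mult_mem)
      finally show ?thesis .
    qed
    thus ?thesis using insert.prems by (intro bexI[of _ k]) auto
  qed
qed auto

text \<open>
  A vanishing sum has two terms of the same valuation: otherwise, divided by its term of
  smallest valuation, it would be \<open>1\<close> plus a nonunit.
\<close>

lemma two_terms_same_val:
  assumes "finite I" "i0 \<in> I" "f i0 \<noteq> 0" "sum f I = 0"
  obtains i j where "i \<in> I" "j \<in> I" "i \<noteq> j" "val_unit (f j / f i)"
proof -
  define J where "J = {i \<in> I. f i \<noteq> 0}"
  have "sum f I = sum f J"
    using assms(1) by (intro sum.mono_neutral_right) (auto simp: J_def)
  moreover have "i0 \<in> J" using assms(2,3) by (simp add: J_def)
  ultimately have J: "finite J" "J \<noteq> {}" "sum f J = 0"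
    using assms(1,4) by (auto simp: J_def)
  have "\<exists>i\<in>J. \<forall>j\<in>J. f j / f i \<in> R"
    using J(1,2) by (rule exists_val_minimal) (simp add: J_def)
  then obtain i where i: "i \<in> J" "\<And>j. j \<in> J \<Longrightarrow> f j / f i \<in> R" by blast
  have fi: "f i \<noteq> 0" using i by (simp add: J_def)
  have "\<exists>j\<in>J - {i}. val_unit (f j / f i)"
  proof (rule ccontr)
    assume "\<not> ?thesis"
    hence "\<not> val_unit (\<Sum>j\<in>J - {i}. f j / f i)"
      using nonunit_sum[of "J - {i}" "\<lambda>j. f j / f i"] i by auto
    moreover have "f i + sum f (J - {i}) = 0" using sum.remove[OF J(1) i(1), of f] J(3) by simp
    hence "sum f (J - {i}) = - f i" by (simp add: add_eq_0_iff)
    hence "(\<Sum>j\<in>J - {i}. f j / f i) = - 1"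
      using fi by (subst sum_divide_distrib[symmetric]) simp
    moreover have "val_unit (- 1)" by (auto simp: val_unit_def intro: mem_intros)
    ultimately show False by simp
  qed
  then obtain j where "j \<in> J" "j \<noteq> i" "val_unit (f j / f i)" by auto
  with i(1) show thesis by (intro that[of i j]) (simp_all add: J_def)
qed

end


section \<open>Extending a place to a finite extension\<close>

lemma subfield_range_to_ac: "subfield (range to_ac :: 'k::field alg_closure set) ring_of_type_algebra"
proof -
  interpret R: field "ring_of_type_algebra :: 'k alg_closure ring" by (rule field_from_type_algebra)
  show ?thesis
  proof (rule R.subfieldI')
    show "subring (range to_ac) (ring_of_type_algebra :: 'k alg_closure ring)"
    proof (rule R.subringI)
      show "\<one>\<^bsub>ring_of_type_algebra\<^esub> \<in> range (to_ac :: 'k \<Rightarrow> _)"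
        using rangeI[of to_ac "1 :: 'k"] by simp
    next
      fix a :: "'k alg_closure" assume "a \<in> range to_ac"
      thus "\<ominus>\<^bsub>ring_of_type_algebra\<^esub> a \<in> range to_ac" by (auto simp flip: to_ac_minus)
    next
      fix a b :: "'k alg_closure" assume "a \<in> range to_ac" "b \<in> range to_ac"
      thus "a \<otimes>\<^bsub>ring_of_type_algebra\<^esub> b \<in> range to_ac"
        and "a \<oplus>\<^bsub>ring_of_type_algebra\<^esub> b \<in> range to_ac"
        by (auto simp flip: to_ac_mult to_ac_add)
    qed auto
  next
    fix a :: "'k alg_closure" assume "a \<in> range to_ac - {\<zero>\<^bsub>ring_of_type_algebra\<^esub>}"
    thus "inv\<^bsub>ring_of_type_algebra\<^esub> a \<in> range to_ac" by (auto simp flip: to_ac_inverse)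
  qed
qed

lemma to_ac_power_int [simp]: "to_ac (x powi k) = to_ac x powi k"
  by (auto simp: power_int_def)

text \<open>Every place of a number field extends to every finite extension inside the algebraic closure.\<close>

theorem exists_place_above:
  fixes v :: "'k::number_field \<Rightarrow> int" and L :: "'k alg_closure set"
  assumes v: "nonarch_place v"
    and L: "subfield L ring_of_type_algebra" "range to_ac \<subseteq> L"
    and fin: "ring.finite_dimension ring_of_type_algebra (range to_ac) L"
  shows "\<exists>w. finite_extension_place v L w"
proof -
  interpret V: valued_field UNIV v
    using v by (intro valued_field_nonarch_place)
  obtain p where p: "p \<noteq> 0" "v p = 1" by (rule V.v_surj)
  define t where "t = to_ac p"
  define A where "A = to_ac ` {x. val_ge v 0 x}"
  have A_I: "to_ac x \<in> A" if "val_ge v 0 x" for x using that by (auto simp: A_def)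
  have "type_subring A"
  proof unfold_locales
    show "1 \<in> A" using A_I[of 1] by simp
    show "- x \<in> A" if x: "x \<in> A" for x
    proof -
      from x obtain a where "x = to_ac a" "val_ge v 0 a" by (auto simp: A_def)
      with A_I[of "- a"] V.val_ge_uminus[of a 0] show ?thesis by simp
    qed
    show "x + y \<in> A" "x * y \<in> A" if xy: "x \<in> A" "y \<in> A" for x y
    proof -
      from xy obtain a b where "x = to_ac a" "val_ge v 0 a" "y = to_ac b" "val_ge v 0 b"
        by (auto simp: A_def)
      with A_I[of "a + b"] V.val_ge_add[of a b 0] A_I[of "a * b"] V.val_ge_mult_0[of a b]
      show "x + y \<in> A" "x * y \<in> A" by simp_all
    qed
  qed
  moreover have "t \<in> A" using p by (auto simp: t_def val_ge_def intro!: A_I)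
  moreover have "t \<noteq> 0" using p by (simp add: t_def)
  moreover have "inverse t \<notin> A"
  proof
    assume "inverse t \<in> A"
    hence "val_ge v 0 (inverse p)" by (auto simp: A_def t_def simp flip: to_ac_inverse)
    thus False using p by (auto simp: val_ge_def V.v_inverse)
  qed
  ultimately obtain R where AR: "A \<subseteq> R" and "maximal_subring_avoiding R t"
    by (rule exists_maximal_subring_avoiding)
  then interpret maximal_subring_avoiding R t by simp
  have unit0: "val_unit (to_ac a)" if "a \<noteq> 0" "v a = 0" for a
    using that A_I[of a] A_I[of "inverse a"] AR
    by (auto simp: val_unit_def val_ge_def V.v_inverse)
  have unit_base: "val_unit (to_ac a * t powi (- v a))" if "a \<noteq> 0" for a
    using unit0[of "a * p powi (- v a)"] that p by (simp add: t_def V.v_mult V.v_power_int)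
  interpret L0: type_subring L
    using subringE[OF subfieldE(1)[OF L(1)]] by unfold_locales auto
  have L_inv: "inverse x \<in> L" if "x \<in> L" for x
  proof (cases "x = 0")
    case False
    interpret R: field "ring_of_type_algebra :: 'k alg_closure ring" by (rule field_from_type_algebra)
    show ?thesis using R.subfield_m_inv(1)[OF L(1), of x] that False by simp
  qed simp
  obtain d where d: "\<And>m (f :: nat \<Rightarrow> 'k alg_closure). d < m \<Longrightarrow> (\<And>i. i < m \<Longrightarrow> f i \<in> L) \<Longrightarrow>
       \<exists>c. (\<forall>i<m. c i \<in> range to_ac) \<and> (\<exists>i<m. c i \<noteq> 0) \<and> (\<Sum>i<m. c i * f i) = 0"
    using finite_dimension_linear_relation[OF subfield_range_to_ac fin] by blast
  \<comment> \<open>A linear relation between \<open>1, x, \<dots>, x\<^sup>d\<close> has two terms of the same valuation, so that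
    \<open>x\<^sup>m = t\<^sup>k\<close> up to a unit for some \<open>1 \<le> m \<le> d\<close>. Every such \<open>m\<close> divides \<open>d!\<close>.\<close>
  define M :: nat where "M = fact d"
  have M: "M > 0" by (simp add: M_def)
  have ex_val: "\<exists>k. val_unit (x ^ M * t powi (- k))" if x: "x \<in> L" "x \<noteq> 0" for x
  proof -
    have "\<exists>c. (\<forall>i<Suc d. c i \<in> range to_ac) \<and> (\<exists>i<Suc d. c i \<noteq> 0) \<and> (\<Sum>i<Suc d. c i * x ^ i) = 0"
      using x by (intro d) (auto intro: L0.power_mem)
    then obtain c i0 where c: "\<And>i. i < Suc d \<Longrightarrow> c i \<in> range to_ac" and i0: "i0 < Suc d" "c i0 \<noteq> 0"
      and rel: "(\<Sum>i<Suc d. c i * x ^ i) = 0" by blast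
    obtain i j where ij: "i < Suc d" "j < Suc d" "i \<noteq> j" "val_unit (c j * x ^ j / (c i * x ^ i))"
      using two_terms_same_val[of "{..<Suc d}" i0 "\<lambda>i. c i * x ^ i"] i0 rel x(2) by auto
    have "\<exists>i j. i < j \<and> j < Suc d \<and> val_unit (c j * x ^ j / (c i * x ^ i))"
    proof (cases "i < j")
      case False
      have "val_unit (c i * x ^ i / (c j * x ^ j))" using val_unit_inverse[OF ij(4)] by simp
      with False ij show ?thesis by (intro exI[of _ j] exI[of _ i]) auto
    qed (use ij in blast)
    then obtain i j where ij: "i < j" "j < Suc d" "val_unit (c j * x ^ j / (c i * x ^ i))" by blast
    obtain a b where ab: "c i = to_ac a" "c j = to_ac b" using c[of i] c[of j] ij by auto
    have nz: "a \<noteq> 0" "b \<noteq> 0" using ij(3) ab by (auto simp: val_unit_def)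
    define k where "k = v (b / a)"
    define m where "m = j - i"
    have m: "1 \<le> m" "m \<le> d" using ij by (auto simp: m_def)
    have "x ^ j = x ^ m * x ^ i" using ij(1) by (simp add: m_def flip: power_add)
    hence "c j * x ^ j / (c i * x ^ i) = to_ac (b / a) * x ^ m"
      using x(2) nz ab by simp
    hence "val_unit (to_ac (b / a) * x ^ m)" using ij(3) by simp
    moreover have "val_unit (inverse (to_ac (b / a) * t powi (- k)))"
      unfolding k_def using nz by (intro val_unit_inverse unit_base) simp
    ultimately have "val_unit (inverse (to_ac (b / a) * t powi (- k)) * (to_ac (b / a) * x ^ m))"
      by (rule val_unit_mult[rotated])
    also have "inverse (to_ac (b / a) * t powi (- k)) * (to_ac (b / a) * x ^ m) = x ^ m * t powi k"
      using nz by (simp add: power_int_minus field_simps)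
    finally have u: "val_unit (x ^ m * t powi k)" .
    have "m dvd M" unfolding M_def using m by (intro dvd_fact) auto
    then obtain q where q: "M = m * q" by blast
    have "val_unit ((x ^ m * t powi k) ^ q)" using u by (rule val_unit_power)
    also have "(x ^ m * t powi k) ^ q = x ^ M * t powi (k * int q)"
      by (simp add: q power_mult_distrib power_mult power_int_mult)
    finally show ?thesis by (intro exI[of _ "- (k * int q)"]) simp
  qed
  then obtain f where f: "\<And>x. x \<in> L \<Longrightarrow> x \<noteq> 0 \<Longrightarrow> val_unit (x ^ M * t powi (- f x))" by metis
  have f_eqI: "f x = k" if "x \<in> L" "x \<noteq> 0" "val_unit (x ^ M * t powi (- k))" for x k
  proof -
    have "val_unit (inverse (x ^ M * t powi (- f x)) * (x ^ M * t powi (- k)))"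
      by (rule val_unit_mult[OF val_unit_inverse[OF f[OF that(1,2)]] that(3)])
    also have "inverse (x ^ M * t powi (- f x)) * (x ^ M * t powi (- k)) = t powi (f x) * t powi (- k)"
      using that(2) by (simp add: power_int_minus field_simps)
    also have "\<dots> = t powi (f x - k)"
      using t_nonzero by (simp flip: power_int_add)
    finally show ?thesis by (simp add: val_unit_power_int_t_iff)
  qed
  have f_mult: "f (x * y) = f x + f y" if "x \<in> L" "y \<in> L" "x \<noteq> 0" "y \<noteq> 0" for x y
  proof (rule f_eqI)
    have "val_unit ((x ^ M * t powi (- f x)) * (y ^ M * t powi (- f y)))"
      by (rule val_unit_mult[OF f[OF that(1,3)] f[OF that(2,4)]])
    also have "(x ^ M * t powi (- f x)) * (y ^ M * t powi (- f y)) =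
        (x * y) ^ M * (t powi (- f x) * t powi (- f y))"
      by (simp add: power_mult_distrib mult_ac)
    also have "t powi (- f x) * t powi (- f y) = t powi (- (f x + f y))"
      using t_nonzero by (simp flip: power_int_add)
    finally show "val_unit ((x * y) ^ M * t powi (- (f x + f y)))" .
  qed (use that in \<open>auto intro: L0.mult_mem\<close>)
  have f_nonneg: "f x \<ge> 0" if "x \<in> L" "x \<noteq> 0" "x \<in> R" for x
  proof -
    have u: "val_unit (x ^ M * t powi (- f x))" using that by (intro f)
    have "t powi (f x) = x ^ M * inverse (x ^ M * t powi (- f x))"
      using that(2) by (simp add: power_int_minus)
    also have "\<dots> \<in> R" using u that by (intro mem_intros) (auto simp: val_unit_def)
    finally show ?thesis by (simp add: power_int_t_mem_iff)
  qed
  have f_add_aux: "f (x + y) \<ge> f x"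
    if "x \<in> L" "y \<in> L" "x \<noteq> 0" "x + y \<noteq> 0" "y / x \<in> R" for x y
  proof -
    have eq: "(x + y) * inverse x = 1 + y / x" using that by (simp add: field_simps)
    have "f ((x + y) * inverse x) \<ge> 0"
    proof (rule f_nonneg)
      show "(x + y) * inverse x \<in> L" using that by (intro L0.mult_mem L0.add_mem L_inv)
      show "(x + y) * inverse x \<in> R" unfolding eq using that by (intro mem_intros)
    qed (use that in simp)
    moreover have "f (x + y) = f ((x + y) * inverse x) + f x"
      using that f_mult[of "(x + y) * inverse x" x] by (simp add: L0.mem_intros L_inv mult.assoc)
    ultimately show ?thesis by simp
  qed
  have f_add: "f (x + y) \<ge> min (f x) (f y)"
    if "x \<in> L" "y \<in> L" "x \<noteq> 0" "y \<noteq> 0" "x + y \<noteq> 0" for x y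
    using mem_or_inverse_mem[of "y / x"] f_add_aux[of x y] f_add_aux[of y x] that
    by (auto simp: add.commute)
  have f_base: "f (to_ac a) = int M * v a" if "a \<noteq> 0" for a
  proof (rule f_eqI)
    have "val_unit ((to_ac a * t powi (- v a)) ^ M)"
      using that by (intro val_unit_power unit_base)
    also have "(to_ac a * t powi (- v a)) ^ M = to_ac a ^ M * t powi (- (int M * v a))"
      using power_int_mult[of t "- v a" "int M"] by (simp add: power_mult_distrib mult.commute)
    finally show "val_unit (to_ac a ^ M * t powi (- (int M * v a)))" .
  qed (use that L in auto)
  have "f t = int M" unfolding t_def using f_base[of p] p by simp
  hence f_t: "f t > 0" using M by simp
  have t_L: "t \<in> L" using L by (auto simp: t_def)
  have "\<exists>g w. g > 0 \<and> discrete_valuation L w \<and> (\<forall>x\<in>L. x \<noteq> 0 \<longrightarrow> f x = g * w x)"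
  proof (rule normalize_valuation[of L f t, OF L(1)])
    show "f (x * y) = f x + f y" if "x \<in> L" "y \<in> L" "x \<noteq> 0" "y \<noteq> 0" for x y
      by (rule f_mult[OF that])
    show "min (f x) (f y) \<le> f (x + y)"
      if "x \<in> L" "y \<in> L" "x \<noteq> 0" "y \<noteq> 0" "x + y \<noteq> 0" for x y
      by (rule f_add[OF that])
  next
    fix g w assume "g > 0" "discrete_valuation L w" "\<And>x. x \<in> L \<Longrightarrow> x \<noteq> 0 \<Longrightarrow> f x = g * w x"
    thus ?thesis by blast
  qed (fact t_L t_nonzero f_t)+
  then obtain g w where g: "g > 0" and w: "discrete_valuation L w"
    and fw: "\<And>x. x \<in> L \<Longrightarrow> x \<noteq> 0 \<Longrightarrow> f x = g * w x" by blast
  define e where "e = w t"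
  have "int M = g * e"
    using fw[OF t_L t_nonzero] \<open>f t = int M\<close> by (simp add: e_def)
  hence "e > 0" using g M by (metis of_nat_0_less_iff zero_less_mult_pos)
  moreover have "w (to_ac x) = e * v x" if "x \<noteq> 0" for x
  proof -
    have "to_ac x \<in> L" using L(2) by auto
    hence "g * w (to_ac x) = g * (e * v x)"
      using fw[of "to_ac x"] f_base[OF that] that L \<open>int M = g * e\<close> by auto
    thus ?thesis using g by simp
  qed
  ultimately have "finite_extension_place v L w"
    unfolding finite_extension_place_def using L fin w by blast
  thus ?thesis by blast
qed

lemma eval_ring_of_type_algebra:
  "ring.eval (ring_of_type_algebra :: 'a::field ring) xs x = poly (Poly (rev xs)) x"
proof (induction xs)
  case Nil
  interpret R: field "ring_of_type_algebra :: 'a ring" by (rule field_from_type_algebra)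
  show ?case by simp
next
  case (Cons a xs)
  interpret R: field "ring_of_type_algebra :: 'a ring" by (rule field_from_type_algebra)
  have "x [^]\<^bsub>ring_of_type_algebra\<^esub> n = x ^ n" for n :: nat
    by (induction n) auto
  with Cons show ?case by (simp add: Poly_append poly_monom mult.commute)
qed

lemma algebraic_over_range_to_ac:
  fixes x :: "'k::field alg_closure"
  shows "(ring.algebraic ring_of_type_algebra over range to_ac) x"
proof -
  interpret R: field "ring_of_type_algebra :: 'k alg_closure ring" by (rule field_from_type_algebra)
  obtain p :: "'k poly" where p: "p \<noteq> 0" "poly (map_poly to_ac p) x = 0"
    by (rule alg_closure_algebraic)
  define q where "q = map_poly to_ac p"
  have q: "q \<noteq> 0" "poly q x = 0" using p by (auto simp: q_def poly_eq_iff coeff_map_poly)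
  define xs where "xs = rev (coeffs q)"
  have "set xs \<subseteq> range (Polynomial.coeff q)" by (auto simp: xs_def range_coeff)
  hence "set xs \<subseteq> range to_ac" by (auto simp: q_def coeff_map_poly)
  moreover have "xs \<noteq> []" "hd xs \<noteq> 0"
    using q(1) by (auto simp: xs_def hd_rev last_coeffs_eq_coeff_degree)
  ultimately have "xs \<in> carrier (univ_poly ring_of_type_algebra (range to_ac))"
    by (auto simp: univ_poly_def polynomial_def)
  moreover have "R.eval xs x = 0"
    using q(2) by (simp add: eval_ring_of_type_algebra xs_def)
  ultimately show ?thesis using \<open>xs \<noteq> []\<close> by (intro R.algebraicI) simp_all
qed

lemma exists_finite_extension_place:
  fixes v :: "'k::number_field \<Rightarrow> int" and xs :: "'k alg_closure list"
  assumes "nonarch_place v"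
  obtains L w where "finite_extension_place v L w" "set xs \<subseteq> L"
proof -
  interpret R: field "ring_of_type_algebra :: 'k alg_closure ring" by (rule field_from_type_algebra)
  define L where "L = R.finite_extension (range to_ac) xs"
  have alg: "\<And>x. x \<in> set xs \<Longrightarrow> (R.algebraic over range to_ac) x"
    by (rule algebraic_over_range_to_ac)
  have 1: "subfield L ring_of_type_algebra"
    unfolding L_def by (rule R.finite_extension_is_subfield[OF subfield_range_to_ac]) (auto intro: alg)
  have 2: "R.finite_dimension (range to_ac) L"
    unfolding L_def by (rule R.finite_extension_finite_dimension(1)[OF subfield_range_to_ac]) (auto intro: alg)
  have 3: "range to_ac \<subseteq> L"
    unfolding L_def using R.finite_extension_incl[OF subfieldE(3)[OF subfield_range_to_ac]] by auto
  have 4: "set xs \<subseteq> L"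
    unfolding L_def using R.finite_extension_mem[OF subfieldE(1)[OF subfield_range_to_ac]] by auto
  from exists_place_above[OF assms 1 3 2] 4 that show thesis by blast
qed


section \<open>Singular points and nodes of Weierstrass equations\<close>

text \<open>
  A homomorphism from a subring \<open>S\<close> of a ring type to a ring \<open>M\<close> given by a carrier set. It serves to
  carry polynomial identities, proved by normalization in a type, over to \<open>M\<close>.
\<close>

locale type_hom = type_subring S + M: cring M
  for S :: "'a::comm_ring_1 set" and M :: "('b, 'm) ring_scheme" (structure) and h :: "'a \<Rightarrow> 'b" +
  assumes hom: "h \<in> ring_hom (ring_of_type_algebra\<lparr>carrier := S\<rparr>) M"
begin

lemma h_closed: "x \<in> S \<Longrightarrow> h x \<in> carrier M"
  using ring_hom_closed[OF hom] by simp

lemma h_add: "x \<in> S \<Longrightarrow> y \<in> S \<Longrightarrow> h (x + y) = h x \<oplus> h y"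
  using ring_hom_add[OF hom, of x y] by simp

lemma h_mult: "x \<in> S \<Longrightarrow> y \<in> S \<Longrightarrow> h (x * y) = h x \<otimes> h y"
  using ring_hom_mult[OF hom, of x y] by simp

lemma h_1: "h 1 = \<one>"
  using ring_hom_one[OF hom] by simp

lemma h_0: "h 0 = \<zero>"
  using h_add[of 0 0] h_closed[of 0] by (simp add: M.add.r_cancel_one')

lemma h_uminus: "x \<in> S \<Longrightarrow> h (- x) = \<ominus> h x"
  using h_add[of "- x" x] h_0 h_closed
  by (intro M.minus_equality[symmetric]) (auto simp: uminus_mem)

lemma h_diff: "x \<in> S \<Longrightarrow> y \<in> S \<Longrightarrow> h (x - y) = h x \<oplus> \<ominus> h y"
  using h_add[of x "- y"] h_uminus[of y] by (simp add: uminus_mem)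

lemma of_nat_mem: "of_nat n \<in> S"
  by (induction n) (auto intro: mem_intros)

lemma numeral_mem: "numeral n \<in> S"
  using of_nat_mem[of "numeral n"] by simp

lemma h_of_nat: "h (of_nat n) = [n] \<cdot> \<one>"
  by (induction n) (simp_all add: h_0 h_1 h_add of_nat_mem M.a_comm)

lemma h_numeral: "h (numeral n) = [(numeral n :: nat)] \<cdot> \<one>"
  using h_of_nat[of "numeral n"] by simp

lemma h_power: "x \<in> S \<Longrightarrow> h (x ^ n) = h x [^] n"
  by (induction n) (simp_all add: h_1 h_mult power_mem M.m_comm h_closed)

lemmas h_simps = h_add h_mult h_1 h_0 h_uminus h_diff h_numeral h_power

end

lemma type_hom_poly_extension:
  fixes h :: "'a::comm_ring_1 \<Rightarrow> 'b" and M :: "('b, 'm) ring_scheme" (structure)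
  assumes "type_hom UNIV M h" and x: "x \<in> carrier M"
  shows "\<exists>H :: 'a poly \<Rightarrow> 'b. type_hom UNIV M H \<and> (\<forall>a. H [:a:] = h a) \<and> H [:0, 1:] = x"
proof -
  interpret type_hom UNIV M h by fact
  define H where "H p = fold_coeffs (\<lambda>a r. h a \<oplus> x \<otimes> r) p \<zero>" for p
  have H_0 [simp]: "H 0 = \<zero>" by (simp add: H_def)
  have H_pCons: "H (pCons a p) = h a \<oplus> x \<otimes> H p" for a p
    using x by (cases "pCons a p = 0") (auto simp: H_def h_0)
  have H_closed [simp]: "H p \<in> carrier M" for p
    by (induction p) (simp_all add: H_pCons x h_closed)
  have hc [simp]: "h a \<in> carrier M" for a by (simp add: h_closed)
  have H_const: "H [:a:] = h a" for a using x by (simp add: H_pCons)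
  have H_add: "H (p + q) = H p \<oplus> H q" for p q
  proof (induction p q rule: poly_induct2)
    case (pCons a p b q)
    thus ?case using x by (simp add: H_pCons h_add M.r_distr M.a_ac)
  qed simp
  have H_smult: "H (smult a q) = h a \<otimes> H q" for a q
    using x by (induction q) (simp_all add: H_pCons h_mult M.r_distr M.m_ac)
  have H_mult: "H (p * q) = H p \<otimes> H q" for p q
    using x by (induction p) (simp_all add: H_add H_smult H_pCons h_0 M.l_distr M.m_assoc)
  have "type_hom UNIV M H"
  proof unfold_locales
    show "H \<in> ring_hom (ring_of_type_algebra\<lparr>carrier := UNIV\<rparr>) M"
      using H_const[of 1] by (intro ring_hom_memI) (simp_all add: H_add H_mult h_1 one_pCons)
  qed auto
  moreover have "H [:0, 1:] = x" using x by (simp add: H_pCons h_0 h_1)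
  ultimately show ?thesis using H_const by blast
qed

lemma (in cring) type_hom_int: "type_hom (UNIV :: int set) R (\<lambda>n. [n] \<cdot> \<one>)"
proof unfold_locales
  show "(\<lambda>n :: int. [n] \<cdot> \<one>) \<in> ring_hom (ring_of_type_algebra\<lparr>carrier := UNIV\<rparr>) R"
  proof (rule ring_hom_memI)
    fix m n :: int
    have "[(m * n)] \<cdot> \<one> = [n] \<cdot> ([m] \<cdot> \<one>)" using add.int_pow_pow[of \<one> n m] by simp
    also have "\<dots> = ([m] \<cdot> \<one>) \<otimes> ([n] \<cdot> \<one>)" by (simp add: add_pow_rdistr_int)
    finally show "[(m \<otimes>\<^bsub>ring_of_type_algebra\<lparr>carrier := UNIV\<rparr>\<^esub> n)] \<cdot> \<one> = [m] \<cdot> \<one> \<otimes> [n] \<cdot> \<one>" by simp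
    show "[(m \<oplus>\<^bsub>ring_of_type_algebra\<lparr>carrier := UNIV\<rparr>\<^esub> n)] \<cdot> \<one> = [m] \<cdot> \<one> \<oplus> [n] \<cdot> \<one>"
      using add.int_pow_mult[of \<one> m n] by simp
  qed simp_all
qed auto

text \<open>Evaluation of integer polynomials in four variables at given elements of a commutative ring.\<close>

lemma (in cring) exists_evaluation4:
  assumes "a \<in> carrier R" "b \<in> carrier R" "c \<in> carrier R" "d \<in> carrier R"
  obtains H and A B C D :: "int poly poly poly poly"
  where "type_hom UNIV R H" "H A = a" "H B = b" "H C = c" "H D = d"
proof -
  obtain H1 :: "int poly \<Rightarrow> 'a" where H1: "type_hom UNIV R H1" "H1 [:0, 1:] = a"
    using type_hom_poly_extension[OF type_hom_int assms(1)] by blast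
  obtain H2 :: "int poly poly \<Rightarrow> 'a"
    where H2: "type_hom UNIV R H2" "\<And>a. H2 [:a:] = H1 a" "H2 [:0, 1:] = b"
    using type_hom_poly_extension[OF H1(1) assms(2)] by blast
  obtain H3 :: "int poly poly poly \<Rightarrow> 'a"
    where H3: "type_hom UNIV R H3" "\<And>a. H3 [:a:] = H2 a" "H3 [:0, 1:] = c"
    using type_hom_poly_extension[OF H2(1) assms(3)] by blast
  obtain H4 :: "int poly poly poly poly \<Rightarrow> 'a"
    where H4: "type_hom UNIV R H4" "\<And>a. H4 [:a:] = H3 a" "H4 [:0, 1:] = d"
    using type_hom_poly_extension[OF H3(1) assms(4)] by blast
  show thesis
    by (rule that[OF H4(1), of "[:[:[:[:0, 1:]:]:]:]" "[:[:[:0, 1:]:]:]" "[:[:0, 1:]:]" "[:0, 1:]"])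
       (simp_all add: H1 H2 H3 H4)
qed

text \<open>
  The discriminant and \<open>c\<^sub>4\<close> as functions of the coefficients over any commutative ring type; polynomial
  rings over \<open>\<int>\<close> are needed besides fields. (The invariant \<open>c\<^sub>4\<close> does not depend on \<open>a\<^sub>6\<close>.)
\<close>

definition discriminant_poly :: "'a::comm_ring_1 \<Rightarrow> 'a \<Rightarrow> 'a \<Rightarrow> 'a \<Rightarrow> 'a \<Rightarrow> 'a" where
  "discriminant_poly a1 a2 a3 a4 a6 =
     (let b2 = a1^2 + 4 * a2;
          b4 = 2 * a4 + a1 * a3;
          b6 = a3^2 + 4 * a6;
          b8 = a1^2 * a6 + 4 * a2 * a6 - a1 * a3 * a4 + a2 * a3^2 - a4^2
      in - (b2^2 * b8) - 8 * b4^3 - 27 * b6^2 + 9 * b2 * b4 * b6)"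

definition c4_poly :: "'a::comm_ring_1 \<Rightarrow> 'a \<Rightarrow> 'a \<Rightarrow> 'a \<Rightarrow> 'a" where
  "c4_poly a1 a2 a3 a4 = (a1^2 + 4 * a2)^2 - 24 * (2 * a4 + a1 * a3)"


lemma discriminant_eq: "discriminant (Weierstrass a1 a2 a3 a4 a6) = discriminant_poly a1 a2 a3 a4 a6"
  by (simp add: discriminant_poly_def)

lemma c4_invariant_eq: "c4_invariant (Weierstrass a1 a2 a3 a4 a6) = c4_poly a1 a2 a3 a4"
  by (simp add: c4_poly_def)

text \<open>
  The last three arguments are the values of \<open>a\<^sub>3\<close>, \<open>a\<^sub>4\<close> and \<open>a\<^sub>6\<close> that make \<open>(x, y)\<close> a singular point.
\<close>

lemma discriminant_poly_singular:
  fixes a1 a2 x y :: "'a::comm_ring_1"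
  shows "discriminant_poly a1 a2 (- (y + y + a1 * x)) (a1 * y - (x * x + x * x + x * x + a2 * x + a2 * x))
           (2 * x ^ 3 + a2 * x ^ 2 - y ^ 2 - a1 * x * y) = 0"
proof -
  define a3 where "a3 = - (y + y + a1 * x)"
  define a4 where "a4 = a1 * y - (x * x + x * x + x * x + a2 * x + a2 * x)"
  define a6 where "a6 = 2 * x ^ 3 + a2 * x ^ 2 - y ^ 2 - a1 * x * y"
  define b2 where "b2 = a1^2 + 4 * a2"
  have b4: "2 * a4 + a1 * a3 = - (6 * x ^ 2) - b2 * x"
    unfolding a3_def a4_def b2_def by (simp add: algebra_simps power2_eq_square)
  have b6: "a3^2 + 4 * a6 = b2 * x ^ 2 + 8 * x ^ 3"
    unfolding a3_def a6_def b2_def by (simp add: algebra_simps power2_eq_square power3_eq_cube)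
  have b8: "a1^2 * a6 + 4 * a2 * a6 - a1 * a3 * a4 + a2 * a3^2 - a4^2 = - (b2 * x ^ 3) - 9 * x ^ 4"
    unfolding a3_def a4_def a6_def b2_def
    by (simp add: algebra_simps power2_eq_square power3_eq_cube power4_eq_xxxx)
  have "discriminant_poly a1 a2 a3 a4 a6 = 0"
    unfolding discriminant_poly_def Let_def b4 b6 b8 b2_def[symmetric]
    by (simp add: algebra_simps power2_eq_square power3_eq_cube power4_eq_xxxx)
  thus ?thesis by (simp only: a3_def a4_def a6_def)
qed

text \<open>
  The arguments are the values of \<open>a\<^sub>1, \<dots>, a\<^sub>4\<close> that make \<open>(x, y)\<close> a singular point with tangent
  directions \<open>a\<close> and \<open>b\<close>.
\<close>

lemma c4_poly_node:
  fixes a b x y :: "'a::comm_ring_1"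
  shows "c4_poly (- (a + b)) (- (a * b) - (x + x + x)) (- (y + y + (- (a + b)) * x))
           ((- (a + b)) * y - (x * x + x * x + x * x + (- (a * b) - (x + x + x)) * x
              + (- (a * b) - (x + x + x)) * x)) = (a - b) ^ 4"
  unfolding c4_poly_def by (simp add: algebra_simps power2_eq_square power4_eq_xxxx)

lemma hom_discriminant_poly_cong:
  assumes "type_hom S M h" "type_hom S' M h'"
    and "a1 \<in> S" "a2 \<in> S" "a3 \<in> S" "a4 \<in> S" "a6 \<in> S"
    and "b1 \<in> S'" "b2 \<in> S'" "b3 \<in> S'" "b4 \<in> S'" "b6 \<in> S'"
    and "h a1 = h' b1" "h a2 = h' b2" "h a3 = h' b3" "h a4 = h' b4" "h a6 = h' b6"
  shows "h (discriminant_poly a1 a2 a3 a4 a6) = h' (discriminant_poly b1 b2 b3 b4 b6)"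
proof -
  interpret A: type_hom S M h by fact
  interpret B: type_hom S' M h' by fact
  show ?thesis
    using assms(3-) unfolding discriminant_poly_def Let_def
    by (simp add: A.h_simps B.h_simps A.mem_intros B.mem_intros A.numeral_mem B.numeral_mem)
qed

lemma hom_c4_poly_cong:
  assumes "type_hom S M h" "type_hom S' M h'"
    and "a1 \<in> S" "a2 \<in> S" "a3 \<in> S" "a4 \<in> S"
    and "b1 \<in> S'" "b2 \<in> S'" "b3 \<in> S'" "b4 \<in> S'"
    and "h a1 = h' b1" "h a2 = h' b2" "h a3 = h' b3" "h a4 = h' b4"
  shows "h (c4_poly a1 a2 a3 a4) = h' (c4_poly b1 b2 b3 b4)"
proof -
  interpret A: type_hom S M h by fact
  interpret B: type_hom S' M h' by fact
  show ?thesis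
    using assms(3-) unfolding c4_poly_def
    by (simp add: A.h_simps B.h_simps A.mem_intros B.mem_intros A.numeral_mem B.numeral_mem)
qed

lemma (in cring) eq_diffI:
  assumes "a \<oplus> b = c" "a \<in> carrier R" "b \<in> carrier R"
  shows "b = c \<oplus> \<ominus> a"
  using assms by (metis a_comm a_inv_closed add.inv_solve_right a_closed)

lemma (in cring) singular_point_coefficients:
  assumes "singular_point R (Weierstrass a1 a2 a3 a4 a6) x y"
    and "a1 \<in> carrier R" "a2 \<in> carrier R" "a3 \<in> carrier R" "a4 \<in> carrier R" "a6 \<in> carrier R"
  shows "a3 = \<ominus> (y \<oplus> y \<oplus> a1 \<otimes> x)"
    and "a4 = a1 \<otimes> y \<oplus> \<ominus> (x \<otimes> x \<oplus> x \<otimes> x \<oplus> x \<otimes> x \<oplus> a2 \<otimes> x \<oplus> a2 \<otimes> x)"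
    and "a6 = y \<otimes> y \<oplus> a1 \<otimes> x \<otimes> y \<oplus> a3 \<otimes> y \<oplus>
           \<ominus> (x \<otimes> x \<otimes> x \<oplus> a2 \<otimes> x \<otimes> x \<oplus> a4 \<otimes> x)"
proof -
  have xy: "x \<in> carrier R" "y \<in> carrier R" using assms(1) by auto
  have "(y \<oplus> y \<oplus> a1 \<otimes> x) \<oplus> a3 = \<zero>" using assms(1) by simp
  hence "a3 = \<zero> \<oplus> \<ominus> (y \<oplus> y \<oplus> a1 \<otimes> x)"
    using assms xy by (intro eq_diffI) auto
  thus "a3 = \<ominus> (y \<oplus> y \<oplus> a1 \<otimes> x)" using assms xy by simp
  have "(x \<otimes> x \<oplus> x \<otimes> x \<oplus> x \<otimes> x \<oplus> a2 \<otimes> x \<oplus> a2 \<otimes> x) \<oplus> a4 = a1 \<otimes> y"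
    using assms(1) by simp
  thus "a4 = a1 \<otimes> y \<oplus> \<ominus> (x \<otimes> x \<oplus> x \<otimes> x \<oplus> x \<otimes> x \<oplus> a2 \<otimes> x \<oplus> a2 \<otimes> x)"
    using assms xy by (intro eq_diffI) auto
  have "(x \<otimes> x \<otimes> x \<oplus> a2 \<otimes> x \<otimes> x \<oplus> a4 \<otimes> x) \<oplus> a6 = y \<otimes> y \<oplus> a1 \<otimes> x \<otimes> y \<oplus> a3 \<otimes> y"
    using assms(1) by simp
  thus "a6 = y \<otimes> y \<oplus> a1 \<otimes> x \<otimes> y \<oplus> a3 \<otimes> y \<oplus>
           \<ominus> (x \<otimes> x \<otimes> x \<oplus> a2 \<otimes> x \<otimes> x \<oplus> a4 \<otimes> x)"
    using assms xy by (intro eq_diffI) auto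
qed

lemma (in domain) nat_pow_nonzero: "a \<in> carrier R \<Longrightarrow> a \<noteq> \<zero> \<Longrightarrow> a [^] (n :: nat) \<noteq> \<zero>"
  by (induction n) (auto dest: integral)

text \<open>
  The point \<open>(x, y)\<close> need not lift to \<open>S\<close>. Both sides are therefore compared with a polynomial ring over
  \<open>\<int>\<close> in variables for \<open>a\<^sub>1, a\<^sub>2, x, y\<close>, where the identity holds identically.
\<close>

lemma (in type_hom) discriminant_singular:
  assumes "singular_point M (Weierstrass (h a1) (h a2) (h a3) (h a4) (h a6)) x y"
    and S: "a1 \<in> S" "a2 \<in> S" "a3 \<in> S" "a4 \<in> S" "a6 \<in> S"
  shows "h (discriminant_poly a1 a2 a3 a4 a6) = \<zero>"
proof -
  have xy: "x \<in> carrier M" "y \<in> carrier M" using assms(1) by auto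
  obtain H :: "int poly poly poly poly \<Rightarrow> 'b" and A1 A2 P Q
    where H: "type_hom UNIV M H" and eqs: "H A1 = h a1" "H A2 = h a2" "H P = x" "H Q = y"
    using M.exists_evaluation4[of "h a1" "h a2" x y] xy S h_closed by metis
  interpret U: type_hom UNIV M H by fact
  note c = M.singular_point_coefficients[OF assms(1) h_closed[OF S(1)] h_closed[OF S(2)]
      h_closed[OF S(3)] h_closed[OF S(4)] h_closed[OF S(5)]]
  define A3 where "A3 = - (Q + Q + A1 * P)"
  define A4 where "A4 = A1 * Q - (P * P + P * P + P * P + A2 * P + A2 * P)"
  define A6 where "A6 = Q * Q + A1 * P * Q + A3 * Q - (P * P * P + A2 * P * P + A4 * P)"
  have 3: "H A3 = h a3" unfolding c(1) A3_def by (simp only: U.h_simps eqs UNIV_I)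
  have 4: "H A4 = h a4" unfolding c(2) A4_def by (simp only: U.h_simps eqs UNIV_I)
  have 6: "H A6 = h a6" unfolding c(3) A6_def by (simp only: U.h_simps eqs 3 4 UNIV_I)
  have "h (discriminant_poly a1 a2 a3 a4 a6) = H (discriminant_poly A1 A2 A3 A4 A6)"
    using S eqs 3 4 6 by (intro hom_discriminant_poly_cong[OF type_hom_axioms H]) auto
  also have "A6 = 2 * P ^ 3 + A2 * P ^ 2 - Q ^ 2 - A1 * P * Q"
    unfolding A6_def A3_def A4_def by (simp add: algebra_simps power2_eq_square power3_eq_cube)
  also have "discriminant_poly A1 A2 A3 A4 (2 * P ^ 3 + A2 * P ^ 2 - Q ^ 2 - A1 * P * Q) = 0"
    unfolding A3_def A4_def by (rule discriminant_poly_singular)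
  finally show ?thesis by (simp add: U.h_0)
qed

text \<open>As before, with variables for the two tangent directions and for \<open>x, y\<close>.\<close>

lemma (in type_hom) c4_node:
  assumes "domain M"
    and node: "node M (Weierstrass (h a1) (h a2) (h a3) (h a4) (h a6)) x y"
    and S: "a1 \<in> S" "a2 \<in> S" "a3 \<in> S" "a4 \<in> S" "a6 \<in> S"
  shows "h (c4_poly a1 a2 a3 a4) \<noteq> \<zero>"
proof -
  interpret D: domain M by fact
  have sing: "singular_point M (Weierstrass (h a1) (h a2) (h a3) (h a4) (h a6)) x y"
    using node by simp
  have xy: "x \<in> carrier M" "y \<in> carrier M" using sing by auto
  obtain \<alpha> \<beta> where ab: "\<alpha> \<in> carrier M" "\<beta> \<in> carrier M" "\<alpha> \<noteq> \<beta>" "\<alpha> \<oplus> \<beta> = \<ominus> h a1"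
    "\<alpha> \<otimes> \<beta> = \<ominus> (x \<oplus> x \<oplus> x \<oplus> h a2)" using node by auto
  obtain H :: "int poly poly poly poly \<Rightarrow> 'b" and A B P Q
    where H: "type_hom UNIV M H" and eqs: "H A = \<alpha>" "H B = \<beta>" "H P = x" "H Q = y"
    using M.exists_evaluation4[of \<alpha> \<beta> x y] xy ab by metis
  interpret U: type_hom UNIV M H by fact
  note c = M.singular_point_coefficients[OF sing h_closed[OF S(1)] h_closed[OF S(2)]
      h_closed[OF S(3)] h_closed[OF S(4)] h_closed[OF S(5)]]
  define A1 where "A1 = - (A + B)"
  define A2 where "A2 = - (A * B) - (P + P + P)"
  define A3 where "A3 = - (Q + Q + A1 * P)"
  define A4 where "A4 = A1 * Q - (P * P + P * P + P * P + A2 * P + A2 * P)"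
  have "h a1 = \<ominus> (\<alpha> \<oplus> \<beta>)" using ab h_closed[OF S(1)] by simp
  hence 1: "H A1 = h a1" by (simp only: A1_def U.h_simps eqs UNIV_I)
  have "(x \<oplus> x \<oplus> x) \<oplus> h a2 = \<ominus> (\<alpha> \<otimes> \<beta>)" using ab xy h_closed[OF S(2)] by simp
  hence "h a2 = \<ominus> (\<alpha> \<otimes> \<beta>) \<oplus> \<ominus> (x \<oplus> x \<oplus> x)"
    using xy h_closed[OF S(2)] by (intro M.eq_diffI) auto
  hence 2: "H A2 = h a2" by (simp only: A2_def U.h_simps eqs UNIV_I)
  have 3: "H A3 = h a3" unfolding c(1) A3_def by (simp only: U.h_simps eqs 1 UNIV_I)
  have 4: "H A4 = h a4" unfolding c(2) A4_def by (simp only: U.h_simps eqs 1 2 UNIV_I)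
  have "h (c4_poly a1 a2 a3 a4) = H (c4_poly A1 A2 A3 A4)"
    using S 1 2 3 4 by (intro hom_c4_poly_cong[OF type_hom_axioms H]) auto
  also have "c4_poly A1 A2 A3 A4 = (A - B) ^ 4"
    unfolding A1_def A2_def A3_def A4_def by (rule c4_poly_node)
  also have "H \<dots> = (\<alpha> \<oplus> \<ominus> \<beta>) [^] (4 :: nat)" by (simp only: U.h_simps eqs UNIV_I)
  finally have eq: "h (c4_poly a1 a2 a3 a4) = (\<alpha> \<oplus> \<ominus> \<beta>) [^] (4 :: nat)" .
  have "\<alpha> \<oplus> \<ominus> \<beta> \<noteq> \<zero>" using ab M.r_right_minus_eq[of \<alpha> \<beta>] by (simp add: a_minus_def)
  thus ?thesis unfolding eq using ab by (intro D.nat_pow_nonzero) auto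
qed


section \<open>Reduction modulo the valuation ideal\<close>

context valued_field
begin

text \<open>The set underlying the valuation ring.\<close>

definition valuation_subring :: "'a set" where
  "valuation_subring = {x \<in> L. val_ge v 0 x}"

sublocale O: type_subring valuation_subring
  by unfold_locales (auto simp: valuation_subring_def intro: mem_intros val_ge_intros)

lemma valuation_ring_eq:
  "valuation_ring L v = ring_of_type_algebra\<lparr>carrier := valuation_subring\<rparr>"
  by (simp add: valuation_ring_def valuation_subring_def)

lemma cring_valuation_ring: "cring (valuation_ring L v)"
proof -
  interpret R: field "ring_of_type_algebra :: 'a ring" by (rule field_from_type_algebra)
  have "subring valuation_subring ring_of_type_algebra"
    by (intro R.subringI) (auto intro: O.mem_intros)
  hence "subcring valuation_subring ring_of_type_algebra" by (rule R.subcringI')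
  thus ?thesis unfolding valuation_ring_eq by (intro R.subcring_iff[THEN iffD1]) auto
qed

lemma valuation_ring_simps [simp]:
  "carrier (valuation_ring L v) = valuation_subring"
  "x \<otimes>\<^bsub>valuation_ring L v\<^esub> y = x * y"
  "x \<oplus>\<^bsub>valuation_ring L v\<^esub> y = x + y"
  "\<one>\<^bsub>valuation_ring L v\<^esub> = 1"
  "\<zero>\<^bsub>valuation_ring L v\<^esub> = 0"
  by (simp_all add: valuation_ring_eq)

lemma a_inv_valuation_ring:
  assumes "x \<in> valuation_subring"
  shows "\<ominus>\<^bsub>valuation_ring L v\<^esub> x = - x"
proof -
  interpret O': cring "valuation_ring L v" by (rule cring_valuation_ring)
  show ?thesis using assms by (intro O'.minus_equality) (auto intro: O.mem_intros)
qed

lemma valuation_ideal_subset: "valuation_ideal L v \<subseteq> valuation_subring"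
  by (auto simp: valuation_ideal_def valuation_subring_def intro: val_ge_mono)

lemma maximalideal_valuation_ideal: "maximalideal (valuation_ideal L v) (valuation_ring L v)"
proof -
  interpret O': cring "valuation_ring L v" by (rule cring_valuation_ring)
  have "ideal (valuation_ideal L v) (valuation_ring L v)"
  proof (rule idealI)
    show "subgroup (valuation_ideal L v) (add_monoid (valuation_ring L v))"
    proof (rule O'.add.subgroupI)
      have "0 \<in> valuation_ideal L v" by (simp add: valuation_ideal_def)
      thus "valuation_ideal L v \<noteq> {}" by blast
    next
      fix a assume a: "a \<in> valuation_ideal L v"
      with valuation_ideal_subset have "a \<in> valuation_subring" by blast
      hence "\<ominus>\<^bsub>valuation_ring L v\<^esub> a = - a" by (rule a_inv_valuation_ring)
      thus "\<ominus>\<^bsub>valuation_ring L v\<^esub> a \<in> valuation_ideal L v"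
        using a by (auto simp: valuation_ideal_def uminus_mem val_ge_uminus)
    qed (use valuation_ideal_subset in \<open>auto simp: valuation_ideal_def add_mem val_ge_add\<close>)
  next
    fix a x assume "a \<in> valuation_ideal L v" "x \<in> carrier (valuation_ring L v)"
    hence "a \<in> L" "val_ge v 1 a" "x \<in> L" "val_ge v 0 x"
      by (auto simp: valuation_ideal_def valuation_subring_def)
    thus "x \<otimes>\<^bsub>valuation_ring L v\<^esub> a \<in> valuation_ideal L v"
      and "a \<otimes>\<^bsub>valuation_ring L v\<^esub> x \<in> valuation_ideal L v"
      using val_ge_mult[of x a 0 1] val_ge_mult[of a x 1 0]
      by (auto simp: valuation_ideal_def mult_mem)
  qed (rule O'.ring_axioms)
  thus ?thesis
  proof (rule maximalidealI)
    have "1 \<in> carrier (valuation_ring L v)" "1 \<notin> valuation_ideal L v"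
      by (auto simp: valuation_ideal_def val_ge_def)
    thus "carrier (valuation_ring L v) \<noteq> valuation_ideal L v" by blast
  next
    fix J assume J: "ideal J (valuation_ring L v)" "valuation_ideal L v \<subseteq> J"
      "J \<subseteq> carrier (valuation_ring L v)"
    interpret J: ideal J "valuation_ring L v" by fact
    show "J = valuation_ideal L v \<or> J = carrier (valuation_ring L v)"
    proof (cases "J \<subseteq> valuation_ideal L v")
      case False
      then obtain x where x: "x \<in> J" "x \<notin> valuation_ideal L v" by blast
      hence "x \<in> L" "x \<noteq> 0" "v x = 0"
        using J(3) by (auto simp: valuation_ideal_def valuation_subring_def val_ge_def)
      moreover from this have "inverse x \<in> valuation_subring"
        by (auto simp: valuation_subring_def val_ge_def v_inverse inverse_mem)
      ultimately have "1 \<in> J" using J.I_l_closed[OF x(1), of "inverse x"] by simp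
      hence "J = carrier (valuation_ring L v)" using J.one_imp_carrier by simp
      thus ?thesis ..
    qed (use J(2) in blast)
  qed
qed

lemma field_residue_field: "field (residue_field L v)"
  unfolding residue_field_def
  by (rule maximalideal.quotient_is_field[OF maximalideal_valuation_ideal cring_valuation_ring])

text \<open>
  The reduction map from the valuation ring to the algebraic closure of the residue field. On
  elements outside the valuation ring its value has no meaning.
\<close>

definition reduction :: "'a \<Rightarrow> ('a set list \<times> nat) multiset \<Rightarrow> 'a set" where
  "reduction x = ring.indexed_const (residue_field L v)
     (valuation_ideal L v +>\<^bsub>valuation_ring L v\<^esub> x)"

lemma field_reduction_field: "field (reduction_field L v)"
proof -
  interpret F: field "residue_field L v" by (rule field_residue_field)
  show ?thesis
    using F.alg_closureE(1)
    by (simp add: reduction_field_def algebraic_closure_def algebraic_closure.axioms(1))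
qed

lemma reduction_hom: "reduction \<in> ring_hom (valuation_ring L v) (reduction_field L v)"
proof -
  interpret F: field "residue_field L v" by (rule field_residue_field)
  interpret I: maximalideal "valuation_ideal L v" "valuation_ring L v"
    by (rule maximalideal_valuation_ideal)
  have "F.indexed_const \<circ> (+>\<^bsub>valuation_ring L v\<^esub>) (valuation_ideal L v) \<in>
          ring_hom (valuation_ring L v) F.alg_closure"
    using I.rcos_ring_hom F.alg_closureE(2) unfolding residue_field_def[symmetric]
    by (rule ring_hom_trans)
  moreover have "reduction = F.indexed_const \<circ> (+>\<^bsub>valuation_ring L v\<^esub>) (valuation_ideal L v)"
    by (simp add: fun_eq_iff reduction_def)
  ultimately show ?thesis by (simp only: reduction_field_def)
qed

sublocale reduction: type_hom valuation_subring "reduction_field L v" reduction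
proof -
  interpret M: field "reduction_field L v" by (rule field_reduction_field)
  show "type_hom valuation_subring (reduction_field L v) reduction"
    by unfold_locales (use reduction_hom in \<open>simp add: valuation_ring_eq\<close>)
qed

lemma reduction_eq_0_iff:
  assumes "x \<in> valuation_subring"
  shows "reduction x = \<zero>\<^bsub>reduction_field L v\<^esub> \<longleftrightarrow> val_ge v 1 x"
proof -
  interpret F: field "residue_field L v" by (rule field_residue_field)
  interpret I: maximalideal "valuation_ideal L v" "valuation_ring L v"
    by (rule maximalideal_valuation_ideal)
  let ?I = "valuation_ideal L v" and ?O = "valuation_ring L v"
  have "reduction x = \<zero>\<^bsub>reduction_field L v\<^esub> \<longleftrightarrow> reduction x = reduction 0"
    by (simp add: reduction.h_0)
  also have "\<dots> \<longleftrightarrow> ?I +>\<^bsub>?O\<^esub> x = ?I +>\<^bsub>?O\<^esub> 0" by (simp add: reduction_def)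
  also have "?I +>\<^bsub>?O\<^esub> 0 = ?I" using I.a_rcos_const[of 0] by (simp add: valuation_ideal_def)
  also have "?I +>\<^bsub>?O\<^esub> x = ?I \<longleftrightarrow> x \<in> ?I"
    using I.a_rcos_const[of x] I.a_rcos_self[of x] assms by auto
  also have "\<dots> \<longleftrightarrow> val_ge v 1 x" using assms by (auto simp: valuation_ideal_def valuation_subring_def)
  finally show ?thesis .
qed

lemma reduced_curve_eq: "reduced_curve L v W = map_weierstrass reduction W"
  by (simp add: reduced_curve_def reduction_def[abs_def])

lemma O_numeral: "numeral n \<in> valuation_subring"
  by (rule reduction.numeral_mem)

lemma discriminant_poly_O:
  "a1 \<in> valuation_subring \<Longrightarrow> a2 \<in> valuation_subring \<Longrightarrow> a3 \<in> valuation_subring \<Longrightarrow>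
   a4 \<in> valuation_subring \<Longrightarrow> a6 \<in> valuation_subring \<Longrightarrow>
     discriminant_poly a1 a2 a3 a4 a6 \<in> valuation_subring"
  unfolding discriminant_poly_def Let_def by (intro O.mem_intros O_numeral)

lemma c4_poly_O:
  "a1 \<in> valuation_subring \<Longrightarrow> a2 \<in> valuation_subring \<Longrightarrow> a3 \<in> valuation_subring \<Longrightarrow>
   a4 \<in> valuation_subring \<Longrightarrow> c4_poly a1 a2 a3 a4 \<in> valuation_subring"
  unfolding c4_poly_def by (intro O.mem_intros O_numeral)

lemma integral_discriminant:
  assumes "set_weierstrass W \<subseteq> valuation_subring"
  shows "discriminant W \<in> valuation_subring"
  using assms by (cases W) (simp only: discriminant_eq, intro discriminant_poly_O, auto)

lemma integral_c4:
  assumes "set_weierstrass W \<subseteq> valuation_subring"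
  shows "c4_invariant W \<in> valuation_subring"
  using assms by (cases W) (simp only: c4_invariant_eq, intro c4_poly_O, auto)

lemma integral_model_iff:
  "integral_model L v E W \<longleftrightarrow>
     (\<exists>u\<in>L. \<exists>r\<in>L. \<exists>s\<in>L. \<exists>t\<in>L. u \<noteq> 0 \<and> W = change_of_variables u r s t E) \<and>
     set_weierstrass W \<subseteq> valuation_subring"
  by (auto simp: integral_model_def valuation_subring_def)

lemma singular_reduction:
  assumes "set_weierstrass W \<subseteq> valuation_subring"
    and "singular_point (reduction_field L v) (reduced_curve L v W) x y"
  shows "val_ge v 1 (discriminant W)"
proof (cases W)
  case (Weierstrass a1 a2 a3 a4 a6)
  have "reduction (discriminant W) = \<zero>\<^bsub>reduction_field L v\<^esub>"
    unfolding Weierstrass discriminant_eq using assms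
    by (intro reduction.discriminant_singular[of _ _ _ _ _ x y]) (auto simp: Weierstrass reduced_curve_eq)
  thus ?thesis using reduction_eq_0_iff[OF integral_discriminant[OF assms(1)]] by simp
qed

lemma node_reduction:
  assumes "set_weierstrass W \<subseteq> valuation_subring"
    and "node (reduction_field L v) (reduced_curve L v W) x y"
  shows "\<not> val_ge v 1 (c4_invariant W)" "val_ge v 1 (discriminant W)"
proof -
  interpret M: field "reduction_field L v" by (rule field_reduction_field)
  obtain a1 a2 a3 a4 a6 where W: "W = Weierstrass a1 a2 a3 a4 a6" by (cases W)
  have "reduction (c4_invariant W) \<noteq> \<zero>\<^bsub>reduction_field L v\<^esub>"
    unfolding W c4_invariant_eq using assms
    by (intro reduction.c4_node[of _ _ _ _ a6 x y] M.domain_axioms) (auto simp: W reduced_curve_eq)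
  thus "\<not> val_ge v 1 (c4_invariant W)"
    using reduction_eq_0_iff[OF integral_c4[OF assms(1)]] by simp
  show "val_ge v 1 (discriminant W)"
    using assms by (intro singular_reduction[of W x y]) (auto simp: W reduced_curve_eq)
qed

lemma integral_model_discriminant:
  assumes "integral_model L v E W" "discriminant E \<noteq> 0"
  shows "discriminant W \<noteq> 0"
proof -
  obtain u r s t where "u \<noteq> 0" "W = change_of_variables u r s t E"
    using assms(1) by (auto simp: integral_model_def)
  with discriminant_change_of_variables[of u E r s t] assms(2) show ?thesis by simp
qed

text \<open>At a node \<open>c\<^sub>4\<close> is a unit while the discriminant is not, so \<open>j = c\<^sub>4\<^sup>3 / \<Delta>\<close> is not integral.\<close>

lemma multiplicative_reduction_imp_j:
  assumes "multiplicative_reduction L v E" and E: "discriminant E \<noteq> 0"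
  shows "v (j_invariant E) < 0"
proof -
  obtain W x y where min: "minimal_model L v E W"
    and node: "node (reduction_field L v) (reduced_curve L v W) x y"
    using assms(1) by (auto simp: multiplicative_reduction_def)
  have int: "set_weierstrass W \<subseteq> valuation_subring" and im: "integral_model L v E W"
    using min by (auto simp: minimal_model_def integral_model_iff)
  obtain u r s t where u: "u \<noteq> 0" "W = change_of_variables u r s t E"
    using im by (auto simp: integral_model_def)
  have j: "j_invariant E = j_invariant W"
    using discriminant_change_of_variables[OF u(1), of E r s t]
      c4_invariant_change_of_variables[OF u(1), of E r s t] u
    by (simp add: j_invariant_def power_mult_distrib flip: power_mult)
  have d: "discriminant W \<noteq> 0" using integral_model_discriminant[OF im E] .
  have c4: "c4_invariant W \<in> L" "c4_invariant W \<noteq> 0" "v (c4_invariant W) = 0"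
    using node_reduction(1)[OF int node] integral_c4[OF int]
    by (auto simp: val_ge_def valuation_subring_def)
  moreover have "discriminant W \<in> L" "v (discriminant W) > 0"
    using node_reduction(2)[OF int node] integral_discriminant[OF int] d
    by (auto simp: val_ge_def valuation_subring_def)
  ultimately show ?thesis
    unfolding j using d by (simp add: j_invariant_def v_divide v_power power_mem)
qed

text \<open>An integral equation whose discriminant is a unit is minimal and reduces to a smooth curve.\<close>

lemma good_reductionI:
  assumes im: "integral_model L v E W" and d: "discriminant W \<noteq> 0" "v (discriminant W) = 0"
  shows "good_reduction L v E"
proof -
  have int: "set_weierstrass W \<subseteq> valuation_subring"
    using im by (simp add: integral_model_iff)
  have "minimal_model L v E W"
    unfolding minimal_model_def
  proof (intro conjI allI impI im)
    fix W' assume "integral_model L v E W'"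
    hence "discriminant W' \<in> valuation_subring"
      by (intro integral_discriminant) (simp add: integral_model_iff)
    thus "v (discriminant W) \<le> v (discriminant W')"
      using d by (auto simp: valuation_subring_def val_ge_def)
  qed
  moreover have "\<not> singular_point (reduction_field L v) (reduced_curve L v W) x y" for x y
    using singular_reduction[OF int, of x y] d by (auto simp: val_ge_def)
  ultimately show ?thesis unfolding good_reduction_def by blast
qed

text \<open>
  An integral equation with \<open>c\<^sub>4\<close> a unit is minimal: passing to another integral equation divides
  \<open>c\<^sub>4\<close> by \<open>u\<^sup>4\<close> and \<open>\<Delta>\<close> by \<open>u\<^sup>1\<^sup>2\<close>, so \<open>u\<close> cannot have positive valuation.
\<close>

lemma multiplicative_reductionI:
  assumes W: "set_weierstrass W \<subseteq> valuation_subring"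
    and c4: "c4_invariant W \<noteq> 0" "v (c4_invariant W) = 0" and d: "discriminant W \<noteq> 0"
    and node: "node (reduction_field L v) (reduced_curve L v W) x y"
  shows "multiplicative_reduction L v W"
proof -
  have "W = change_of_variables 1 0 0 0 W" by (cases W) simp
  hence "integral_model L v W W"
    using W zero_mem one_mem one_neq_zero unfolding integral_model_iff by blast
  moreover have "v (discriminant W) \<le> v (discriminant W')" if W': "integral_model L v W W'" for W'
  proof -
    from W' obtain u r s t where u: "u \<in> L" "u \<noteq> 0" "W' = change_of_variables u r s t W"
      by (auto simp: integral_model_def)
    have int: "set_weierstrass W' \<subseteq> valuation_subring" using W' by (simp add: integral_model_iff)
    have "c4_invariant W' \<in> valuation_subring" "discriminant W' \<in> valuation_subring"
      using int by (intro integral_c4 integral_discriminant; simp)+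
    hence L: "c4_invariant W' \<in> L" "discriminant W' \<in> L" "val_ge v 0 (c4_invariant W')"
      by (auto simp: valuation_subring_def)
    have eq: "c4_invariant W = u ^ 4 * c4_invariant W'" "discriminant W = u ^ 12 * discriminant W'"
      using c4_invariant_change_of_variables[OF u(2), of W r s t]
        discriminant_change_of_variables[OF u(2), of W r s t] u(3) by simp_all
    have nz: "c4_invariant W' \<noteq> 0" "discriminant W' \<noteq> 0" using eq c4 d by auto
    have "v (c4_invariant W) = 4 * v u + v (c4_invariant W')"
      unfolding eq using L u nz by (simp add: v_mult v_power power_mem)
    moreover have "v (discriminant W) = 12 * v u + v (discriminant W')"
      unfolding eq using L u nz by (simp add: v_mult v_power power_mem)
    ultimately show ?thesis using c4 nz L by (auto simp: val_ge_def)
  qed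
  ultimately have "minimal_model L v W W" by (simp add: minimal_model_def)
  with node show ?thesis unfolding multiplicative_reduction_def by blast
qed

end


section \<open>Curves with the same j-invariant, and curves of unit discriminant\<close>

text \<open>
  The invariant \<open>c\<^sub>6\<close>, normalized so that \<open>c\<^sub>4\<^sup>3 - c\<^sub>6\<^sup>2 = 1728 \<Delta>\<close>. Together with \<open>c\<^sub>4\<close> it determines
  a curve up to isomorphism in characteristic \<open>0\<close>.
\<close>

primrec c6_invariant :: "'a::field weierstrass \<Rightarrow> 'a" where
  "c6_invariant (Weierstrass a1 a2 a3 a4 a6) =
     (let b2 = a1^2 + 4 * a2;
          b4 = 2 * a4 + a1 * a3;
          b6 = a3^2 + 4 * a6
      in - (b2^3) + 36 * b2 * b4 - 216 * b6)"

lemma c4_c6_discriminant: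
  "c4_invariant W ^ 3 - c6_invariant W ^ 2 = 1728 * discriminant W"
proof (cases W)
  case (Weierstrass a1 a2 a3 a4 a6)
  define b2 where "b2 = a1^2 + 4 * a2"
  define b4 where "b4 = 2 * a4 + a1 * a3"
  define b6 where "b6 = a3^2 + 4 * a6"
  define b8 where "b8 = a1^2 * a6 + 4 * a2 * a6 - a1 * a3 * a4 + a2 * a3^2 - a4^2"
  note b = b2_def b4_def b6_def b8_def
  have b8: "4 * b8 = b2 * b6 - b4^2"
    unfolding b by (simp add: eval_nat_numeral algebra_simps)
  have "(b2^2 - 24 * b4)^3 - (- (b2^3) + 36 * b2 * b4 - 216 * b6)^2 =
      1728 * (- (b2^2 * b8) - 8 * b4^3 - 27 * b6^2 + 9 * b2 * b4 * b6)
      + 432 * b2^2 * (4 * b8 - (b2 * b6 - b4^2))"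
    by (simp add: eval_nat_numeral algebra_simps)
  also have "4 * b8 - (b2 * b6 - b4^2) = 0" using b8 by simp
  finally show ?thesis by (simp add: Weierstrass b Let_def)
qed

lemma c6_invariant_change_of_variables:
  assumes "u \<noteq> 0"
  shows "c6_invariant W = u ^ 6 * c6_invariant (change_of_variables u r s t W)"
proof (cases W)
  case (Weierstrass a1 a2 a3 a4 a6)
  define A1 where "A1 = a1 + 2 * s"
  define A2 where "A2 = a2 - s * a1 + 3 * r - s^2"
  define A3 where "A3 = a3 + r * a1 + 2 * t"
  define A4 where "A4 = a4 - s * a3 + 2 * r * a2 - (t + r * s) * a1 + 3 * r^2 - 2 * s * t"
  define A6 where "A6 = a6 + r * a4 + r^2 * a2 + r^3 - t * a3 - t^2 - r * t * a1"
  note A = A1_def A2_def A3_def A4_def A6_def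
  define b2 where "b2 = a1^2 + 4 * a2"
  define b4 where "b4 = 2 * a4 + a1 * a3"
  define b6 where "b6 = a3^2 + 4 * a6"
  note b = b2_def b4_def b6_def
  have 1: "A1^2 + 4 * A2 = b2 + 12 * r"
    and 2: "2 * A4 + A1 * A3 = b4 + r * b2 + 6 * r^2"
    and 3: "A3^2 + 4 * A6 = b6 + 2 * r * b4 + r^2 * b2 + 4 * r^3"
    unfolding A b by (simp_all add: eval_nat_numeral algebra_simps)
  have "c6_invariant (Weierstrass A1 A2 A3 A4 A6) = - (b2^3) + 36 * b2 * b4 - 216 * b6"
    unfolding c6_invariant.simps Let_def 1 2 3 by (simp add: eval_nat_numeral algebra_simps)
  also have "\<dots> = c6_invariant W" by (simp add: Weierstrass b Let_def)
  finally have "c6_invariant (Weierstrass A1 A2 A3 A4 A6) = c6_invariant W" .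
  moreover have "c6_invariant (Weierstrass A1 A2 A3 A4 A6) =
      u^6 * c6_invariant (Weierstrass (A1 / u) (A2 / u^2) (A3 / u^3) (A4 / u^4) (A6 / u^6))"
  proof -
    define B1 B2 B3 B4 B6
      where B: "B1 = A1 / u" "B2 = A2 / u^2" "B3 = A3 / u^3" "B4 = A4 / u^4" "B6 = A6 / u^6"
    have C: "A1 = u * B1" "A2 = u^2 * B2" "A3 = u^3 * B3" "A4 = u^4 * B4" "A6 = u^6 * B6"
      using assms by (simp_all add: B)
    show ?thesis
      unfolding B [symmetric] unfolding C c6_invariant.simps Let_def
      by (simp add: eval_nat_numeral algebra_simps)
  qed
  ultimately show ?thesis
    by (simp only: Weierstrass change_of_variables.simps A)
qed

text \<open>
  The parameters \<open>s\<close>, \<open>r\<close>, \<open>t\<close> are solved for so that \<open>a\<^sub>1\<close>, \<open>a\<^sub>2\<close>, \<open>a\<^sub>3\<close> match; \<open>c\<^sub>4\<close> and \<open>c\<^sub>6\<close> then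
  determine \<open>a\<^sub>4\<close> and \<open>a\<^sub>6\<close>.
\<close>

lemma change_of_variables_exists:
  fixes E W :: "'a::field_char_0 weierstrass"
  assumes L: "valued_field L v" and E: "set_weierstrass E \<subseteq> L" and W: "set_weierstrass W \<subseteq> L"
    and u: "u \<in> L" "u \<noteq> 0"
    and c4: "c4_invariant E = u ^ 4 * c4_invariant W"
    and c6: "c6_invariant E = u ^ 6 * c6_invariant W"
  shows "\<exists>r\<in>L. \<exists>s\<in>L. \<exists>t\<in>L. W = change_of_variables u r s t E"
proof -
  interpret valued_field L v by fact
  obtain a1 a2 a3 a4 a6 where Ea: "E = Weierstrass a1 a2 a3 a4 a6" by (cases E)
  obtain b1 b2 b3 b4 b6 where Wb: "W = Weierstrass b1 b2 b3 b4 b6" by (cases W)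
  have mem: "a1 \<in> L" "a2 \<in> L" "a3 \<in> L" "b1 \<in> L" "b2 \<in> L" "b3 \<in> L"
    using E W by (auto simp: Ea Wb)
  define s where "s = (u * b1 - a1) / 2"
  define r where "r = (u^2 * b2 - a2 + s * a1 + s^2) / 3"
  define t where "t = (u^3 * b3 - a3 - r * a1) / 2"
  have s: "s \<in> L" unfolding s_def using mem u by (intro mem_intros)
  have r: "r \<in> L" unfolding r_def using mem u s by (intro mem_intros)
  have t: "t \<in> L" unfolding t_def using mem u r by (intro mem_intros)
  obtain d1 d2 d3 d4 d6 where D: "change_of_variables u r s t E = Weierstrass d1 d2 d3 d4 d6"
    by (cases "change_of_variables u r s t E")
  have "u * d1 = a1 + 2 * s" using D u by (auto simp: Ea)
  also have "\<dots> = u * b1" by (simp add: s_def field_simps)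
  finally have d1: "d1 = b1" using u by simp
  have "u^2 * d2 = a2 - s * a1 + 3 * r - s^2" using D u by (auto simp: Ea)
  also have "\<dots> = u^2 * b2" by (simp add: r_def field_simps)
  finally have d2: "d2 = b2" using u by simp
  have "u^3 * d3 = a3 + r * a1 + 2 * t" using D u by (auto simp: Ea)
  also have "\<dots> = u^3 * b3" by (simp add: t_def field_simps)
  finally have d3: "d3 = b3" using u by simp
  have "u ^ 4 * c4_invariant (Weierstrass d1 d2 d3 d4 d6) = u ^ 4 * c4_invariant W"
    using c4_invariant_change_of_variables[OF u(2), of E r s t, symmetric] by (simp only: D c4)
  hence d4: "d4 = b4" using u by (simp add: Wb d1 d2 d3)
  have "u ^ 6 * c6_invariant (Weierstrass d1 d2 d3 d4 d6) = u ^ 6 * c6_invariant W"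
    using c6_invariant_change_of_variables[OF u(2), of E r s t, symmetric] by (simp only: D c6)
  hence d6: "d6 = b6" using u by (simp add: Wb d1 d2 d3 d4 Let_def)
  have "W = change_of_variables u r s t E" by (simp add: D Wb d1 d2 d3 d4 d6)
  with r s t show ?thesis by blast
qed

lemma c4_c6_j_invariant:
  assumes "discriminant W \<noteq> 0"
  shows "c4_invariant W ^ 3 = j_invariant W * discriminant W"
    and "c6_invariant W ^ 2 = (j_invariant W - 1728) * discriminant W"
proof -
  show c4: "c4_invariant W ^ 3 = j_invariant W * discriminant W"
    using assms by (simp add: j_invariant_def)
  show "c6_invariant W ^ 2 = (j_invariant W - 1728) * discriminant W"
    using c4_c6_discriminant[of W] unfolding c4 by (simp add: algebra_simps)
qed

text \<open>
  For \<open>j \<noteq> 0, 1728\<close> both \<open>c\<^sub>4\<close> and \<open>c\<^sub>6\<close> are nonzero, and two curves with the same \<open>j\<close> differ by a quadratic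
  twist; a square root \<open>u\<close> of the twisting factor gives the isomorphism.
\<close>

lemma twist_parameter_powers:
  fixes E W :: "'a::field weierstrass"
  assumes d: "discriminant E \<noteq> 0" "discriminant W \<noteq> 0" and j: "j_invariant W = j_invariant E"
    and j0: "j_invariant E \<noteq> 0" and j1: "j_invariant E \<noteq> 1728"
    and u: "u ^ 2 = c6_invariant E * c4_invariant W / (c6_invariant W * c4_invariant E)"
  shows "u \<noteq> 0" "c4_invariant E = u ^ 4 * c4_invariant W" "c6_invariant E = u ^ 6 * c6_invariant W"
proof -
  note E = c4_c6_j_invariant[OF d(1)] and W = c4_c6_j_invariant[OF d(2), unfolded j]
  have nz: "c4_invariant E \<noteq> 0" "c6_invariant E \<noteq> 0" "c4_invariant W \<noteq> 0" "c6_invariant W \<noteq> 0"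
    using E W d j0 j1 by (metis mult_eq_0_iff right_minus_eq zero_power zero_less_numeral)+
  show "u \<noteq> 0" using u nz by auto
  have "u ^ 4 = (u ^ 2) ^ 2" by (simp flip: power_mult)
  also have "\<dots> = (c6_invariant E ^ 2 * c4_invariant W ^ 2) / (c6_invariant W ^ 2 * c4_invariant E ^ 2)"
    unfolding u by (simp add: power_mult_distrib power_divide)
  also have "\<dots> = (discriminant E * c4_invariant W ^ 2) / (discriminant W * c4_invariant E ^ 2)"
    unfolding E(2) W(2) using j1 by simp
  finally have u4: "u ^ 4 = (discriminant E * c4_invariant W ^ 2) / (discriminant W * c4_invariant E ^ 2)" .
  have "u ^ 4 * c4_invariant W = discriminant E * c4_invariant W ^ 3 / (discriminant W * c4_invariant E ^ 2)"
    unfolding u4 by (simp add: power2_eq_square power3_eq_cube)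
  also have "\<dots> = c4_invariant E ^ 3 / c4_invariant E ^ 2"
    unfolding E(1) W(1) using d(2) by simp
  also have "\<dots> = c4_invariant E" using nz by (simp add: power2_eq_square power3_eq_cube)
  finally show c4: "c4_invariant E = u ^ 4 * c4_invariant W" by simp
  have "u ^ 6 * c6_invariant W = u ^ 2 * c6_invariant W * u ^ 4"
    by (simp add: mult_ac flip: power_add)
  also have "u ^ 2 * c6_invariant W = c6_invariant E * c4_invariant W / c4_invariant E"
    unfolding u using nz by simp
  also have "\<dots> * u ^ 4 = c6_invariant E"
    using c4 nz by (simp add: field_simps)
  finally show "c6_invariant E = u ^ 6 * c6_invariant W" by simp
qed

lemma good_reduction_same_j:
  fixes E W :: "'a::field_char_0 weierstrass"
  assumes L: "valued_field L v" and E: "set_weierstrass E \<subseteq> L"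
    and W: "set_weierstrass W \<subseteq> valued_field.valuation_subring L v"
    and d: "discriminant E \<noteq> 0" "discriminant W \<noteq> 0" "v (discriminant W) = 0"
    and j: "j_invariant W = j_invariant E" "j_invariant E \<noteq> 0" "j_invariant E \<noteq> 1728"
    and u: "u \<in> L" "u ^ 2 = c6_invariant E * c4_invariant W / (c6_invariant W * c4_invariant E)"
  shows "good_reduction L v E"
proof -
  interpret valued_field L v by fact
  have WL: "set_weierstrass W \<subseteq> L" using W by (auto simp: valuation_subring_def)
  note t = twist_parameter_powers[OF d(1,2) j u(2)]
  have "integral_model L v E W"
    unfolding integral_model_iff
    using change_of_variables_exists[OF L E WL u(1) t] u(1) t(1) W by blast
  thus ?thesis using d by (intro good_reductionI)
qed

context valued_field
begin

lemma v_not_val_ge_1: "val_ge v 0 x \<Longrightarrow> \<not> val_ge v 1 x \<Longrightarrow> x \<noteq> 0 \<and> v x = 0"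
  by (auto simp: val_ge_def)

text \<open>
  The equation says that the Deuring form with parameter \<open>a\<close>, of discriminant \<open>a\<^sup>3 - 27\<close>, has
  \<open>j\<close>-invariant \<open>J\<close>. If \<open>a\<close> were not integral, the left-hand side would have the smaller
  valuation. If \<open>a\<^sup>3\<close> were congruent to \<open>27\<close>, then \<open>a\<^sup>3\<close> and \<open>a\<^sup>3 - 24\<close>, congruent to \<open>3\<close>, would be
  units, but the right-hand side is not a unit.
\<close>

lemma deuring_parameter:
  assumes a: "a \<in> L" and J: "J \<in> L" "val_ge v 0 J" and 3: "\<not> val_ge v 1 3"
    and eq: "a ^ 3 * (a ^ 3 - 24) ^ 3 = J * (a ^ 3 - 27)"
  shows "val_ge v 0 a" "a ^ 3 - 27 \<noteq> 0" "v (a ^ 3 - 27) = 0"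
proof -
  define s where "s = a ^ 3"
  have s: "s \<in> L" using a by (simp add: s_def power_mem)
  note eq = eq[folded s_def]
  have v3: "v 3 = 0" "(3 :: 'a) \<noteq> 0" using v_not_val_ge_1[OF val_ge_numeral 3] by auto
  show a0: "val_ge v 0 a"
  proof (rule ccontr)
    assume "\<not> ?thesis"
    hence a_neg: "a \<noteq> 0" "v a < 0" by (auto simp: val_ge_def)
    hence s_neg: "s \<noteq> 0" "v s < 0" using a by (auto simp: s_def v_power)
    have *: "s - c \<noteq> 0 \<and> v (s - c) = v s" if "c \<in> L" "val_ge v 0 c" for c
    proof -
      have "val_ge v (v s + 1) (- c)"
        using s_neg that by (intro val_ge_mono[OF val_ge_uminus]) auto
      thus ?thesis using v_add_eq[of s "- c"] s s_neg that by (simp add: uminus_mem)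
    qed
    have lhs: "s * (s - 24) ^ 3 \<noteq> 0" "v (s * (s - 24) ^ 3) = 4 * v s"
      using *[OF numeral_mem val_ge_numeral] s s_neg
      by (auto simp: v_mult v_power mem_intros)
    hence "J \<noteq> 0" using eq by auto
    hence "v (J * (s - 27)) = v J + v s" "v J \<ge> 0"
      using *[OF numeral_mem val_ge_numeral] s J
      by (auto simp: v_mult mem_intros val_ge_def)
    with lhs s_neg show False unfolding eq by simp
  qed
  have s0: "val_ge v 0 s" unfolding s_def using a a0 by (rule val_ge_power)
  have "\<not> val_ge v 1 (s - 27)"
  proof
    assume m: "val_ge v 1 (s - 27)"
    have "v 27 = 0" using v_power[of 3 3] v3 by (simp add: numeral_mem)
    hence 27: "27 + (s - 27) \<noteq> 0" "v (27 + (s - 27)) = v 27"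
      using v_add_eq[of 27 "s - 27"] m s v_power[of 3 3] v3 \<open>(3 :: 'a) \<noteq> 0\<close> power_not_zero[of "3 :: 'a" 3]
      by (auto simp: mem_intros)
    have "3 + (s - 27) \<noteq> 0" "v (3 + (s - 27)) = v 3"
      using v_add_eq[of 3 "s - 27"] m s v3 by (auto simp: mem_intros)
    hence "s - 24 \<noteq> 0" "v (s - 24) = 0" using v3 by (simp_all add: algebra_simps)
    hence "s * (s - 24) ^ 3 \<noteq> 0" "v (s * (s - 24) ^ 3) = 0"
      using 27 \<open>v 27 = 0\<close> s by (auto simp: v_mult v_power mem_intros)
    moreover have "val_ge v (0 + 1) (J * (s - 27))" using J m s by (intro val_ge_mult mem_intros)
    ultimately show False unfolding eq by (simp add: val_ge_def)
  qed
  moreover have "val_ge v 0 (s - 27)" using s0 s by (intro val_ge_diff val_ge_numeral mem_intros)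
  ultimately have "s - 27 \<noteq> 0 \<and> v (s - 27) = 0" by (intro v_not_val_ge_1)
  thus "a ^ 3 - 27 \<noteq> 0" "v (a ^ 3 - 27) = 0" by (auto simp: s_def)
qed

text \<open>
  The equation says that the Legendre form with parameter \<open>l\<close>, of discriminant
  \<open>16 l\<^sup>2 (l - 1)\<^sup>2\<close>, has \<open>j\<close>-invariant \<open>J\<close>. The argument is the same; here
  \<open>l\<^sup>2 - l + 1 = 1 + l (l - 1)\<close> is a unit as soon as \<open>l (l - 1)\<close> is not.
\<close>

lemma legendre_parameter:
  assumes l: "l \<in> L" and J: "J \<in> L" "val_ge v 0 J" and 2: "\<not> val_ge v 1 2"
    and eq: "256 * (l ^ 2 - l + 1) ^ 3 = J * (l * (l - 1)) ^ 2"
  shows "val_ge v 0 l" "l * (l - 1) \<noteq> 0" "v (l * (l - 1)) = 0"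
proof -
  have v2: "v 2 = 0" "(2 :: 'a) \<noteq> 0" using v_not_val_ge_1[OF val_ge_numeral 2] by auto
  have v256: "v 256 = 0" "(256 :: 'a) \<noteq> 0"
    using v_power[of 2 8] v2 power_not_zero[of "2 :: 'a" 8] by (simp_all add: numeral_mem)
  show l0: "val_ge v 0 l"
  proof (rule ccontr)
    assume "\<not> ?thesis"
    hence neg: "l \<noteq> 0" "v l < 0" by (auto simp: val_ge_def)
    have l1: "l - 1 \<noteq> 0 \<and> v (l - 1) = v l"
    proof -
      have "val_ge v (v l + 1) (- 1)"
        using neg by (intro val_ge_mono[OF val_ge_uminus[OF one_mem val_ge_1]]) simp
      thus ?thesis using v_add_eq[of l "- 1"] l neg by (simp add: mem_intros)
    qed
    have "val_ge v (v (l ^ 2) + 1) (1 - l)"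
    proof (intro val_ge_diff)
      show "val_ge v (v (l ^ 2) + 1) 1" "val_ge v (v (l ^ 2) + 1) l"
        using neg l by (auto simp: val_ge_def v_power)
    qed (use l in auto)
    hence "l ^ 2 + (1 - l) \<noteq> 0" "v (l ^ 2 + (1 - l)) = 2 * v l"
      using v_add_eq[of "l ^ 2" "1 - l"] l neg by (auto simp: mem_intros v_power)
    moreover have "l ^ 2 + (1 - l) = l ^ 2 - l + 1" by simp
    ultimately have "l ^ 2 - l + 1 \<noteq> 0" "v (l ^ 2 - l + 1) = 2 * v l" by simp_all
    hence lhs: "256 * (l ^ 2 - l + 1) ^ 3 \<noteq> 0" "v (256 * (l ^ 2 - l + 1) ^ 3) = 6 * v l"
      using v256 l by (auto simp: v_mult v_power mem_intros)
    hence "J \<noteq> 0" using eq by auto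
    hence "v (J * (l * (l - 1)) ^ 2) = v J + 4 * v l" "v J \<ge> 0"
      using l1 l neg J by (auto simp: v_mult v_power mem_intros val_ge_def)
    with lhs neg show False unfolding eq by simp
  qed
  have "\<not> val_ge v 1 (l * (l - 1))"
  proof
    assume m: "val_ge v 1 (l * (l - 1))"
    have "1 + l * (l - 1) \<noteq> 0" "v (1 + l * (l - 1)) = 0"
      using v_add_eq[of 1 "l * (l - 1)"] m l by (auto simp: mem_intros)
    moreover have "1 + l * (l - 1) = l ^ 2 - l + 1" by (simp add: algebra_simps power2_eq_square)
    ultimately have "l ^ 2 - l + 1 \<noteq> 0" "v (l ^ 2 - l + 1) = 0" by simp_all
    hence "256 * (l ^ 2 - l + 1) ^ 3 \<noteq> 0" "v (256 * (l ^ 2 - l + 1) ^ 3) = 0"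
      using v256 l by (auto simp: v_mult v_power mem_intros)
    moreover have "val_ge v (0 + (1 + 1)) (J * ((l * (l - 1)) * (l * (l - 1))))"
      using J m l by (intro val_ge_mult mem_intros)
    hence "val_ge v 1 (J * (l * (l - 1)) ^ 2)"
      by (auto simp: power2_eq_square intro: val_ge_mono)
    ultimately show False unfolding eq by (simp add: val_ge_def)
  qed
  moreover have "val_ge v 0 (l * (l - 1))" using l0 l by (intro val_ge_intros mem_intros)
  ultimately have "l * (l - 1) \<noteq> 0 \<and> v (l * (l - 1)) = 0" by (intro v_not_val_ge_1)
  thus "l * (l - 1) \<noteq> 0" "v (l * (l - 1)) = 0" by auto
qed

end


section \<open>Potential reduction types and the j-invariant\<close>

lemma discriminant_map_to_ac: "discriminant (map_weierstrass to_ac W) = to_ac (discriminant W)"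
  and c4_invariant_map_to_ac: "c4_invariant (map_weierstrass to_ac W) = to_ac (c4_invariant W)"
  by (cases W; simp add: Let_def)+

lemma j_invariant_map_to_ac: "j_invariant (map_weierstrass to_ac W) = to_ac (j_invariant W)"
  by (simp add: j_invariant_def discriminant_map_to_ac c4_invariant_map_to_ac)

lemma discriminant_deuring: "discriminant (Weierstrass a 0 1 0 0) = a ^ 3 - 27"
  and c4_invariant_deuring: "c4_invariant (Weierstrass a 0 1 0 0) = a * (a ^ 3 - 24)"
  by (simp_all add: Let_def eval_nat_numeral algebra_simps)

lemma discriminant_legendre:
    "discriminant (Weierstrass 0 (- (1 + l)) 0 l 0) = 16 * (l * (l - 1)) ^ 2"
  and c4_invariant_legendre:
    "c4_invariant (Weierstrass 0 (- (1 + l)) 0 l 0) = 16 * (l ^ 2 - l + 1)"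
  by (simp_all add: Let_def eval_nat_numeral algebra_simps)

lemma finite_extension_place_valued_field:
  "finite_extension_place v L w \<Longrightarrow> valued_field L w"
  unfolding finite_extension_place_def by (intro valued_field.intro) auto

lemma map_weierstrass_to_ac_subset:
  "finite_extension_place v L w \<Longrightarrow> set_weierstrass (map_weierstrass to_ac E) \<subseteq> L"
  unfolding finite_extension_place_def by (auto simp: weierstrass.set_map)

lemma finite_extension_place_val_ge_iff:
  assumes "finite_extension_place v L w"
  shows "val_ge w 0 (to_ac x) \<longleftrightarrow> val_ge v 0 x" "val_ge w 1 (to_ac x) \<longleftrightarrow> val_ge v 1 x"
proof -
  obtain e where e: "e > 0" "\<And>x. x \<noteq> 0 \<Longrightarrow> w (to_ac x) = e * v x"
    using assms by (auto simp: finite_extension_place_def)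
  have "0 \<le> e * k \<longleftrightarrow> 0 \<le> k" "1 \<le> e * k \<longleftrightarrow> 1 \<le> k" for k :: int
    using e(1) by (simp_all add: zero_le_mult_iff zero_less_mult_iff int_one_le_iff_zero_less)
  thus "val_ge w 0 (to_ac x) \<longleftrightarrow> val_ge v 0 x" "val_ge w 1 (to_ac x) \<longleftrightarrow> val_ge v 1 x"
    by (cases "x = 0"; simp add: val_ge_def e)+
qed

text \<open>The polynomials in the next two proofs are the differences of the two sides, expanded.\<close>

lemma deuring_parameter_exists:
  fixes J :: "'a::alg_closed_field"
  obtains a where "a ^ 3 * (a ^ 3 - 24) ^ 3 = J * (a ^ 3 - 27)"
proof -
  obtain a where "poly [:27 * J, 0, 0, - 13824 - J, 0, 0, 1728, 0, 0, - 72, 0, 0, 1:] a = 0"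
    using alg_closed_imp_poly_has_root[of "[:27 * J, 0, 0, - 13824 - J, 0, 0, 1728, 0, 0, - 72, 0, 0, 1:]"]
    by auto
  hence "a ^ 3 * (a ^ 3 - 24) ^ 3 - J * (a ^ 3 - 27) = 0"
    by (simp add: eval_nat_numeral algebra_simps)
  with that show thesis by simp
qed

lemma legendre_parameter_exists:
  fixes J :: "'a::{alg_closed_field, field_char_0}"
  obtains l where "256 * (l ^ 2 - l + 1) ^ 3 = J * (l * (l - 1)) ^ 2"
proof -
  obtain l where "poly [:256, - 768, 1536 - J, - 1792 + 2 * J, 1536 - J, - 768, 256:] l = 0"
    using alg_closed_imp_poly_has_root[of "[:256, - 768, 1536 - J, - 1792 + 2 * J, 1536 - J, - 768, 256:]"]
    by auto
  hence "256 * (l ^ 2 - l + 1) ^ 3 - J * (l * (l - 1)) ^ 2 = 0"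
    by (simp add: eval_nat_numeral algebra_simps)
  with that show thesis by simp
qed

theorem potentially_good_reduction_if_j_integral:
  fixes E :: "'k::number_field weierstrass"
  assumes v: "nonarch_place v" and d: "discriminant E \<noteq> 0"
    and j: "j_invariant E \<noteq> 0" "j_invariant E \<noteq> 1728" and int: "val_ge v 0 (j_invariant E)"
  shows "potentially_good_reduction v E"
proof -
  interpret V: valued_field UNIV v using v by (intro valued_field_nonarch_place)
  define F where "F = map_weierstrass to_ac E"
  define J where "J = to_ac (j_invariant E)"
  have dF: "discriminant F \<noteq> 0" using d by (simp add: F_def discriminant_map_to_ac)
  have jF: "j_invariant F = J" by (simp add: F_def J_def j_invariant_map_to_ac)
  have J: "J \<noteq> 0" "J \<noteq> 1728"
    using j to_ac_eq_iff[of "j_invariant E" 1728] by (auto simp: J_def)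
  show ?thesis
  proof (cases "val_ge v 1 3")
    case False
    obtain a where a: "a ^ 3 * (a ^ 3 - 24) ^ 3 = J * (a ^ 3 - 27)" by (rule deuring_parameter_exists)
    define W where "W = Weierstrass a 0 1 0 0"
    obtain u where u: "u ^ 2 = c6_invariant F * c4_invariant W / (c6_invariant W * c4_invariant F)"
      using nth_root_exists[of 2] by auto
    obtain L w where Lw: "finite_extension_place v L w" "set [a, u] \<subseteq> L"
      using exists_finite_extension_place[OF v] by blast
    have vf: "valued_field L w" by (rule finite_extension_place_valued_field[OF Lw(1)])
    interpret valued_field L w by fact
    have J_L: "J \<in> L" using Lw(1) by (auto simp: J_def finite_extension_place_def)
    have J_int: "val_ge w 0 J"
      unfolding J_def finite_extension_place_val_ge_iff[OF Lw(1)] by (rule int)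
    have "\<not> val_ge w 1 3" using finite_extension_place_val_ge_iff(2)[OF Lw(1), of 3] False by simp
    note p = deuring_parameter[OF _ J_L J_int this a]
    have a_L: "a \<in> L" and u_L: "u \<in> L" using Lw(2) by auto
    note p = p[OF a_L]
    have "good_reduction L w F"
    proof (rule good_reduction_same_j[OF vf _ _ dF, of W u])
      show "set_weierstrass F \<subseteq> L"
        unfolding F_def by (rule map_weierstrass_to_ac_subset[OF Lw(1)])
      show "set_weierstrass W \<subseteq> valuation_subring"
        using a_L p by (auto simp: W_def valuation_subring_def)
      show "discriminant W \<noteq> 0" "w (discriminant W) = 0"
        using p unfolding W_def discriminant_deuring by simp_all
      have "j_invariant W = J"
        using p a unfolding W_def j_invariant_def discriminant_deuring c4_invariant_deuring
        by (simp add: power_mult_distrib)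
      thus "j_invariant W = j_invariant F" by (simp only: jF)
    qed (use jF J u u_L in auto)
    with Lw(1) show ?thesis unfolding potentially_good_reduction_def F_def by blast
  next
    case True
    have two: "\<not> val_ge v 1 2"
    proof
      assume "val_ge v 1 2"
      hence "val_ge v 1 (3 - 2)" using True by (intro V.val_ge_diff) auto
      thus False by (simp add: val_ge_def)
    qed
    obtain l where l: "256 * (l ^ 2 - l + 1) ^ 3 = J * (l * (l - 1)) ^ 2"
      by (rule legendre_parameter_exists)
    define W where "W = Weierstrass 0 (- (1 + l)) 0 l 0"
    obtain u where u: "u ^ 2 = c6_invariant F * c4_invariant W / (c6_invariant W * c4_invariant F)"
      using nth_root_exists[of 2] by auto
    obtain L w where Lw: "finite_extension_place v L w" "set [l, u] \<subseteq> L"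
      using exists_finite_extension_place[OF v] by blast
    have vf: "valued_field L w" by (rule finite_extension_place_valued_field[OF Lw(1)])
    interpret valued_field L w by fact
    have J_L: "J \<in> L" using Lw(1) by (auto simp: J_def finite_extension_place_def)
    have J_int: "val_ge w 0 J"
      unfolding J_def finite_extension_place_val_ge_iff[OF Lw(1)] by (rule int)
    have w2: "\<not> val_ge w 1 2" using finite_extension_place_val_ge_iff(2)[OF Lw(1), of 2] two by simp
    have l_L: "l \<in> L" and u_L: "u \<in> L" using Lw(2) by auto
    note p = legendre_parameter[OF l_L J_L J_int w2 l]
    have "w 2 = 0" using v_not_val_ge_1[OF val_ge_numeral w2] by simp
    hence w16: "w 16 = 0" using v_power[of 2 4] by (simp add: numeral_mem)
    have "good_reduction L w F"
    proof (rule good_reduction_same_j[OF vf _ _ dF, of W u])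
      show "set_weierstrass F \<subseteq> L"
        unfolding F_def by (rule map_weierstrass_to_ac_subset[OF Lw(1)])
      have "l \<in> valuation_subring" using l_L p by (simp add: valuation_subring_def)
      thus "set_weierstrass W \<subseteq> valuation_subring"
        by (auto simp del: add_uminus_conv_diff minus_add_distrib simp: W_def intro!: O.mem_intros)
      have "l * (l - 1) \<in> L" using l_L by (intro mem_intros)
      thus "discriminant W \<noteq> 0" "w (discriminant W) = 0"
        using p w16 unfolding W_def discriminant_legendre
        by (simp_all add: v_mult[OF numeral_mem power_mem] v_power del: mult_eq_0_iff)
      have "(16 * c) ^ 3 = 16 * (256 * c ^ 3)" for c :: "'k alg_closure"
        by (simp add: power_mult_distrib)
      hence "(16 * (l ^ 2 - l + 1)) ^ 3 = 16 * (256 * (l ^ 2 - l + 1) ^ 3)" .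
      also have "\<dots> = J * (16 * (l * (l - 1)) ^ 2)" unfolding l by simp
      finally have "j_invariant W = J"
        using p unfolding W_def j_invariant_def discriminant_legendre c4_invariant_legendre
        by simp
      thus "j_invariant W = j_invariant F" by (simp only: jF)
    qed (use jF J u u_L in auto)
    with Lw(1) show ?thesis unfolding potentially_good_reduction_def F_def by blast
  qed
qed

text \<open>
  A curve of given \<open>j\<close>-invariant \<open>j \<noteq> 0, 1728\<close> whose reduction is \<open>y\<^sup>2 + x y = x\<^sup>3\<close> wherever \<open>j\<close> is not
  integral. For \<open>j = 1728\<close> the coefficients degenerate because division by \<open>0\<close> yields \<open>0\<close>.
\<close>

definition tate_form :: "'a::field \<Rightarrow> 'a weierstrass" where
  "tate_form j = Weierstrass 1 0 0 (- 36 / (j - 1728)) (- 1 / (j - 1728))"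

lemma discriminant_tate_form:
  assumes "j \<noteq> 1728"
  shows "discriminant (tate_form j) = j ^ 2 / (j - 1728) ^ 3"
proof -
  define k where "k = j - 1728"
  have k: "k \<noteq> 0" "j = k + 1728" using assms by (auto simp: k_def)
  have "discriminant (tate_form j) * k ^ 3 = j ^ 2"
    unfolding tate_form_def k_def[symmetric] discriminant.simps Let_def using k(1)
    by (simp add: k(2) field_simps eval_nat_numeral)
  thus ?thesis using k(1) by (simp add: k_def field_simps)
qed

lemma c4_invariant_tate_form:
  assumes "j \<noteq> 1728"
  shows "c4_invariant (tate_form j) = j / (j - 1728)"
  using assms by (simp add: tate_form_def field_simps)

lemma j_invariant_tate_form:
  assumes "j \<noteq> 0" "j \<noteq> 1728"
  shows "j_invariant (tate_form j) = j"
  using assms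
  by (simp add: j_invariant_def discriminant_tate_form c4_invariant_tate_form power_divide
      power2_eq_square power3_eq_cube)

lemma map_weierstrass_to_ac_tate_form: "map_weierstrass to_ac (tate_form j) = tate_form (to_ac j)"
  by (simp add: tate_form_def)

theorem (in valued_field) multiplicative_reduction_tate_form:
  assumes J: "J \<in> L" "J \<noteq> 0" "v J < 0"
  shows "multiplicative_reduction L v (tate_form J)"
proof -
  interpret M: field "reduction_field L v" by (rule field_reduction_field)
  have "val_ge v (v J + 1) (- 1728)"
    using J by (intro val_ge_mono[OF val_ge_uminus[OF numeral_mem val_ge_numeral]]) simp
  hence k: "J - 1728 \<noteq> 0" "v (J - 1728) = v J"
    using v_add_eq[of J "- 1728"] J by (simp_all add: mem_intros)
  have inv: "inverse (J - 1728) \<in> L" "val_ge v 1 (inverse (J - 1728))"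
    using J k by (auto simp: val_ge_def v_inverse mem_intros)
  have "val_ge v (0 + 1) (c * inverse (J - 1728))" if "c \<in> L" "val_ge v 0 c" for c
    using that inv by (intro val_ge_mult)
  from this[of "- 1"] this[of "- 36"]
  have a: "val_ge v 1 (- 1 / (J - 1728))" "val_ge v 1 (- 36 / (J - 1728))"
    by (simp_all add: divide_inverse mem_intros val_ge_intros)
  have aL: "- 1 / (J - 1728) \<in> L" "- 36 / (J - 1728) \<in> L"
    by (intro mem_intros J(1))+
  have O: "- 1 / (J - 1728) \<in> valuation_subring" "- 36 / (J - 1728) \<in> valuation_subring"
    using a aL by (auto simp: valuation_subring_def intro: val_ge_mono)
  have red: "reduction (- 1 / (J - 1728)) = \<zero>\<^bsub>reduction_field L v\<^esub>"
    "reduction (- 36 / (J - 1728)) = \<zero>\<^bsub>reduction_field L v\<^esub>"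
    using reduction_eq_0_iff[OF O(1)] reduction_eq_0_iff[OF O(2)] a by simp_all
  have J1: "J \<noteq> 1728" using k(1) by simp
  show ?thesis
  proof (rule multiplicative_reductionI)
    show "set_weierstrass (tate_form J) \<subseteq> valuation_subring"
      using O by (simp add: tate_form_def)
    show "c4_invariant (tate_form J) \<noteq> 0" "v (c4_invariant (tate_form J)) = 0"
      using J k J1 by (simp_all add: c4_invariant_tate_form v_divide mem_intros)
    show "discriminant (tate_form J) \<noteq> 0"
      using J J1 by (simp add: discriminant_tate_form)
    have "\<one>\<^bsub>reduction_field L v\<^esub> \<noteq> \<zero>\<^bsub>reduction_field L v\<^esub>" by (rule M.one_not_zero)
    \<comment> \<open>The tangent directions of \<open>y\<^sup>2 + x y = x\<^sup>3\<close> at the origin are \<open>0\<close> and \<open>- 1\<close>.\<close>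
    hence tangents: "\<zero>\<^bsub>reduction_field L v\<^esub> \<noteq> \<ominus>\<^bsub>reduction_field L v\<^esub> \<one>\<^bsub>reduction_field L v\<^esub>"
      by (metis reduction.M.r_neg reduction.M.r_zero reduction.M.one_closed)
    have "reduced_curve L v (tate_form J) =
        Weierstrass \<one>\<^bsub>reduction_field L v\<^esub> \<zero>\<^bsub>reduction_field L v\<^esub> \<zero>\<^bsub>reduction_field L v\<^esub>
          \<zero>\<^bsub>reduction_field L v\<^esub> \<zero>\<^bsub>reduction_field L v\<^esub>"
      by (simp only: reduced_curve_eq tate_form_def weierstrass.map red reduction.h_0 reduction.h_1)
    thus "node (reduction_field L v) (reduced_curve L v (tate_form J))
        \<zero>\<^bsub>reduction_field L v\<^esub> \<zero>\<^bsub>reduction_field L v\<^esub>"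
      using tangents
      by (simp, intro bexI[of _ "\<zero>\<^bsub>reduction_field L v\<^esub>"]
          bexI[of _ "\<ominus>\<^bsub>reduction_field L v\<^esub> \<one>\<^bsub>reduction_field L v\<^esub>"]) simp_all
  qed
qed

theorem potentially_multiplicative_reduction_tate_form:
  fixes v :: "'k::number_field \<Rightarrow> int"
  assumes v: "nonarch_place v" and j: "j \<noteq> 0" "v j < 0"
  shows "potentially_multiplicative_reduction v (tate_form j)"
proof -
  obtain L w where Lw: "finite_extension_place v L w"
    using exists_finite_extension_place[OF v, of "[]"] by blast
  interpret valued_field L w by (rule finite_extension_place_valued_field[OF Lw])
  obtain e where e: "e > 0" "w (to_ac j) = e * v j"
    using Lw j(1) by (auto simp: finite_extension_place_def)
  have "to_ac j \<in> L" using Lw by (auto simp: finite_extension_place_def)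
  moreover have "w (to_ac j) < 0" using e j by (simp add: mult_pos_neg)
  ultimately have "multiplicative_reduction L w (tate_form (to_ac j))"
    using j by (intro multiplicative_reduction_tate_form) auto
  thus ?thesis
    unfolding potentially_multiplicative_reduction_def map_weierstrass_to_ac_tate_form[symmetric]
    using Lw by blast
qed

theorem potentially_multiplicative_reduction_imp_j:
  fixes E :: "'k::number_field weierstrass"
  assumes "potentially_multiplicative_reduction v E" "discriminant E \<noteq> 0" "j_invariant E \<noteq> 0"
  shows "v (j_invariant E) < 0"
proof -
  obtain L w where Lw: "finite_extension_place v L w"
    and m: "multiplicative_reduction L w (map_weierstrass to_ac E)"
    using assms(1) by (auto simp: potentially_multiplicative_reduction_def)
  interpret valued_field L w by (rule finite_extension_place_valued_field[OF Lw])
  obtain e where e: "e > 0" "w (to_ac (j_invariant E)) = e * v (j_invariant E)"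
    using Lw assms(3) by (auto simp: finite_extension_place_def)
  have "w (to_ac (j_invariant E)) < 0"
    using multiplicative_reduction_imp_j[OF m] assms(2)
    by (simp add: j_invariant_map_to_ac discriminant_map_to_ac)
  thus ?thesis using e by (simp add: mult_less_0_iff)
qed

theorem theorem10p2p2:
  fixes n :: nat
    and v :: "nat \<Rightarrow> 'k::number_field \<Rightarrow> int"
    and w :: "nat \<Rightarrow> 'l::number_field \<Rightarrow> int"
    and E :: "'k weierstrass"
  assumes "anabelomorphically_connected n v w"
    and "elliptic_curve E"
    and "j_invariant E \<noteq> 0" and "j_invariant E \<noteq> 1728"
    and "\<forall>i\<in>{1..n}. potentially_multiplicative_reduction (v i) E"
    and "\<forall>v'. nonarch_place v' \<and> v' \<notin> v ` {1..n} \<longrightarrow> potentially_good_reduction v' E"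
  shows "\<exists>E' :: 'l weierstrass.
           elliptic_curve E' \<and> j_invariant E' \<noteq> 0 \<and> j_invariant E' \<noteq> 1728 \<and>
           (\<forall>w'. nonarch_place w' \<and> w' \<notin> w ` {1..n} \<longrightarrow> potentially_good_reduction w' E') \<and>
           (\<forall>i\<in>{1..n}. v i (j_invariant E) = w i (j_invariant E')) \<and>
           (\<forall>i\<in>{1..n}. potentially_multiplicative_reduction (w i) E')"
proof -
  have w: "nonarch_place (w i)" if "i \<in> {1..n}" for i
    using assms(1) that by (auto simp: anabelomorphically_connected_def)
  have inj: "inj_on w {1..n}" using assms(1) by (simp add: anabelomorphically_connected_def)
  have neg: "v i (j_invariant E) < 0" if "i \<in> {1..n}" for i
    using assms(2,3,5) that
    by (intro potentially_multiplicative_reduction_imp_j) (auto simp: elliptic_curve_def)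
  have "\<exists>j. j \<noteq> 0 \<and> j \<noteq> 1728 \<and> (\<forall>i\<in>{1..n}. w i j = v i (j_invariant E)) \<and>
          (\<forall>w'. nonarch_place w' \<and> w' \<notin> w ` {1..n} \<longrightarrow> w' j \<ge> 0)"
  proof (cases "n = 0")
    case True
    have 1: "0 \<le> w' 1" if "nonarch_place w'" for w' :: "'l \<Rightarrow> int"
    proof -
      interpret valued_field UNIV w'
        using that by (intro valued_field_nonarch_place)
      show ?thesis by simp
    qed
    show ?thesis
    proof (intro exI[of _ 1] conjI)
      show "\<forall>w'. nonarch_place w' \<and> w' \<notin> w ` {1..n} \<longrightarrow> 0 \<le> w' 1" using 1 by blast
    qed (use True in simp_all)
  next
    case False
    define t where "t = (\<lambda>w'. v (inv_into {1..n} w w') (j_invariant E))"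
    have t: "t (w i) = v i (j_invariant E)" if "i \<in> {1..n}" for i
      using inj that by (simp add: t_def)
    have "\<exists>j. j \<noteq> 0 \<and> (\<forall>w'\<in>w ` {1..n}. w' j = t w') \<and>
            (\<forall>w'. nonarch_place w' \<and> w' \<notin> w ` {1..n} \<longrightarrow> w' j \<ge> 0)"
      by (rule exists_prescribed_valuations) (use w in auto)
    then obtain j where j: "j \<noteq> 0" "\<forall>w'\<in>w ` {1..n}. w' j = t w'"
      "\<forall>w'. nonarch_place w' \<and> w' \<notin> w ` {1..n} \<longrightarrow> w' j \<ge> 0" by blast
    have val: "w i j = v i (j_invariant E)" if "i \<in> {1..n}" for i using j(2) t that by auto
    have "j \<noteq> 1728"
    proof
      assume "j = 1728"
      interpret valued_field UNIV "w 1"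
        using False by (intro valued_field_nonarch_place w) simp
      have "w 1 j \<ge> 0" using val_ge_numeral[of _] j(1) unfolding \<open>j = 1728\<close> by (auto simp: val_ge_def)
      thus False using val[of 1] neg[of 1] False by simp
    qed
    with j val show ?thesis by blast
  qed
  then obtain j where j: "j \<noteq> 0" "j \<noteq> 1728" "\<And>i. i \<in> {1..n} \<Longrightarrow> w i j = v i (j_invariant E)"
    "\<And>w'. nonarch_place w' \<Longrightarrow> w' \<notin> w ` {1..n} \<Longrightarrow> w' j \<ge> 0" by blast
  have d: "discriminant (tate_form j) \<noteq> 0" using j by (simp add: discriminant_tate_form)
  have jj: "j_invariant (tate_form j) = j" using j by (intro j_invariant_tate_form)
  show ?thesis
  proof (intro exI[of _ "tate_form j"] conjI allI ballI impI)
    show "elliptic_curve (tate_form j)" using d by (simp add: elliptic_curve_def)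
    show "j_invariant (tate_form j) \<noteq> 0" "j_invariant (tate_form j) \<noteq> 1728" using jj j by auto
    show "v i (j_invariant E) = w i (j_invariant (tate_form j))" if "i \<in> {1..n}" for i
      using jj j(3)[OF that] by simp
    show "potentially_multiplicative_reduction (w i) (tate_form j)" if "i \<in> {1..n}" for i
      using w[OF that] j(1) j(3)[OF that] neg[OF that]
      by (intro potentially_multiplicative_reduction_tate_form) auto
    show "potentially_good_reduction w' (tate_form j)"
      if "nonarch_place w' \<and> w' \<notin> w ` {1..n}" for w'
      using that j jj d
      by (intro potentially_good_reduction_if_j_integral) (auto simp: val_ge_def)
  qed
qed


end
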